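(* Let $d>1$ and $Q>0$ be real constants, let $q_1,q_2,\dots$ be positive real numbers with $q_j=Qj^{d-1}(1+o(1))$ as $j\to\infty$, let $q_0\ge1$ be a real number, and let $\chi:[0,\infty)\to(0,\infty)$ be a function with $\chi(x)\to\infty$ as $x\to\infty$ (arbitrarily slowly). Then there exist constants $C_s>0$, $s=1,2,\dots$, such that for all positive integers $M$ and $N$ with $N>\overline{N}(M)$ and every sequence $\{f_j\}_{j=0}^\infty$ of complex numbers with $\sup_j|f_j|\le1$, $$\mathsf{P}_{M,N}\biggl(\biggl|\sum_{j=0}^\infty f_j(N_j-\overline{N}_j)\biggr|>\Delta\biggr)\le C_s\overline{N}^{-s},\qquad s=1,2,\dots,$$ where $\overline{N}=\overline{N}(M)$, $\overline{N}_j$, $\Delta$ and $\mathsf{P}_{M,N}$ are as defined in the context.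
   Context: For integers $M,N\ge0$, $\Omega_{M,N}$ is the (finite) set of all sequences $\{N_j\}_{j=0}^\infty$ of nonnegative integers with $\sum_{j=0}^\infty N_j=N$ and $\sum_{j=0}^\infty jN_j\le M$. Each sequence has weight $W(\{N_j\})=\prod_{j=0}^\infty\binom{N_j+q_j-1}{N_j}$, where $\binom zn=\prod_{i=0}^{n-1}\frac{z-i}{n-i}$ is the generalized binomial coefficient (equal to $1$ for $n=0$). For $\mathcal{A}\subset\Omega_{M,N}$ put $W(\mathcal{A})=\sum_{\{N_j\}\in\mathcal{A}}W(\{N_j\})$ and $\mathsf{P}_{M,N}(\mathcal{A})=W(\mathcal{A})/W(\Omega_{M,N})$; a condition inside $\mathsf{P}_{M,N}(\cdot)$ denotes the set of sequences satisfying it. For $M>0$, $b=b(M)>0$ is the unique solution of $\sum_{j=1}^\infty\frac{jq_j}{e^{bj}-1}=M$, and $\overline{N}=\overline{N}(M)=\sum_{j=1}^\infty\frac{q_j}{e^{bj}-1}$. Set $\overline{N}_j=\frac{q_j}{e^{bj}-1}$ for $j\ge1$ and $\overline{N}_0=N-\overline{N}$. Set $\Delta=(\overline{N}\ln\overline{N})^{1/2}\chi(\overline{N})$ if $d>2$, and $\Delta=\overline{N}^{1/d}\ln\overline{N}\,\chi(\overline{N})$ if $1<d\le2$. Convention: for the finitely many $M$ with $\overline{N}(M)<1$, when $d>2$, $(\overline{N}\ln\overline{N})^{1/2}$ is read as $0$. *)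

theory Defs
  imports Complex_Main "HOL-Library.Landau_Symbols"
begin

text \<open>A sequence of nonnegative integers with a finite sum has finite support, so the
  infinite sums and the infinite product (whose factors with \<open>n j = 0\<close> equal 1) are
  taken over the support.\<close>

definition Omega :: "nat \<Rightarrow> nat \<Rightarrow> (nat \<Rightarrow> nat) set" where
  "Omega M N = {n. finite {j. n j \<noteq> 0} \<and>
                   (\<Sum>j | n j \<noteq> 0. n j) = N \<and>
                   (\<Sum>j | n j \<noteq> 0. j * n j) \<le> M}"

definition weight :: "(nat \<Rightarrow> real) \<Rightarrow> (nat \<Rightarrow> nat) \<Rightarrow> real" where
  "weight q n = (\<Prod>j | n j \<noteq> 0. (real (n j) + q j - 1) gchoose n j)"

definition weight_set :: "(nat \<Rightarrow> real) \<Rightarrow> (nat \<Rightarrow> nat) set \<Rightarrow> real" where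
  "weight_set q A = (\<Sum>n\<in>A. weight q n)"

text \<open>Intended for \<open>A \<subseteq> Omega M N\<close>.\<close>

definition Prob :: "(nat \<Rightarrow> real) \<Rightarrow> nat \<Rightarrow> nat \<Rightarrow> (nat \<Rightarrow> nat) set \<Rightarrow> real" where
  "Prob q M N A = weight_set q A / weight_set q (Omega M N)"

text \<open>Sums over \<open>j \<ge> 1\<close> are indexed by \<open>Suc i\<close>; the value \<open>q 0\<close> does not enter.\<close>

definition b_of :: "(nat \<Rightarrow> real) \<Rightarrow> nat \<Rightarrow> real" where
  "b_of q M = (THE b. b > 0 \<and>
     (\<lambda>i. real (Suc i) * q (Suc i) / (exp (b * real (Suc i)) - 1)) sums real M)"

definition Nbar :: "(nat \<Rightarrow> real) \<Rightarrow> nat \<Rightarrow> real" where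
  "Nbar q M = (\<Sum>i. q (Suc i) / (exp (b_of q M * real (Suc i)) - 1))"

definition Nbar_at :: "(nat \<Rightarrow> real) \<Rightarrow> nat \<Rightarrow> nat \<Rightarrow> nat \<Rightarrow> real" where
  "Nbar_at q M N j =
     (if j = 0 then real N - Nbar q M else q j / (exp (b_of q M * real j) - 1))"

text \<open>\<open>Delta d \<chi> x\<close> is the deviation threshold at \<open>x = Nbar q M\<close>. For \<open>d > 2\<close> and
  \<open>x < 1\<close> the radicand \<open>x * ln x\<close> is negative and the root is read as \<open>0\<close>.\<close>

definition Delta :: "real \<Rightarrow> (real \<Rightarrow> real) \<Rightarrow> real \<Rightarrow> real" where
  "Delta d \<chi> x =
     (if d > 2 then (if x < 1 then 0 else sqrt (x * ln x)) * \<chi> x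
      else x powr (1 / d) * ln x * \<chi> x)"

end

theory Submission
  imports Defs "HOL-Analysis.Generalised_Binomial_Theorem" "HOL-Computational_Algebra.Formal_Power_Series" "HOL-Real_Asymp.Real_Asymp"
begin

text \<open>
  Write \<open>S\<close> and \<open>E\<close> for the number and the energy of the particles above level 0. The weight of level 0
  is increasing and submultiplicative, so up to a factor polynomial in \<open>Nbar\<close> the probability is at most
  the weight of the deviating configurations with \<open>E \<le> M\<close>, divided by that of the configurations with
  \<open>E\<close> within 2 of \<open>M\<close> and \<open>S \<le> Nbar\<close>. Compare both with \<open>exp (b M) Z\<close>, where \<open>Z\<close> is the partition function at \<open>b\<close>.
  The numerator is at most \<open>exp (b M) Z\<close> times a superpolynomially small factor, by the exponential
  Markov inequality for independent negative binomial variables. The denominator is at least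
  \<open>b\<^sup>K exp (b M) Z\<close>: after a tilt by \<open>exp (- \<mu> S + \<beta> E)\<close> that keeps the mean energy but lowers the mean of
  \<open>S\<close> by at most logarithmically many standard deviations, the energy hits its mean with polynomially small
  probability, and undoing the tilt costs a power of \<open>b\<close>. As \<open>ln Nbar\<close> is of order \<open>ln (1 / b)\<close>, the
  superpolynomial factor wins; the finitely many \<open>M\<close> with \<open>b\<close> not small are absorbed in the constants.
\<close>

unbundle no vec_syntax \<comment> \<open>frees the symbol \<open>\<chi>\<close>\<close>

section \<open>The Bose function and its convexity\<close>

text \<open>Since \<chi> may grow arbitrarily slowly, the Markov bound gains only a factor
  \<open>b powr (c * \<chi> x)\<close>. Every other step may therefore lose at most a power of
  \<open>b\<close> whose exponent does not depend on \<chi>; such powers are cheap, which is why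
  crude bounds are enough elsewhere. The restriction \<open>S \<le> Nbar\<close> in the denominator
  comes from the hypothesis on \<open>N\<close>: a configuration above level 0 extends to
  \<open>Omega M N\<close> only if it has at most \<open>N\<close> particles, and \<open>N\<close>
  may barely exceed \<open>Nbar\<close>. This event must be combined with one exact value of
  \<open>E\<close>, and for \<open>d < 2\<close> the fluctuations of \<open>S\<close> are dominated
  by the lowest levels, so a normal approximation is not at hand. Forcing \<open>S\<close> well
  below its mean avoids it. The strength \<mu> of the tilt is fixed implicitly, through the size of
  a cumulant, because the dependence of that cumulant on \<mu> changes its form at
  \<open>d = 2\<close>. All products run over levels \<open>1..J\<close> with \<open>J\<close> large
  depending on \<open>M\<close>. The truncated mean energy is then below \<open>M\<close> by less
  than 1, and rounding it to an integer loses less than 1 more; this is the distance 2.\<close>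

definition bose :: "real \<Rightarrow> real" where
  "bose y = 1 / (exp y - 1)"

definition bvar :: "real \<Rightarrow> real" where
  "bvar y = exp y / (exp y - 1)\<^sup>2"

text \<open>Log-partition function of a geometric variable with ratio \<open>exp (- y)\<close>. Its
  derivative is \<open>- bose\<close>, and that of \<open>bose\<close> is \<open>- bvar\<close>, so
  \<open>bose\<close> and \<open>bvar\<close> are the mean and the variance.\<close>

definition phi :: "real \<Rightarrow> real" where
  "phi y = - ln (1 - exp (- y))"

text \<open>The centred cumulant generating function: the logarithm of the expectation of
  \<open>exp (- u * (X - E X))\<close> for the geometric variable \<open>X\<close> at
  \<open>y\<close>. It is also the gap between the convex function \<open>phi\<close> and its
  tangent at \<open>y\<close>.\<close>

definition psi :: "real \<Rightarrow> real \<Rightarrow> real" where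
  "psi y u = phi (y + u) - phi y + u * bose y"

lemma bose_pos: "y > 0 \<Longrightarrow> bose y > 0"
  by (simp add: bose_def)

lemma bvar_pos: "y > 0 \<Longrightarrow> bvar y > 0"
  by (simp add: bvar_def)

lemma bvar_eq: "y > 0 \<Longrightarrow> bvar y = bose y + (bose y)\<^sup>2"
proof -
  assume "y > 0"
  then have "exp y - 1 \<noteq> 0" by simp
  then show ?thesis unfolding bvar_def bose_def
    by (simp add: divide_simps power2_eq_square)
qed

lemma bose_antimono: "0 < x \<Longrightarrow> x \<le> y \<Longrightarrow> bose y \<le> bose x"
  by (simp add: bose_def divide_left_mono)

lemma bvar_antimono: "0 < x \<Longrightarrow> x \<le> y \<Longrightarrow> bvar y \<le> bvar x"
  using bose_antimono[of x y] bose_pos[of y] by (simp add: bvar_eq add_mono power_mono)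

lemma bose_geometric: "y > 0 \<Longrightarrow> bose y = exp (- y) / (1 - exp (- y))"
  by (simp add: bose_def exp_minus divide_simps)

lemma DERIV_bose [derivative_intros]:
  assumes "(g has_real_derivative g') (at x)" "g x > 0"
  shows "((\<lambda>x. bose (g x)) has_real_derivative (- bvar (g x) * g')) (at x)"
proof -
  have "exp (g x) - 1 \<noteq> 0" using assms(2) by simp
  then show ?thesis unfolding bose_def bvar_def
    by (auto intro!: derivative_eq_intros assms simp: power2_eq_square)
qed

lemma DERIV_phi [derivative_intros]:
  assumes "(g has_real_derivative g') (at x)" "g x > 0"
  shows "((\<lambda>x. phi (g x)) has_real_derivative (- bose (g x) * g')) (at x)"
  unfolding phi_def bose_geometric[OF assms(2)] using assms(2)
  by (auto intro!: derivative_eq_intros assms simp: field_simps)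

text \<open>Second-order Taylor expansion of \<open>phi\<close> at \<open>y\<close>. It turns every
  quadratic bound on \<open>psi\<close> into monotonicity of \<open>bvar\<close>.\<close>

lemma psi_Lagrange:
  assumes "y > 0" "y + u > 0"
  shows "\<exists>\<xi>. min y (y + u) \<le> \<xi> \<and> \<xi> \<le> max y (y + u) \<and> psi y u = u\<^sup>2 / 2 * bvar \<xi>"
proof (cases "u = 0")
  case True
  then show ?thesis by (auto simp: psi_def)
next
  case False
  define D where "D m = (if m = 0 then phi else if m = 1 then (\<lambda>t. - bose t) else bvar)" for m :: nat
  have "\<exists>t. (if y + u < y then y + u < t \<and> t < y else y < t \<and> t < y + u) \<and>
      phi (y + u) = (\<Sum>m<2. D m y / fact m * (y + u - y) ^ m) + D 2 t / fact 2 * (y + u - y) ^ 2"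
  proof (rule Taylor[where a = "min y (y + u)" and b = "max y (y + u)"])
    show "\<forall>m t. m < 2 \<and> min y (y + u) \<le> t \<and> t \<le> max y (y + u) \<longrightarrow> (D m has_real_derivative D (Suc m) t) (at t)"
    proof (intro allI impI)
      fix m :: nat and t
      assume a: "m < 2 \<and> min y (y + u) \<le> t \<and> t \<le> max y (y + u)"
      then have t: "t > 0" using assms by linarith
      have "m = 0 \<or> m = 1" using a by linarith
      then show "(D m has_real_derivative D (Suc m) t) (at t)"
        using t by (auto simp: D_def intro!: derivative_eq_intros)
    qed
  qed (use False in \<open>auto simp: D_def\<close>)
  then obtain t where t: "if y + u < y then y + u < t \<and> t < y else y < t \<and> t < y + u"
    "phi (y + u) = (\<Sum>m<2. D m y / fact m * u ^ m) + D 2 t / fact 2 * u ^ 2"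
    by auto
  have "psi y u = u\<^sup>2 / 2 * bvar t"
    using t(2) by (simp add: psi_def D_def numeral_2_eq_2)
  with t(1) show ?thesis by (intro exI[of _ t]) (auto split: if_splits)
qed

lemma psi_nonneg: "y > 0 \<Longrightarrow> y + u > 0 \<Longrightarrow> psi y u \<ge> 0"
  using psi_Lagrange[of y u] bvar_pos by (smt (verit) divide_nonneg_nonneg mult_nonneg_nonneg zero_le_power2)

lemma psi_le:
  assumes "x > 0" "x \<le> y" "x \<le> y + u"
  shows "psi y u \<le> u\<^sup>2 / 2 * bvar x"
proof -
  obtain \<xi> where "min y (y + u) \<le> \<xi>" "psi y u = u\<^sup>2 / 2 * bvar \<xi>"
    using psi_Lagrange[of y u] assms by (smt (verit))
  moreover have "bvar \<xi> \<le> bvar x" using assms calculation by (intro bvar_antimono) auto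
  ultimately show ?thesis by (simp add: mult_left_mono)
qed

lemma psi_ge:
  assumes "y > 0" "y + u > 0" "y \<le> x" "y + u \<le> x"
  shows "psi y u \<ge> u\<^sup>2 / 2 * bvar x"
proof -
  obtain \<xi> where "min y (y + u) \<le> \<xi>" "\<xi> \<le> max y (y + u)" "psi y u = u\<^sup>2 / 2 * bvar \<xi>"
    using psi_Lagrange[of y u] assms by (smt (verit))
  moreover have "bvar x \<le> bvar \<xi>" using assms calculation by (intro bvar_antimono) auto
  ultimately show ?thesis by (simp add: mult_left_mono)
qed

text \<open>Convexity of \<open>bose\<close>, whose derivative \<open>- bvar\<close> increases. It
  yields a lower bound on the tilted mean energy that is linear in the tilt.\<close>

lemma bose_tangent:
  assumes "y > 0" "y + u > 0"
  shows "bose (y + u) \<ge> bose y - u * bvar y"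
proof (cases "u \<ge> 0")
  case True
  have "\<exists>D. \<exists>z. y \<le> z \<and> z \<le> y + u \<and> bose (y + u) - bose y = u * D \<and> D = - bvar z"
  proof (cases "u = 0")
    case False
    then have "\<exists>z>y. z < y + u \<and> bose (y + u) - bose y = (y + u - y) * (- bvar z)"
      using assms True by (intro MVT2) (auto intro!: derivative_eq_intros)
    then obtain z where "z > y" "z < y + u" "bose (y + u) - bose y = u * (- bvar z)" by auto
    then show ?thesis by (intro exI[of _ "- bvar z"] exI[of _ z]) auto
  qed auto
  then obtain z where z: "y \<le> z" "bose (y + u) - bose y = u * (- bvar z)" by blast
  have "u * bvar z \<le> u * bvar y" using bvar_antimono[OF assms(1) z(1)] True by (rule mult_left_mono)
  with z show ?thesis by linarith
next
  case False
  then have "\<exists>z>y + u. z < y \<and> bose y - bose (y + u) = (y - (y + u)) * (- bvar z)"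
    using assms by (intro MVT2) (auto intro!: derivative_eq_intros)
  then obtain z where z: "z > y + u" "z < y" "bose y - bose (y + u) = u * bvar z" by auto
  have "bvar y \<le> bvar z" using assms z by (intro bvar_antimono) auto
  then have "u * bvar z \<le> u * bvar y" using False by (intro mult_left_mono_neg) auto
  with z show ?thesis by linarith
qed

lemma bose_midpoint:
  assumes "y > 0" "u \<ge> 0"
  shows "2 * bose (y + u) \<le> bose y + bose (y + 2 * u)"
  using bose_tangent[of "y + u" u] bose_tangent[of "y + u" "- u"] assms by (simp add: algebra_simps)

lemma psi_mono:
  assumes "y > 0" "0 \<le> u" "u \<le> v"
  shows "psi y u \<le> psi y v"
proof (rule DERIV_nonneg_imp_nondecreasing[OF assms(3)])
  fix x assume x: "u \<le> x" "x \<le> v"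
  show "\<exists>D. (psi y has_real_derivative D) (at x) \<and> 0 \<le> D"
  proof (intro exI conjI)
    show "(psi y has_real_derivative (- bose (y + x) * 1 + bose y)) (at x)"
      unfolding psi_def using x assms by (auto intro!: derivative_eq_intros)
    show "0 \<le> - bose (y + x) * 1 + bose y" using bose_antimono[of y "y + x"] x assms by simp
  qed
qed

text \<open>The derivative of \<open>4 * psi y u - psi y (2 * u)\<close> in \<open>u\<close> is a
  second difference of \<open>bose\<close>, nonnegative by convexity. The factor 4 is that of a
  quadratic function, but here it holds uniformly in \<open>y\<close>, also where \<open>u\<close>
  is much larger than \<open>y\<close> and Taylor bounds are too weak.\<close>

lemma psi_double:
  assumes "y > 0" "u \<ge> 0"
  shows "psi y (2 * u) \<le> 4 * psi y u"
proof -
  have "4 * psi y 0 - psi y (2 * 0) \<le> 4 * psi y u - psi y (2 * u)"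
  proof (rule DERIV_nonneg_imp_nondecreasing[OF assms(2)])
    fix x assume x: "0 \<le> x" "x \<le> u"
    show "\<exists>D. ((\<lambda>u. 4 * psi y u - psi y (2 * u)) has_real_derivative D) (at x) \<and> 0 \<le> D"
    proof (intro exI conjI)
      show "((\<lambda>u. 4 * psi y u - psi y (2 * u)) has_real_derivative
          (4 * (- bose (y + x) + bose y) - (- bose (y + 2 * x) * 2 + 2 * bose y))) (at x)"
        unfolding psi_def using x assms by (auto intro!: derivative_eq_intros)
      show "0 \<le> 4 * (- bose (y + x) + bose y) - (- bose (y + 2 * x) * 2 + 2 * bose y)"
        using bose_midpoint[of y x] x assms by simp
    qed
  qed
  then show ?thesis by (simp add: psi_def)
qed

text \<open>Factor \<open>exp y - 1\<close> as \<open>(exp (y/2) - 1) * (exp (y/2) + 1)\<close>; the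
  first factor is \<open>exp (y/4) * 2 * sinh (y/4)\<close>. The exponent 3/4 exceeds 1/2 so that,
  after squaring, \<open>bvar\<close> still decays like \<open>exp (- y / 2)\<close>.\<close>

lemma exp_minus_one_ge:
  assumes "y \<ge> (0 :: real)"
  shows "y / 2 * exp (3 * y / 4) \<le> exp y - 1"
proof -
  have h: "exp (y / 2) - 1 \<ge> exp (y / 4) * (y / 2)"
  proof -
    have "0 * 1 \<le> exp (u::real) - exp (- u) - 2 * u" if "u \<ge> 0" for u
    proof -
      have "exp 0 - exp (- 0) - 2 * 0 \<le> exp u - exp (- u) - 2 * u"
      proof (rule DERIV_nonneg_imp_nondecreasing[OF that])
        fix x :: real
        have "exp x + exp (- x) \<ge> 2"
          using sum_squares_ge_zero[of "exp (x/2) - exp (- x/2)" 0]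
          by (simp add: algebra_simps flip: exp_add)
        then show "\<exists>D. ((\<lambda>u. exp u - exp (- u) - 2 * u) has_real_derivative D) (at x) \<and> 0 \<le> D"
          by (intro exI[of _ "exp x + exp (- x) - 2"]) (auto intro!: derivative_eq_intros)
      qed
      then show ?thesis by simp
    qed
    from this[of "y / 4"] have "exp (y / 4) - exp (- (y / 4)) \<ge> y / 2" using assms by simp
    then have "exp (y / 4) * (y / 2) \<le> exp (y / 4) * (exp (y / 4) - exp (- (y / 4)))"
      by (intro mult_left_mono) auto
    also have "\<dots> = exp (y / 2) - 1" by (simp add: algebra_simps flip: exp_add)
    finally show ?thesis .
  qed
  have "y / 2 * exp (3 * y / 4) = (exp (y / 4) * (y / 2)) * exp (y / 2)"
    by (simp flip: exp_add)
  also have "\<dots> \<le> (exp (y / 2) - 1) * (exp (y / 2) + 1)"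
    using h assms by (intro mult_mono) auto
  also have "\<dots> = exp y - 1" by (simp add: algebra_simps flip: exp_add)
  finally show ?thesis .
qed

lemma bose_le:
  assumes "y > 0"
  shows "bose y \<le> 2 / y * exp (- y / 2)"
proof -
  have "y / 2 * exp (y / 2) \<le> y / 2 * exp (3 * y / 4)" using assms by (intro mult_left_mono) auto
  then have "y / 2 * exp (y / 2) \<le> exp y - 1" using assms exp_minus_one_ge[of y] by linarith
  then have "bose y \<le> 1 / (y / 2 * exp (y / 2))"
    unfolding bose_def using assms by (intro divide_left_mono) auto
  also have "\<dots> = 2 / y * exp (- y / 2)" by (simp add: exp_minus divide_simps)
  finally show ?thesis .
qed

lemma bvar_le:
  assumes "y > 0"
  shows "bvar y \<le> 4 / y\<^sup>2 * exp (- y / 2)"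
proof -
  have "(y / 2 * exp (3 * y / 4))\<^sup>2 \<le> (exp y - 1)\<^sup>2"
    using assms exp_minus_one_ge[of y] by (intro power_mono) auto
  then have "bvar y \<le> exp y / (y / 2 * exp (3 * y / 4))\<^sup>2"
    unfolding bvar_def using assms by (intro divide_left_mono) auto
  also have "\<dots> = 4 / y\<^sup>2 * (exp y / exp (3 * y / 2))"
    by (simp add: power_mult_distrib power_divide flip: exp_double)
  also have "exp y / exp (3 * y / 2) = exp (- y / 2)" by (simp flip: exp_diff)
  finally show ?thesis .
qed

section \<open>Sums over levels\<close>

text \<open>Raise \<open>x \<le> k * exp (x / k)\<close> to the power \<open>s\<close>. The value
  \<open>k = 2 * s + 1\<close> is positive also for \<open>s = 0\<close> and makes
  \<open>s / k\<close> at most 1/2.\<close>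

lemma powr_le_exp_half:
  assumes "s \<ge> 0" "x \<ge> (0 :: real)"
  shows "x powr s \<le> (2 * s + 1) powr s * exp (x / 2)"
proof -
  define k where "k = 2 * s + 1"
  have k: "k > 0" using assms by (simp add: k_def)
  have "x / k \<le> exp (x / k)" using exp_ge_add_one_self[of "x / k"] by linarith
  then have "x \<le> k * exp (x / k)" using k by (simp add: field_simps)
  then have "x powr s \<le> (k * exp (x / k)) powr s" using assms by (intro powr_mono2) auto
  also have "\<dots> = k powr s * exp (s * x / k)"
    using k by (simp add: powr_mult exp_powr_real mult.commute)
  also have "s * x / k \<le> x / 2" using k assms by (simp add: k_def field_simps)
  finally show ?thesis using k by (simp add: k_def)
qed

lemma sum_exp_le:
  assumes "c > 0"
  shows "(\<Sum>j=1..J. exp (- (c * real j))) \<le> 1 / c"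
proof -
  define x where "x = exp (- c)"
  have x: "0 < x" "x < 1" using assms by (auto simp: x_def)
  have "(\<Sum>j=1..J. exp (- (c * real j))) = (\<Sum>j=1..J. x ^ j)"
    by (simp add: x_def flip: exp_of_nat_mult) (simp add: mult.commute)
  also have "\<dots> = (x - x ^ Suc J) / (1 - x)"
    using x by (subst sum_gp) auto
  also have "\<dots> \<le> x / (1 - x)" using x by (intro divide_right_mono) auto
  also have "\<dots> = bose c" using assms by (simp add: bose_geometric x_def)
  also have "\<dots> \<le> 1 / c"
  proof -
    have "c \<le> exp c - 1" using exp_ge_add_one_self[of c] by linarith
    then show ?thesis unfolding bose_def using assms by (intro divide_left_mono) auto
  qed
  finally show ?thesis .
qed

text \<open>Half of the exponential absorbs the power, the other half is summed as a geometric
  series.\<close>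

lemma sum_powr_exp_nonneg_exponent:
  assumes "s \<ge> 0" "b > 0"
  shows "(\<Sum>j=1..J. real j powr s * exp (- (b * real j))) \<le> 2 * (2 * s + 1) powr s * b powr (- s - 1)"
proof -
  let ?K = "(2 * s + 1) powr s"
  have "real j powr s * exp (- (b * real j)) \<le> ?K * b powr (- s) * exp (- (b / 2 * real j))" for j
  proof -
    have "real j powr s = b powr (- s) * (b * real j) powr s"
      using assms by (simp add: powr_mult powr_minus)
    also have "\<dots> \<le> b powr (- s) * (?K * exp (b * real j / 2))"
      using assms by (intro mult_left_mono powr_le_exp_half) auto
    finally have "real j powr s * exp (- (b * real j))
        \<le> b powr (- s) * (?K * exp (b * real j / 2)) * exp (- (b * real j))"
      by (rule mult_right_mono) auto
    also have "\<dots> = ?K * b powr (- s) * exp (- (b / 2 * real j))"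
      by (simp add: field_simps flip: exp_add)
    finally show ?thesis .
  qed
  then have "(\<Sum>j=1..J. real j powr s * exp (- (b * real j)))
      \<le> (\<Sum>j=1..J. ?K * b powr (- s) * exp (- (b / 2 * real j)))" by (intro sum_mono)
  also have "\<dots> = ?K * b powr (- s) * (\<Sum>j=1..J. exp (- (b / 2 * real j)))"
    by (simp add: sum_distrib_left)
  also have "\<dots> \<le> ?K * b powr (- s) * (1 / (b / 2))"
    using assms by (intro mult_left_mono sum_exp_le) auto
  also have "\<dots> = 2 * ?K * b powr (- s - 1)"
    using assms by (simp add: powr_diff)
  finally show ?thesis .
qed

lemma powr_diff_Suc_ge:
  assumes "0 < p" "p < 1"
  shows "p * real (Suc n) powr (p - 1) \<le> real (Suc n) powr p - real n powr p"
proof (cases "n = 0")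
  case True
  then show ?thesis using assms by simp
next
  case False
  then have "\<exists>z>real n. z < real (Suc n) \<and>
      real (Suc n) powr p - real n powr p = (real (Suc n) - real n) * (p * z powr (p - 1))"
    using assms by (intro MVT2) (auto intro!: derivative_eq_intros)
  then obtain z where z: "z > real n" "z < real (Suc n)"
    "real (Suc n) powr p - real n powr p = p * z powr (p - 1)" by auto
  have "real (Suc n) powr (p - 1) \<le> z powr (p - 1)"
    using z assms False by (intro powr_mono2') auto
  with z assms show ?thesis by simp
qed

text \<open>For exponents between \<open>-1\<close> and \<open>0\<close>, \<open>j\<^sup>s\<close> is dominated by the increments of
  \<open>j\<^sup>s\<^sup>+\<^sup>1\<close>, and summation by parts returns to a nonnegative exponent.\<close>

lemma sum_powr_exp_neg_exponent:
  assumes "- 1 < s" "s < 0" "b > 0"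
  shows "(\<Sum>j=1..J. real j powr s * exp (- (b * real j)))
    \<le> 3 * (2 * (s + 1) + 1) powr (s + 1) / (s + 1) * b powr (- s - 1)"
proof -
  define p where "p = s + 1"
  define K where "K = (2 * p + 1) powr p"
  have p: "0 < p" "p < 1" using assms by (auto simp: p_def)
  \<comment> \<open>Abel summation by induction on \<open>n\<close>: a boundary term at
    \<open>n\<close>, and \<open>1 - exp (- b) \<le> b\<close> for the increments of the
    exponential.\<close>
  have parts: "(\<Sum>j=1..n. (real j powr p - real (j - 1) powr p) * exp (- (b * real j)))
      \<le> real n powr p * exp (- (b * real n)) + b * (\<Sum>j<n. real j powr p * exp (- (b * real j)))" for n
  proof (induction n)
    case (Suc n)
    have "exp (- (b * real (Suc n))) = exp (- (b * real n)) * exp (- b)"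
      by (simp add: algebra_simps flip: exp_add)
    moreover have "1 - exp (- b) \<le> b" using exp_ge_add_one_self[of "- b"] by linarith
    then have "exp (- (b * real n)) * (1 - exp (- b)) \<le> exp (- (b * real n)) * b"
      by (intro mult_left_mono) auto
    ultimately have e: "exp (- (b * real n)) - exp (- (b * real (Suc n))) \<le> b * exp (- (b * real n))"
      by (simp add: algebra_simps)
    have "real n powr p * (exp (- (b * real n)) - exp (- (b * real (Suc n))))
        \<le> b * (real n powr p * exp (- (b * real n)))"
      using mult_left_mono[OF e, of "real n powr p"] by (simp add: mult_ac)
    with Suc show ?case by (simp add: algebra_simps)
  qed (use p in auto)
  have "p * (real j powr s * exp (- (b * real j)))
      \<le> (real j powr p - real (j - 1) powr p) * exp (- (b * real j))" if "j \<ge> 1" for j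
    using powr_diff_Suc_ge[OF p, of "j - 1"] that
    by (simp add: p_def mult.assoc flip: mult.assoc)
  then have "p * (\<Sum>j=1..J. real j powr s * exp (- (b * real j)))
      \<le> (\<Sum>j=1..J. (real j powr p - real (j - 1) powr p) * exp (- (b * real j)))"
    by (subst sum_distrib_left, intro sum_mono) auto
  also have "\<dots> \<le> real J powr p * exp (- (b * real J)) + b * (\<Sum>j<J. real j powr p * exp (- (b * real j)))"
    by (rule parts)
  also have "real J powr p * exp (- (b * real J)) \<le> K * b powr (- p)"
  proof -
    have "real J powr p * exp (- (b * real J)) = b powr (- p) * ((b * real J) powr p * exp (- (b * real J)))"
      using assms by (simp add: powr_mult powr_minus)
    also have "\<dots> \<le> b powr (- p) * (K * exp (b * real J / 2) * exp (- (b * real J)))"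
      using assms p unfolding K_def
      by (intro mult_left_mono mult_right_mono powr_le_exp_half) auto
    also have "K * exp (b * real J / 2) * exp (- (b * real J)) = K * exp (- (b * real J / 2))"
      by (simp add: mult.assoc flip: exp_add)
    also have "\<dots> \<le> K" using p assms by (simp add: K_def mult_left_le)
    finally show ?thesis using assms by (simp add: mult.commute)
  qed
  also have "(\<Sum>j<J. real j powr p * exp (- (b * real j))) = (\<Sum>j=1..J-1. real j powr p * exp (- (b * real j)))"
  proof (rule sum.mono_neutral_right)
    show "\<forall>i\<in>{..<J} - {1..J - 1}. real i powr p * exp (- (b * real i)) = 0"
    proof
      fix i assume "i \<in> {..<J} - {1..J - 1}"
      then have "i = 0" by auto
      then show "real i powr p * exp (- (b * real i)) = 0" using p by simp
    qed
  qed auto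
  also have "\<dots> \<le> 2 * K * b powr (- p - 1)"
    unfolding K_def using p assms by (intro sum_powr_exp_nonneg_exponent) auto
  also have "b * (2 * K * b powr (- p - 1)) = 2 * K * b powr (- p)"
    using assms by (simp add: powr_diff)
  finally have "p * (\<Sum>j=1..J. real j powr s * exp (- (b * real j))) \<le> 3 * K * b powr (- p)"
    using assms by (simp add: mult_left_mono)
  moreover have "- p = - s - 1" by (simp add: p_def)
  ultimately show ?thesis using p unfolding K_def p_def[symmetric] by (simp add: field_simps)
qed

lemma sum_powr_exp_bound:
  assumes "s > - 1"
  shows "\<exists>C>0. \<forall>b>0. \<forall>J. (\<Sum>j=1..J. real j powr s * exp (- (b * real j))) \<le> C * b powr (- s - 1)"
proof (cases "s \<ge> 0")
  case True
  then show ?thesis using sum_powr_exp_nonneg_exponent[OF True]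
    by (intro exI[of _ "2 * (2 * s + 1) powr s"]) auto
next
  case False
  then show ?thesis using sum_powr_exp_neg_exponent[OF assms] assms
    by (intro exI[of _ "3 * (2 * (s + 1) + 1) powr (s + 1) / (s + 1)"]) auto
qed

text \<open>The borderline exponent -1: the sum is a partial sum of the series of
  \<open>- ln (1 - x)\<close> at \<open>x = exp (- b)\<close>. This is the origin of the logarithm
  in the case \<open>d \<le> 2\<close>.\<close>

lemma sum_inverse_exp_le:
  assumes "0 < b" "b \<le> 1"
  shows "(\<Sum>j=1..J. 1 / real j * exp (- (b * real j))) \<le> 1 + ln (1 / b)"
proof -
  define x where "x = exp (- b)"
  have x: "0 < x" "x < 1" using assms by (auto simp: x_def)
  have "(\<lambda>n. - ((- (- x)) ^ n) / real n) sums ln (1 + (- x))"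
    using ln_series'[of "- x"] x by simp
  then have s: "(\<lambda>n. x ^ n / real n) sums (- ln (1 - x))"
    using sums_minus by fastforce
  have "(\<Sum>j=1..J. 1 / real j * exp (- (b * real j))) = (\<Sum>j=1..J. x ^ j / real j)"
    by (simp add: x_def flip: exp_of_nat_mult) (simp add: mult.commute)
  also have "\<dots> \<le> - ln (1 - x)"
    using s x by (intro sum_le_suminf[where I = "{1..J}", THEN order_trans]) (auto simp: sums_iff)
  \<comment> \<open>From \<open>1 - x \<ge> b / (1 + b) \<ge> b / 2\<close>; replacing 1/2 by
    \<open>exp (- 1)\<close> makes the additive constant equal to 1.\<close>
  also have "\<dots> \<le> - ln (exp (- 1) * b)"
  proof -
    have "1 + b \<le> exp b" by (rule exp_ge_add_one_self)
    then have "x \<le> 1 / (1 + b)" using assms by (simp add: x_def exp_minus divide_simps)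
    then have "1 - x \<ge> 1 - 1 / (1 + b)" by simp
    also have "1 - 1 / (1 + b) = b / (1 + b)" using assms by (simp add: field_simps)
    also have "\<dots> \<ge> b / 2" using assms by (intro divide_left_mono) auto
    also have "b / 2 \<ge> exp (- 1) * b"
      using assms exp_ge_add_one_self[of 1] by (simp add: exp_minus divide_simps)
    finally have "exp (- 1) * b \<le> 1 - x" .
    then show ?thesis using x assms by simp
  qed
  also have "\<dots> = 1 + ln (1 / b)" using assms by (simp add: ln_mult ln_div)
  finally show ?thesis .
qed

text \<open>The interval from \<open>x / 2\<close> to \<open>x\<close> contains at least
  \<open>x / 2 - 1\<close> integers, which is at least \<open>x / 4\<close> once
  \<open>x \<ge> 4\<close>.\<close>

lemma sum_ge_window:
  fixes h :: "nat \<Rightarrow> real"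
  assumes "x \<ge> 4" "x \<le> real J" "v \<ge> 0" "\<And>j. j \<ge> 1 \<Longrightarrow> h j \<ge> 0"
    and "\<And>j. j \<ge> 1 \<Longrightarrow> x / 2 \<le> real j \<Longrightarrow> real j \<le> x \<Longrightarrow> h j \<ge> v"
  shows "(\<Sum>j | j \<in> {1..J} \<and> real j \<le> x. h j) \<ge> x / 4 * v"
proof -
  let ?W = "{nat \<lceil>x / 2\<rceil>..nat \<lfloor>x\<rfloor>}"
  have w: "j \<ge> 1 \<and> x / 2 \<le> real j \<and> real j \<le> x" if "j \<in> ?W" for j
    using that assms(1) by (auto simp: nat_ceiling_le_eq le_nat_iff le_floor_iff)
  have "x / 4 \<le> real (card ?W)"
    using assms(1) by simp linarith
  then have "x / 4 * v \<le> real (card ?W) * v" using assms by (intro mult_right_mono)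
  also have "\<dots> = (\<Sum>j\<in>?W. v)" by simp
  also have "\<dots> \<le> (\<Sum>j\<in>?W. h j)" using w assms by (intro sum_mono) auto
  also have "\<dots> \<le> (\<Sum>j | j \<in> {1..J} \<and> real j \<le> x. h j)"
    using w assms by (intro sum_mono2) force+
  finally show ?thesis .
qed

text \<open>The asymptotic law of \<open>q\<close> is recast as two-sided power bounds valid from
  level 1 on. They determine the order in \<open>b\<close> of all sums below, with constants uniform
  in \<open>b\<close> and in the cutoff \<open>J\<close>.\<close>

locale level_weights =
  fixes q :: "nat \<Rightarrow> real" and d c0 C0 :: real
  assumes d_gt: "d > 1" and c0_pos: "c0 > 0"
    and q_ge: "\<And>j. j \<ge> 1 \<Longrightarrow> c0 * real j powr (d - 1) \<le> q j"
    and q_le: "\<And>j. j \<ge> 1 \<Longrightarrow> q j \<le> C0 * real j powr (d - 1)"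
begin

section \<open>Orders in \<open>b\<close> of the mean number, the mean energy and the
  variances\<close>

lemma C0_ge: "c0 \<le> C0"
  using q_ge[of 1] q_le[of 1] by simp

lemma C0_pos: "C0 > 0"
  using C0_ge c0_pos by linarith

lemma q_ge_c0:
  assumes "j \<ge> 1"
  shows "c0 \<le> q j"
proof -
  have "1 \<le> real j powr (d - 1)" using assms d_gt by (simp add: ge_one_powr_ge_zero)
  then have "c0 * 1 \<le> c0 * real j powr (d - 1)" using c0_pos by (intro mult_left_mono) auto
  with q_ge[OF assms] show ?thesis by simp
qed

lemma q_pos: "j \<ge> 1 \<Longrightarrow> q j > 0"
  using q_ge_c0 c0_pos by force

lemma bose_term_le:
  assumes "j \<ge> 1" "b > 0"
  shows "q j * bose (b * real j) \<le> 2 * C0 / b * (real j powr (d - 2) * exp (- (b / 2 * real j)))"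
proof -
  have "q j * bose (b * real j)
      \<le> (C0 * real j powr (d - 1)) * (2 / (b * real j) * exp (- (b * real j) / 2))"
    using assms q_le[of j] q_pos[of j] bose_le[of "b * real j"] bose_pos[of "b * real j"] C0_pos
    by (intro mult_mono) auto
  also have "\<dots> = 2 * C0 / b * (real j powr (d - 2) * exp (- (b / 2 * real j)))"
  proof -
    have "real j powr (d - 1) = real j powr (d - 2) * real j"
      using assms powr_add[of "real j" "d - 2" 1] by simp
    then show ?thesis using assms by simp
  qed
  finally show ?thesis .
qed

lemma bvar_term_le:
  assumes "j \<ge> 1" "b > 0"
  shows "q j * bvar (b * real j) \<le> 4 * C0 / b\<^sup>2 * (real j powr (d - 3) * exp (- (b / 2 * real j)))"
proof -
  have "q j * bvar (b * real j)
      \<le> (C0 * real j powr (d - 1)) * (4 / (b * real j)\<^sup>2 * exp (- (b * real j) / 2))"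
    using assms q_le[of j] q_pos[of j] bvar_le[of "b * real j"] bvar_pos[of "b * real j"] C0_pos
    by (intro mult_mono) auto
  also have "\<dots> = 4 * C0 / b\<^sup>2 * (real j powr (d - 3) * exp (- (b / 2 * real j)))"
  proof -
    have "real j powr (d - 1) = real j powr (d - 3) * (real j)\<^sup>2"
      using assms powr_add[of "real j" "d - 3" 2] by simp
    then show ?thesis using assms by (simp add: power_mult_distrib)
  qed
  finally show ?thesis .
qed

text \<open>Common template: terms of size \<open>b ^ - r * j powr s * exp (- b j / 2)\<close> add
  up to order \<open>b powr (- s - 1 - r)\<close>. For the number \<open>s = d - 2\<close>, for the
  energy \<open>s = d - 1\<close>; for the variance of the number \<open>s = d - 3\<close>, and
  there \<open>s > - 1\<close> is exactly the case \<open>d > 2\<close>.\<close>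

lemma sum_le_powr:
  assumes "s > - 1" "K > 0"
  shows "\<exists>C>0. \<forall>b>0. \<forall>J. \<forall>h :: nat \<Rightarrow> real.
    (\<forall>j\<in>{1..J}. h j \<le> K / b ^ r * (real j powr s * exp (- (b / 2 * real j))))
    \<longrightarrow> (\<Sum>j=1..J. h j) \<le> C * b powr (- s - 1 - real r)"
proof -
  obtain C where C: "C > 0" "\<And>b J. b > 0 \<Longrightarrow>
      (\<Sum>j=1..J. real j powr s * exp (- (b * real j))) \<le> C * b powr (- s - 1)"
    using sum_powr_exp_bound[OF assms(1)] by blast
  show ?thesis
  proof (intro exI conjI allI impI)
    show "K * C * 2 powr (s + 1) > 0" using assms C by simp
    fix b :: real and J and h :: "nat \<Rightarrow> real"
    assume b: "b > 0" and h: "\<forall>j\<in>{1..J}. h j \<le> K / b ^ r * (real j powr s * exp (- (b / 2 * real j)))"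
    have "(\<Sum>j=1..J. h j) \<le> K / b ^ r * (\<Sum>j=1..J. real j powr s * exp (- (b / 2 * real j)))"
      unfolding sum_distrib_left using h by (intro sum_mono) auto
    also have "\<dots> \<le> K / b ^ r * (C * (b / 2) powr (- s - 1))"
      using assms b by (intro mult_left_mono C) auto
    also have "(b / 2) powr (- s - 1) = b powr (- s - 1) * 2 powr (s + 1)"
    proof -
      have "- s - 1 = - (s + 1)" by simp
      then show ?thesis using b by (simp only: powr_divide powr_minus) (simp add: field_simps)
    qed
    also have "K / b ^ r * (C * (b powr (- s - 1) * 2 powr (s + 1)))
        = K * C * 2 powr (s + 1) * b powr (- s - 1 - real r)"
      using b by (simp add: powr_diff powr_realpow mult_ac)
    finally show "(\<Sum>j=1..J. h j) \<le> K * C * 2 powr (s + 1) * b powr (- s - 1 - real r)" .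
  qed
qed

lemma sum_number_le:
  "\<exists>C>0. \<forall>b>0. \<forall>J. (\<Sum>j=1..J. q j * bose (b * real j)) \<le> C * b powr (- d)"
proof -
  obtain C where C: "C > 0" "\<And>b J (h :: nat \<Rightarrow> real). b > 0 \<Longrightarrow>
      (\<forall>j\<in>{1..J}. h j \<le> 2 * C0 / b ^ 1 * (real j powr (d - 2) * exp (- (b / 2 * real j)))) \<Longrightarrow>
      (\<Sum>j=1..J. h j) \<le> C * b powr (- (d - 2) - 1 - real 1)"
    using sum_le_powr[of "d - 2" "2 * C0" 1] d_gt C0_pos by auto
  show ?thesis
  proof (intro exI[of _ C] conjI allI impI)
    fix b :: real and J assume b: "b > 0"
    have "(\<Sum>j=1..J. q j * bose (b * real j)) \<le> C * b powr (- (d - 2) - 1 - real 1)"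
      using bose_term_le b by (intro C) auto
    moreover have "- (d - 2) - 1 - real 1 = - d" by simp
    ultimately show "(\<Sum>j=1..J. q j * bose (b * real j)) \<le> C * b powr (- d)" by metis
  qed (rule C)
qed

lemma sum_energy_le:
  "\<exists>C>0. \<forall>b>0. \<forall>J. (\<Sum>j=1..J. real j * q j * bose (b * real j)) \<le> C * b powr (- d - 1)"
proof -
  obtain C where C: "C > 0" "\<And>b J (h :: nat \<Rightarrow> real). b > 0 \<Longrightarrow>
      (\<forall>j\<in>{1..J}. h j \<le> 2 * C0 / b ^ 1 * (real j powr (d - 1) * exp (- (b / 2 * real j)))) \<Longrightarrow>
      (\<Sum>j=1..J. h j) \<le> C * b powr (- (d - 1) - 1 - real 1)"
    using sum_le_powr[of "d - 1" "2 * C0" 1] d_gt C0_pos by auto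
  show ?thesis
  proof (intro exI[of _ C] conjI allI impI)
    fix b :: real and J assume b: "b > 0"
    have "real j * q j * bose (b * real j) \<le> 2 * C0 / b ^ 1 * (real j powr (d - 1) * exp (- (b / 2 * real j)))"
      if "j \<ge> 1" for j
    proof -
      have "real j powr (d - 1) = real j powr (d - 2) * real j"
        using that powr_add[of "real j" "d - 2" 1] by simp
      then show ?thesis
        using mult_left_mono[OF bose_term_le[OF that b], of "real j"] by (simp add: mult_ac)
    qed
    then have "(\<Sum>j=1..J. real j * q j * bose (b * real j)) \<le> C * b powr (- (d - 1) - 1 - real 1)"
      using b by (intro C) auto
    moreover have "- (d - 1) - 1 - real 1 = - d - 1" by simp
    ultimately show "(\<Sum>j=1..J. real j * q j * bose (b * real j)) \<le> C * b powr (- d - 1)"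
      by metis
  qed (rule C)
qed

lemma sum_energy_bvar_le:
  "\<exists>C>0. \<forall>b>0. \<forall>J. (\<Sum>j=1..J. real j * q j * bvar (b * real j)) \<le> C * b powr (- d - 1)"
proof -
  obtain C where C: "C > 0" "\<And>b J (h :: nat \<Rightarrow> real). b > 0 \<Longrightarrow>
      (\<forall>j\<in>{1..J}. h j \<le> 4 * C0 / b ^ 2 * (real j powr (d - 2) * exp (- (b / 2 * real j)))) \<Longrightarrow>
      (\<Sum>j=1..J. h j) \<le> C * b powr (- (d - 2) - 1 - real 2)"
    using sum_le_powr[of "d - 2" "4 * C0" 2] d_gt C0_pos by auto
  show ?thesis
  proof (intro exI[of _ C] conjI allI impI)
    fix b :: real and J assume b: "b > 0"
    have "real j * q j * bvar (b * real j) \<le> 4 * C0 / b ^ 2 * (real j powr (d - 2) * exp (- (b / 2 * real j)))"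
      if "j \<ge> 1" for j
    proof -
      have "real j powr (d - 2) = real j powr (d - 3) * real j"
        using that powr_add[of "real j" "d - 3" 1] by simp
      then show ?thesis
        using mult_left_mono[OF bvar_term_le[OF that b], of "real j"] by (simp add: mult_ac)
    qed
    then have "(\<Sum>j=1..J. real j * q j * bvar (b * real j)) \<le> C * b powr (- (d - 2) - 1 - real 2)"
      using b by (intro C) auto
    moreover have "- (d - 2) - 1 - real 2 = - d - 1" by simp
    ultimately show "(\<Sum>j=1..J. real j * q j * bvar (b * real j)) \<le> C * b powr (- d - 1)"
      by metis
  qed (rule C)
qed

lemma sum_bvar_le_gt2:
  assumes "d > 2"
  shows "\<exists>C>0. \<forall>b>0. \<forall>J. (\<Sum>j=1..J. q j * bvar (b * real j)) \<le> C * b powr (- d)"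
proof -
  obtain C where C: "C > 0" "\<And>b J (h :: nat \<Rightarrow> real). b > 0 \<Longrightarrow>
      (\<forall>j\<in>{1..J}. h j \<le> 4 * C0 / b ^ 2 * (real j powr (d - 3) * exp (- (b / 2 * real j)))) \<Longrightarrow>
      (\<Sum>j=1..J. h j) \<le> C * b powr (- (d - 3) - 1 - real 2)"
    using sum_le_powr[of "d - 3" "4 * C0" 2] assms C0_pos by auto
  show ?thesis
  proof (intro exI[of _ C] conjI allI impI)
    fix b :: real and J assume b: "b > 0"
    have "(\<Sum>j=1..J. q j * bvar (b * real j)) \<le> C * b powr (- (d - 3) - 1 - real 2)"
      using bvar_term_le b by (intro C) auto
    moreover have "- (d - 3) - 1 - real 2 = - d" by simp
    ultimately show "(\<Sum>j=1..J. q j * bvar (b * real j)) \<le> C * b powr (- d)" by metis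
  qed (rule C)
qed

text \<open>Here \<open>j powr (d - 3)\<close> is at most \<open>1 / j\<close>. The logarithm so
  introduced is affordable, since the deviation threshold for \<open>d \<le> 2\<close> carries a
  logarithm as well.\<close>

lemma sum_bvar_le_le2:
  assumes "d \<le> 2"
  shows "\<exists>C>0. \<forall>b. 0 < b \<and> b \<le> 1 \<longrightarrow> (\<forall>J. (\<Sum>j=1..J. q j * bvar (b * real j)) \<le> C / b\<^sup>2 * (1 + ln (1 / b)))"
proof (intro exI[of _ "8 * C0"] conjI allI impI)
  show "8 * C0 > 0" using C0_pos by simp
  fix b :: real and J assume b: "0 < b \<and> b \<le> 1"
  have "(\<Sum>j=1..J. q j * bvar (b * real j)) \<le> 4 * C0 / b\<^sup>2 * (\<Sum>j=1..J. 1 / real j * exp (- (b / 2 * real j)))"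
    unfolding sum_distrib_left
  proof (intro sum_mono)
    fix j assume "j \<in> {1..J}"
    then have j: "j \<ge> 1" by simp
    have "real j powr (d - 3) \<le> real j powr (- 1)" using j assms by (intro powr_mono) auto
    then have "real j powr (d - 3) \<le> 1 / real j" using j by (simp add: powr_minus_divide)
    then have "4 * C0 / b\<^sup>2 * (real j powr (d - 3) * exp (- (b / 2 * real j)))
        \<le> 4 * C0 / b\<^sup>2 * (1 / real j * exp (- (b / 2 * real j)))"
      using C0_pos by (intro mult_left_mono mult_right_mono) auto
    with bvar_term_le[OF j, of b] b
    show "q j * bvar (b * real j) \<le> 4 * C0 / b\<^sup>2 * (1 / real j * exp (- (b / 2 * real j)))" by linarith
  qed
  also have "\<dots> \<le> 4 * C0 / b\<^sup>2 * (1 + ln (1 / (b / 2)))"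
    using b C0_pos by (intro mult_left_mono sum_inverse_exp_le) auto
  also have "\<dots> \<le> 4 * C0 / b\<^sup>2 * (2 * (1 + ln (1 / b)))"
  proof (rule mult_left_mono)
    have "ln (1 / (b / 2)) = ln 2 + ln (1 / b)" using b by (simp add: ln_div)
    moreover have "ln 2 \<le> (1 :: real)" using ln_le_minus_one[of "2 :: real"] by simp
    moreover have "ln (1 / b) \<ge> 0" using b by simp
    ultimately show "1 + ln (1 / (b / 2)) \<le> 2 * (1 + ln (1 / b))"
      unfolding distrib_left by linarith
  qed (use C0_pos in auto)
  also have "\<dots> = 8 * C0 / b\<^sup>2 * (1 + ln (1 / b))" by simp
  finally show "(\<Sum>j=1..J. q j * bvar (b * real j)) \<le> 8 * C0 / b\<^sup>2 * (1 + ln (1 / b))" .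
qed

text \<open>Beyond the scale \<open>\<kappa> / b\<close> the factor
  \<open>1 / (b * j)\<^sup>2\<close> is bounded, which removes the blow-up of the variance at low
  levels. The tail is thus of order \<open>b powr (- d)\<close> for all \<open>d > 1\<close>, the
  size of the window sums below.\<close>

lemma sum_bvar_tail_le:
  assumes "\<kappa> > 0"
  shows "\<exists>C>0. \<forall>b>0. \<forall>J. (\<Sum>j | j \<in> {1..J} \<and> \<not> real j \<le> \<kappa> / b. q j * bvar (b * real j)) \<le> C * b powr (- d)"
proof -
  have s: "d - 1 > - 1" and K: "4 * C0 / \<kappa>\<^sup>2 > 0" using d_gt assms C0_pos by auto
  obtain C where C: "C > 0" "\<And>b J (h :: nat \<Rightarrow> real). b > 0 \<Longrightarrow>
      (\<forall>j\<in>{1..J}. h j \<le> 4 * C0 / \<kappa>\<^sup>2 / b ^ 0 * (real j powr (d - 1) * exp (- (b / 2 * real j)))) \<Longrightarrow>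
      (\<Sum>j=1..J. h j) \<le> C * b powr (- (d - 1) - 1 - real 0)"
    using sum_le_powr[of "d - 1" "4 * C0 / \<kappa>\<^sup>2" 0, OF s K] by blast
  show ?thesis
  proof (intro exI[of _ C] conjI allI impI)
    fix b :: real and J assume b: "b > 0"
    define h where "h j = (if real j \<le> \<kappa> / b then 0 else q j * bvar (b * real j))" for j
    have "h j \<le> 4 * C0 / \<kappa>\<^sup>2 / b ^ 0 * (real j powr (d - 1) * exp (- (b / 2 * real j)))"
      if "j \<ge> 1" for j
    proof (cases "real j \<le> \<kappa> / b")
      case False
      then have "\<kappa> \<le> b * real j" using b by (simp add: field_simps)
      then have "\<kappa>\<^sup>2 \<le> (b * real j)\<^sup>2" using assms by (intro power_mono) auto
      then have k: "1 / (b * real j)\<^sup>2 \<le> 1 / \<kappa>\<^sup>2" using assms b that by (intro divide_left_mono) auto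
      have "real j powr (d - 1) = real j powr (d - 3) * (real j)\<^sup>2"
        using that powr_add[of "real j" "d - 3" 2] by simp
      then have "4 * C0 / b\<^sup>2 * (real j powr (d - 3) * exp (- (b / 2 * real j)))
        = 1 / (b * real j)\<^sup>2 * (4 * C0 * (real j powr (d - 1) * exp (- (b / 2 * real j))))"
        using that b by (simp add: power_mult_distrib)
      also have "\<dots> \<le> 1 / \<kappa>\<^sup>2 * (4 * C0 * (real j powr (d - 1) * exp (- (b / 2 * real j))))"
        using k C0_pos by (intro mult_right_mono) auto
      finally show ?thesis using False bvar_term_le[OF that b] by (simp add: h_def)
    qed (use C0_pos in \<open>auto simp: h_def\<close>)
    then have "(\<Sum>j=1..J. h j) \<le> C * b powr (- (d - 1) - 1 - real 0)"
      using b by (intro C) auto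
    moreover have "(\<Sum>j=1..J. h j) = (\<Sum>j | j \<in> {1..J} \<and> \<not> real j \<le> \<kappa> / b. q j * bvar (b * real j))"
      unfolding h_def by (subst sum.If_cases) (auto intro!: sum.cong)
    ultimately show "(\<Sum>j | j \<in> {1..J} \<and> \<not> real j \<le> \<kappa> / b. q j * bvar (b * real j)) \<le> C * b powr (- d)"
      by simp
  qed (rule C)
qed

text \<open>With the powers of \<open>b\<close> stripped off: \<open>\<kappa> / 4\<close> bounds
  from below the number of levels with \<open>b * j\<close> between \<open>\<kappa> / 2\<close> and
  \<open>\<kappa>\<close>, and the other factor is the smallest guaranteed \<open>q j\<close>
  there.\<close>

definition window_const :: "real \<Rightarrow> real" where
  "window_const \<kappa> = \<kappa> / 4 * (c0 * (\<kappa> / 2) powr (d - 1))"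

lemma window_const_pos: "\<kappa> > 0 \<Longrightarrow> window_const \<kappa> > 0"
  using c0_pos by (simp add: window_const_def)

lemma sum_window_ge:
  assumes b: "b > 0" "4 * b \<le> \<kappa>" "\<kappa> / b \<le> real J" and v: "v \<ge> 0"
    and h: "\<And>j. j \<ge> 1 \<Longrightarrow> h j \<ge> 0"
      "\<And>j. j \<ge> 1 \<Longrightarrow> \<kappa> / 2 \<le> b * real j \<Longrightarrow> b * real j \<le> \<kappa> \<Longrightarrow> h j \<ge> v"
  shows "(\<Sum>j | j \<in> {1..J} \<and> real j \<le> \<kappa> / b. q j * h j) \<ge> window_const \<kappa> * v * b powr (- d)"
proof -
  have \<kappa>: "\<kappa> > 0" using b by linarith
  let ?v = "c0 * (\<kappa> / b / 2) powr (d - 1) * v"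
  have "(\<Sum>j | j \<in> {1..J} \<and> real j \<le> \<kappa> / b. q j * h j) \<ge> \<kappa> / b / 4 * ?v"
  proof (rule sum_ge_window)
    show "0 \<le> q j * h j" if "j \<ge> 1" for j using that q_pos[OF that] h(1)[OF that] by simp
    fix j :: nat assume j: "j \<ge> 1" "\<kappa> / b / 2 \<le> real j" "real j \<le> \<kappa> / b"
    then have "\<kappa> / 2 \<le> b * real j" "b * real j \<le> \<kappa>" using b by (simp_all add: field_simps)
    then have hj: "h j \<ge> v" using h j by auto
    have "(\<kappa> / b / 2) powr (d - 1) \<le> real j powr (d - 1)"
      using \<kappa> b j d_gt by (intro powr_mono2) auto
    then have "c0 * (\<kappa> / b / 2) powr (d - 1) \<le> q j"
      using q_ge[OF j(1)] c0_pos by (meson mult_left_mono less_imp_le order_trans)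
    then show "?v \<le> q j * h j" using hj v q_pos[OF j(1)] by (intro mult_mono) auto
  qed (use b v c0_pos in \<open>auto simp: field_simps\<close>)
  also have "\<kappa> / b / 4 * ?v = window_const \<kappa> * v * ((1 / b) powr (d - 1) * (1 / b))"
  proof -
    have "(\<kappa> / b / 2) powr (d - 1) = (\<kappa> / 2) powr (d - 1) * (1 / b) powr (d - 1)"
      using \<kappa> b by (simp add: mult.commute flip: powr_mult)
    then show ?thesis by (simp only: window_const_def) (simp add: mult_ac)
  qed
  also have "(1 / b) powr (d - 1) * (1 / b) = b powr (- d)"
    using b by (simp add: powr_divide powr_diff powr_minus field_simps)
  finally show ?thesis .
qed

lemma sum_window_ge_all:
  assumes b: "b > 0" "4 * b \<le> \<kappa>" "\<kappa> / b \<le> real J" and v: "v \<ge> 0"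
    and h: "\<And>j. j \<ge> 1 \<Longrightarrow> h j \<ge> 0"
      "\<And>j. j \<ge> 1 \<Longrightarrow> \<kappa> / 2 \<le> b * real j \<Longrightarrow> b * real j \<le> \<kappa> \<Longrightarrow> h j \<ge> v"
  shows "(\<Sum>j=1..J. q j * h j) \<ge> window_const \<kappa> * v * b powr (- d)"
proof -
  have "(\<Sum>j | j \<in> {1..J} \<and> real j \<le> \<kappa> / b. q j * h j) \<le> (\<Sum>j=1..J. q j * h j)"
  proof (rule sum_mono2)
    fix j assume "j \<in> {1..J} - {j. j \<in> {1..J} \<and> real j \<le> \<kappa> / b}"
    then have "j \<ge> 1" by simp
    then show "0 \<le> q j * h j" using h(1)[of j] q_pos[of j] by simp
  qed auto
  with sum_window_ge[where h = h, OF assms] show ?thesis by linarith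
qed

end

section \<open>A local lower bound at the mean\<close>

text \<open>The recursion forces the mode of \<open>P\<close> to lie at or below the mean \<open>A\<close>. It also propagates lower
  bounds from any \<open>L\<close> consecutive values to the next one, with a loss of a factor \<open>1 - 1 / A\<close>
  per step as long as the argument stays below \<open>A\<close>.\<close>

lemma local_lower_bound:
  fixes P \<alpha> :: "nat \<Rightarrow> real"
  assumes P: "\<And>e. P e \<ge> 0" and \<alpha>: "\<And>k. \<alpha> k \<ge> 0" "\<alpha> 0 = 0"
    and rec: "\<And>e. real e * P e = (\<Sum>k\<le>e. \<alpha> k * P (e - k))"
    and sums: "\<alpha> sums A" "P sums 1" and A: "A \<ge> 2"
    and \<delta>: "0 < \<delta>" "\<delta> \<le> 1" "\<And>k. 1 \<le> k \<Longrightarrow> k \<le> L \<Longrightarrow> \<alpha> k \<ge> \<delta>"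
    and tail: "(\<Sum>k=1..L. \<alpha> k) \<ge> A - 1"
  shows "P (nat \<lfloor>A\<rfloor>) \<ge> exp (- 2) * \<delta> / (A * (4 * A + 2))"
proof -
  define n where "n = nat \<lfloor>A\<rfloor>"
  have n: "real n \<le> A" "A < real n + 1" using A by (auto simp: n_def)
  \<comment> \<open>Summing the recursion over \<open>e\<close> gives a Cauchy product, so
    \<open>A\<close> is the mean of the distribution \<open>P\<close>.\<close>
  have mean: "(\<lambda>e. real e * P e) sums A"
  proof -
    have "(\<lambda>e. \<Sum>k\<le>e. \<alpha> k * P (e - k)) sums ((\<Sum>k. \<alpha> k) * (\<Sum>k. P k))"
      using sums P \<alpha> by (intro Cauchy_product_sums) (auto simp: sums_iff)
    with sums show ?thesis by (simp add: rec sums_iff)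
  qed
  define \<epsilon> where "\<epsilon> = Max (P ` {..n})"
  obtain e1 where e1: "e1 \<le> n" "P e1 = \<epsilon>"
  proof -
    have "\<epsilon> \<in> P ` {..n}" unfolding \<epsilon>_def by (intro Max_in) auto
    then show ?thesis using that by auto
  qed
  have partial: "(\<Sum>k\<le>e. \<alpha> k) \<le> A" for e
    using sums \<alpha> by (auto simp: sums_iff intro!: sum_le_suminf)
  \<comment> \<open>For \<open>e > n\<close> one has \<open>e > A\<close>, while the recursion
    bounds \<open>e * P e\<close> by \<open>A * \<epsilon>\<close>.\<close>
  have mode: "P e \<le> \<epsilon>" for e
  proof (induction e rule: less_induct)
    case (less e)
    show ?case
    proof (cases "e \<le> n")
      case True
      then show ?thesis unfolding \<epsilon>_def by (intro Max_ge) auto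
    next
      case False
      have "real e * P e \<le> (\<Sum>k\<le>e. \<alpha> k * \<epsilon>)"
        unfolding rec
      proof (intro sum_mono)
        fix k assume "k \<in> {..e}"
        then show "\<alpha> k * P (e - k) \<le> \<alpha> k * \<epsilon>"
          using less \<alpha> False by (cases "k = 0") (auto intro!: mult_left_mono)
      qed
      also have "\<dots> = (\<Sum>k\<le>e. \<alpha> k) * \<epsilon>" by (simp add: sum_distrib_right)
      also have "\<dots> \<le> real e * \<epsilon>"
        using partial[of e] n False P[of e1] e1 by (intro mult_right_mono) auto
      finally show ?thesis using False by simp
    qed
  qed
  \<comment> \<open>Markov's inequality: at least half of the mass lies at or below
    \<open>2 * A\<close>, on at most \<open>2 * A + 1\<close> points, so the largest value is at
    least \<open>1 / (4 * A + 2)\<close>.\<close>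
  have eps: "\<epsilon> \<ge> 1 / (4 * A + 2)"
  proof -
    define m where "m = nat \<lfloor>2 * A\<rfloor>"
    have m: "real m \<le> 2 * A" "\<And>e. e > m \<Longrightarrow> real e \<ge> 2 * A"
      using A by (auto simp: m_def nat_less_iff floor_less_iff)
    have "(\<lambda>e. if e \<in> {..m} then P e else 0) sums (\<Sum>e\<le>m. P e)" by (rule sums_If_finite_set) simp
    then have S: "(\<lambda>e. real e * P e - 2 * A * P e + 2 * A * (if e \<in> {..m} then P e else 0))
        sums (A - 2 * A * 1 + 2 * A * (\<Sum>e\<le>m. P e))" (is "?g sums _")
      by (intro sums_add sums_diff sums_mult mean sums(2))
    have "0 \<le> A - 2 * A * 1 + 2 * A * (\<Sum>e\<le>m. P e)"
    proof (rule sums_le[OF _ sums_zero S])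
      fix e show "0 \<le> ?g e"
        using m(2)[of e] P[of e] by (auto intro!: mult_right_mono)
    qed
    then have "A * 1 \<le> A * (2 * (\<Sum>e\<le>m. P e))" by simp
    then have "1 \<le> 2 * (\<Sum>e\<le>m. P e)" using A by (subst (asm) mult_le_cancel_left_pos) auto
    also have "(\<Sum>e\<le>m. P e) \<le> (\<Sum>e\<le>m. \<epsilon>)" by (intro sum_mono mode)
    also have "2 * (\<Sum>e\<le>m. \<epsilon>) = 2 * (real m + 1) * \<epsilon>" by simp
    also have "\<dots> \<le> (4 * A + 2) * \<epsilon>"
      using m P[of e1] e1 by (intro mult_right_mono) auto
    finally show ?thesis using A by (simp add: field_simps)
  qed
  then have eps0: "\<epsilon> > 0" using A by (smt (verit) divide_pos_pos)
  have step: "\<delta> / A * \<epsilon> * (1 - 1 / A) ^ e \<le> P e" if "e1 \<le> e" "e \<le> n" for e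
    using that
  proof (induction e rule: less_induct)
    case (less e)
    have r: "0 < 1 - 1 / A" "1 - 1 / A \<le> 1" using A by auto
    have pw: "\<delta> / A * \<epsilon> * (1 - 1 / A) ^ e \<le> \<delta> / A * \<epsilon>"
      using r \<delta> A eps0 by (intro mult_left_le power_le_one) auto
    have eA: "real e \<le> A" using less.prems n by linarith
    consider "e = e1" | "e1 < e" "e \<le> e1 + L" | "e > e1 + L" using less.prems by linarith
    then show ?case
    proof cases
      case 1
      have "\<delta> / A * \<epsilon> \<le> 1 * \<epsilon>" using \<delta> A eps0 by (intro mult_right_mono) auto
      with pw 1 e1 show ?thesis by simp
    next
      case 2
      \<comment> \<open>Within distance \<open>L\<close> of the mode, the single term of the
        recursion that reaches back to \<open>e1\<close> suffices.\<close>
      have "\<delta> * \<epsilon> \<le> \<alpha> (e - e1) * P (e - (e - e1))"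
        using 2 \<delta>(3)[of "e - e1"] e1 eps0 by (auto intro!: mult_right_mono)
      also have "\<dots> \<le> real e * P e"
        unfolding rec using P \<alpha> by (intro member_le_sum[where f = "\<lambda>k. \<alpha> k * P (e - k)"]) auto
      also have "\<dots> \<le> A * P e" using eA P by (intro mult_right_mono)
      finally have "\<delta> / A * \<epsilon> \<le> P e" using A by (simp add: field_simps)
      with pw show ?thesis by linarith
    next
      case 3
      \<comment> \<open>The bound decreases in its exponent, so its value at \<open>e - 1\<close>
        serves for all the points \<open>e - k\<close> with \<open>k \<le> L\<close>; these still
        lie above \<open>e1\<close>.\<close>
      let ?v = "\<delta> / A * \<epsilon> * (1 - 1 / A) ^ (e - 1)"
      have v: "?v \<ge> 0" using \<delta> A eps0 r by auto
      have "(A - 1) * ?v \<le> (\<Sum>k=1..L. \<alpha> k) * ?v" using tail v by (intro mult_right_mono)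
      also have "\<dots> = (\<Sum>k=1..L. \<alpha> k * ?v)" by (rule sum_distrib_right)
      also have "\<dots> \<le> (\<Sum>k=1..L. \<alpha> k * P (e - k))"
      proof (intro sum_mono mult_left_mono \<alpha>)
        fix k assume k: "k \<in> {1..L}"
        have "?v \<le> \<delta> / A * \<epsilon> * (1 - 1 / A) ^ (e - k)"
          using r k \<delta> A eps0 by (intro mult_left_mono power_decreasing) auto
        also have "\<dots> \<le> P (e - k)" using k 3 less.prems by (intro less.IH) auto
        finally show "?v \<le> P (e - k)" .
      qed
      also have "\<dots> \<le> (\<Sum>k\<le>e. \<alpha> k * P (e - k))"
        using 3 P \<alpha> by (intro sum_mono2) auto
      also have "\<dots> = real e * P e" by (simp add: rec)
      also have "\<dots> \<le> A * P e" using eA P by (intro mult_right_mono)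
      finally have "(1 - 1 / A) * ?v \<le> P e" using A by (simp add: field_simps)
      moreover have "(1 - 1 / A) * ?v = \<delta> / A * \<epsilon> * (1 - 1 / A) ^ e"
        using 3 by (cases e) auto
      ultimately show ?thesis by metis
    qed
  qed
  have pow: "(1 - 1 / A) ^ n \<ge> exp (- 2)"
  proof -
    have "exp (- 2 / A) \<le> 1 - 1 / A"
    proof -
      have "1 / (1 - 1 / A) = 1 + 1 / (A - 1)" using A by (simp add: field_simps)
      also have "\<dots> \<le> exp (1 / (A - 1))" by (rule exp_ge_add_one_self)
      also have "1 / (A - 1) \<le> 2 / A" using A by (simp add: field_simps)
      finally have "1 / (1 - 1 / A) \<le> exp (2 / A)" by simp
      then show ?thesis using A by (simp add: exp_minus field_simps)
    qed
    then have "exp (- 2 / A) ^ n \<le> (1 - 1 / A) ^ n" by (intro power_mono) auto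
    moreover have "exp (- 2) \<le> exp (- 2 / A) ^ n"
      using n A by (simp add: field_simps flip: exp_of_nat_mult)
    ultimately show ?thesis by linarith
  qed
  have "exp (- 2) * \<delta> / (A * (4 * A + 2)) = \<delta> / A * (1 / (4 * A + 2)) * exp (- 2)" by simp
  also have "\<dots> \<le> \<delta> / A * \<epsilon> * (1 - 1 / A) ^ n"
    using eps eps0 pow \<delta> A by (intro mult_mono mult_left_mono) auto
  also have "\<dots> \<le> P n" using e1 by (intro step) auto
  finally show ?thesis by (simp add: n_def)
qed

section \<open>Generating functions of configurations\<close>

text \<open>The negative binomial coefficient: the coefficient of \<open>x ^ n\<close> in
  \<open>(1 - x) powr (- a)\<close>.\<close>

definition nb :: "real \<Rightarrow> nat \<Rightarrow> real" where
  "nb a n = (real n + a - 1) gchoose n"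

lemma nb_0 [simp]: "nb a 0 = 1"
  by (simp add: nb_def)

lemma nb_Suc: "real (Suc n) * nb a (Suc n) = (real n + a) * nb a n"
  using gbinomial_absorption[of n "real n + a"] by (simp add: nb_def add_ac)

lemma nb_Suc': "nb a (Suc n) = nb a n * ((real n + a) / real (Suc n))"
  using nb_Suc[of n a] by (simp add: field_simps del: of_nat_Suc)

lemma nb_pos: "a > 0 \<Longrightarrow> nb a n > 0"
  by (induction n) (auto simp: nb_Suc')

lemma nb_sums:
  assumes "0 \<le> x" "x < 1"
  shows "(\<lambda>n. nb a n * x ^ n) sums ((1 - x) powr (- a))"
proof -
  have "(\<lambda>n. (- a gchoose n) * (- x) ^ n) sums (1 + (- x)) powr (- a)"
    using assms by (intro gen_binomial_real) auto
  moreover have "(- a gchoose n) * (- x) ^ n = nb a n * x ^ n" for n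
    by (subst gbinomial_minus) (simp add: nb_def add_ac power_mult_distrib flip: power_mult_distrib)
  ultimately show ?thesis by simp
qed

lemma sum_nb_le:
  assumes "0 \<le> x" "x < 1" "a > 0"
  shows "(\<Sum>n\<le>K. nb a n * x ^ n) \<le> (1 - x) powr (- a)"
proof -
  have "(\<Sum>n\<le>K. nb a n * x ^ n) \<le> (\<Sum>n. nb a n * x ^ n)"
    using nb_sums[OF assms(1,2), of a] nb_pos[OF assms(3)] assms(1)
    by (intro sum_le_suminf) (auto simp: sums_iff less_imp_le)
  then show ?thesis using nb_sums[OF assms(1,2), of a] by (simp add: sums_iff)
qed

text \<open>The series of \<open>(1 - y * X ^ j) powr (- a)\<close>, where the variable
  \<open>X\<close> marks energy: a particle on level \<open>j\<close> contributes
  \<open>j\<close>.\<close>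

definition level_fps :: "nat \<Rightarrow> real \<Rightarrow> real \<Rightarrow> real fps" where
  "level_fps j y a = Abs_fps (\<lambda>n. if j dvd n then nb a (n div j) * y ^ (n div j) else 0)"

text \<open>The series of \<open>X * F' / F\<close> for \<open>F = level_fps j y a\<close>, that is,
  of \<open>j * a * y * X ^ j / (1 - y * X ^ j)\<close>. Its coefficients are the \<alpha> of the
  local lower bound.\<close>

definition logderiv_fps :: "nat \<Rightarrow> real \<Rightarrow> real \<Rightarrow> real fps" where
  "logderiv_fps j y a = Abs_fps (\<lambda>k. if j dvd k \<and> k > 0 then real j * a * y ^ (k div j) else 0)"

text \<open>Multiplication by \<open>D = 1 - y * X ^ j\<close> turns the two sides into polynomial
  multiples of \<open>level_fps\<close>, where comparing coefficients amounts to
  \<open>nb_Suc\<close>; \<open>D\<close> is nonzero and can be cancelled.\<close>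

lemma level_fps_logderiv:
  assumes "j \<ge> 1"
  shows "fps_X * fps_deriv (level_fps j y a) = level_fps j y a * logderiv_fps j y a"
proof -
  define D where "D = (1 :: real fps) - fps_const y * fps_X ^ j"
  have D: "D \<noteq> 0"
  proof
    assume "D = 0"
    then have "fps_nth D 0 = 0" by simp
    then show False using assms by (simp add: D_def)
  qed
  have Dn: "fps_nth (D * f) n = fps_nth f n - (if n < j then 0 else y * fps_nth f (n - j))" for f n
  proof -
    have "D * f = f - fps_const y * (fps_X ^ j * f)" by (simp add: D_def left_diff_distrib mult.assoc)
    then show ?thesis by (simp add: fps_X_power_mult_nth)
  qed
  have "D * (fps_X * fps_deriv (level_fps j y a)) = fps_const (real j * a * y) * (fps_X ^ j * level_fps j y a)"
  proof (rule fps_ext)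
    fix n
    have nth: "fps_nth (fps_X * fps_deriv f) m = real m * fps_nth f m" for f :: "real fps" and m
      by (cases m) auto
    show "fps_nth (D * (fps_X * fps_deriv (level_fps j y a))) n
        = fps_nth (fps_const (real j * a * y) * (fps_X ^ j * level_fps j y a)) n"
    proof (cases "j dvd n \<and> n \<ge> j")
      case True
      then obtain m where m: "n = j * Suc m"
        using assms by (metis One_nat_def Suc_le_D dvdE le_antisym less_Suc_eq_0_disj less_nat_zero_code mult_0_right not0_implies_Suc not_less_eq_eq zero_le)
      have *: "(n - j) div j = m" "n div j = Suc m" "j dvd (n - j)" "j dvd n" "\<not> n < j" "n - j = j * m"
        using m assms by (auto simp: )
      have "real n * nb a (Suc m) = real j * ((real m + a) * nb a m)"
        unfolding m of_nat_mult mult.assoc nb_Suc ..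
      then have "real n * (nb a (Suc m) * y ^ Suc m) = real j * ((real m + a) * nb a m) * y ^ Suc m"
        by (simp add: mult.assoc)
      then show ?thesis
        unfolding Dn nth fps_mult_left_const_nth fps_X_power_mult_nth
        using * by (simp add: level_fps_def algebra_simps)
    next
      case False
      then have "\<not> j dvd (n - j) \<or> n < j"
        by (meson dvd_diffD linorder_not_less dvd_refl)
      moreover have "n = 0 \<or> \<not> j dvd n" using False assms by (auto dest: dvd_imp_le)
      ultimately show ?thesis
        unfolding Dn nth fps_mult_left_const_nth fps_X_power_mult_nth
        by (auto simp: level_fps_def)
    qed
  qed
  moreover have "D * logderiv_fps j y a = fps_const (real j * a * y) * fps_X ^ j"
  proof (rule fps_ext)
    fix n
    show "fps_nth (D * logderiv_fps j y a) n = fps_nth (fps_const (real j * a * y) * fps_X ^ j) n"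
    proof (cases "j dvd n \<and> n \<ge> j")
      case True
      then obtain m where m: "n = j * Suc m"
        using assms by (metis One_nat_def Suc_le_D dvdE le_antisym less_Suc_eq_0_disj less_nat_zero_code mult_0_right not0_implies_Suc not_less_eq_eq zero_le)
      have *: "(n - j) div j = m" "n div j = Suc m" "j dvd (n - j)" "j dvd n" "\<not> n < j" "n - j = j * m" "n > 0"
        using m assms by (auto simp: )
      show ?thesis
        unfolding Dn fps_mult_left_const_nth using * assms m
        by (cases m) (auto simp: logderiv_fps_def)
    next
      case False
      then have "\<not> j dvd (n - j) \<or> n < j"
        by (meson dvd_diffD linorder_not_less dvd_refl)
      moreover have "n = 0 \<or> \<not> j dvd n" "n \<noteq> j" using False assms by (auto dest: dvd_imp_le)
      ultimately show ?thesis
        unfolding Dn fps_mult_left_const_nth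
        by (auto simp: logderiv_fps_def)
    qed
  qed
  ultimately have "D * (fps_X * fps_deriv (level_fps j y a)) = D * (level_fps j y a * logderiv_fps j y a)"
    by (simp add: mult_ac)
  then show ?thesis using D by simp
qed

lemma prod_level_fps_logderiv:
  assumes "finite S" "\<And>j. j \<in> S \<Longrightarrow> j \<ge> 1"
  shows "fps_X * fps_deriv (\<Prod>j\<in>S. level_fps j (y j) (q j))
    = (\<Prod>j\<in>S. level_fps j (y j) (q j)) * (\<Sum>j\<in>S. logderiv_fps j (y j) (q j))"
  using assms
proof (induction S rule: finite_induct)
  case (insert j S)
  let ?B = "level_fps j (y j) (q j)" and ?P = "\<Prod>j\<in>S. level_fps j (y j) (q j)"
  let ?s = "\<Sum>j\<in>S. logderiv_fps j (y j) (q j)"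
  have "fps_X * fps_deriv (?B * ?P) = (fps_X * fps_deriv ?B) * ?P + ?B * (fps_X * fps_deriv ?P)"
    by (simp add: algebra_simps)
  also have "fps_X * fps_deriv ?B = ?B * logderiv_fps j (y j) (q j)"
    using insert by (intro level_fps_logderiv) auto
  also have "fps_X * fps_deriv ?P = ?P * ?s" using insert by auto
  finally have "fps_X * fps_deriv (?B * ?P) = (?B * ?P) * (logderiv_fps j (y j) (q j) + ?s)"
    by (simp add: algebra_simps)
  then show ?case using insert by simp
qed simp

lemma sums_dvd_reindex:
  fixes f :: "nat \<Rightarrow> real"
  assumes "f sums s" "j \<ge> 1"
  shows "(\<lambda>n. if j dvd n then f (n div j) else 0) sums s"
proof -
  have "strict_mono (\<lambda>m. j * m)" using assms by (intro strict_monoI) auto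
  moreover have "(if j dvd n then f (n div j) else 0) = 0" if "n \<notin> range (\<lambda>m. j * m)" for n
    using that by auto
  ultimately have "(\<lambda>m. if j dvd (j * m) then f (j * m div j) else 0) sums s
      \<longleftrightarrow> (\<lambda>n. if j dvd n then f (n div j) else 0) sums s"
    by (rule sums_mono_reindex)
  then show ?thesis using assms by simp
qed

lemma level_fps_nonneg:
  assumes "y \<ge> 0" "a > 0"
  shows "fps_nth (level_fps j y a) n \<ge> 0"
  using assms nb_pos[OF assms(2)] by (simp add: level_fps_def less_imp_le)

text \<open>After division by the right-hand product the coefficients form the distribution of the
  total energy of independent negative binomial occupation numbers.\<close>

lemma prod_level_fps:
  assumes "finite S" "\<And>j. j \<in> S \<Longrightarrow> j \<ge> 1 \<and> 0 \<le> y j \<and> y j < 1 \<and> q j > 0"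
  shows "(\<forall>n. fps_nth (\<Prod>j\<in>S. level_fps j (y j) (q j)) n \<ge> 0) \<and>
    fps_nth (\<Prod>j\<in>S. level_fps j (y j) (q j)) sums (\<Prod>j\<in>S. (1 - y j) powr (- q j))"
  using assms
proof (induction S rule: finite_induct)
  case empty
  have e: "fps_nth (1 :: real fps) = (\<lambda>n. if n = 0 then 1 else 0)" by (auto simp: fun_eq_iff)
  have "fps_nth (1 :: real fps) sums 1"
    unfolding e by (rule sums_single[of 0 "\<lambda>_. 1 :: real"])
  moreover have "\<forall>n. fps_nth (1 :: real fps) n \<ge> 0" by simp
  ultimately show ?case unfolding prod.empty by blast
next
  case (insert j S)
  let ?B = "level_fps j (y j) (q j)" and ?P = "\<Prod>j\<in>S. level_fps j (y j) (q j)"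
  have j: "j \<ge> 1" "0 \<le> y j" "y j < 1" "q j > 0" using insert.prems by auto
  have IH: "\<And>n. fps_nth ?P n \<ge> 0" "fps_nth ?P sums (\<Prod>j\<in>S. (1 - y j) powr (- q j))"
    using insert by auto
  have B: "\<And>n. fps_nth ?B n \<ge> 0" using level_fps_nonneg j by auto
  have Bs: "fps_nth ?B sums (1 - y j) powr (- q j)"
    using sums_dvd_reindex[OF nb_sums[OF j(2,3)] j(1)] by (simp add: level_fps_def fps_nth_Abs_fps[abs_def])
  have "(\<lambda>n. \<Sum>i\<le>n. fps_nth ?B i * fps_nth ?P (n - i)) sums ((\<Sum>n. fps_nth ?B n) * (\<Sum>n. fps_nth ?P n))"
    using Bs IH B by (intro Cauchy_product_sums) (auto simp: sums_iff)
  then have "fps_nth (?B * ?P) sums ((1 - y j) powr (- q j) * (\<Prod>j\<in>S. (1 - y j) powr (- q j)))"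
    using Bs IH by (simp add: sums_iff fps_mult_nth[abs_def] atLeast0AtMost)
  moreover have "fps_nth (?B * ?P) n \<ge> 0" for n
    using B IH by (auto simp: fps_mult_nth intro!: sum_nonneg)
  ultimately show ?case using insert by simp
qed

text \<open>Vanishing off \<open>S\<close> makes a configuration determined by its values on
  \<open>S\<close>. With \<open>S = {1..J}\<close> level 0 is empty; it is refilled in
  \<open>Prob_le\<close>.\<close>

definition configs :: "nat set \<Rightarrow> nat \<Rightarrow> (nat \<Rightarrow> nat) set" where
  "configs S e = {m. (\<forall>j. j \<notin> S \<longrightarrow> m j = 0) \<and> (\<Sum>j\<in>S. j * m j) = e}"

lemma configs_insert:
  assumes "finite S" "j \<notin> S" "j \<ge> 1"
  shows "bij_betw (\<lambda>(k, m). m(j := k)) (SIGMA k:{k. j * k \<le> e}. configs S (e - j * k)) (configs (insert j S) e)"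
proof (rule bij_betwI[where g = "\<lambda>m. (m j, m(j := 0))"])
  have s: "(\<Sum>i\<in>S. i * (m(j := k)) i) = (\<Sum>i\<in>S. i * m i)" for m k
    using assms by (intro sum.cong) auto
  show "(\<lambda>(k, m). m(j := k)) \<in> (SIGMA k:{k. j * k \<le> e}. configs S (e - j * k)) \<rightarrow> configs (insert j S) e"
    using assms s by (auto simp: configs_def simp del: fun_upd_apply) (auto)
  show "(\<lambda>m. (m j, m(j := 0))) \<in> configs (insert j S) e \<rightarrow> (SIGMA k:{k. j * k \<le> e}. configs S (e - j * k))"
    using assms s by (auto simp: configs_def simp del: fun_upd_apply) (auto)
next
  fix x assume "x \<in> (SIGMA k:{k. j * k \<le> e}. configs S (e - j * k))"
  then show "((case x of (k, m) \<Rightarrow> m(j := k)) j, (case x of (k, m) \<Rightarrow> m(j := k))(j := 0)) = x"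
    using assms by (auto simp: configs_def)
next
  fix m assume "m \<in> configs (insert j S) e"
  show "(case (m j, m(j := 0)) of (k, m) \<Rightarrow> m(j := k)) = m" by auto
qed

lemma finite_configs:
  assumes "finite S" "\<And>j. j \<in> S \<Longrightarrow> j \<ge> 1"
  shows "finite (configs S e)"
  using assms
proof (induction S arbitrary: e rule: finite_induct)
  case empty
  have "configs {} e \<subseteq> {\<lambda>_. 0}" by (auto simp: configs_def)
  then show ?case using finite_subset by blast
next
  case (insert j S)
  have "{k. j * k \<le> e} \<subseteq> {..e}"
  proof
    fix k assume "k \<in> {k. j * k \<le> e}"
    moreover have "1 * k \<le> j * k" using insert.prems by (intro mult_right_mono) auto
    ultimately show "k \<in> {..e}" by (simp only: mem_Collect_eq atMost_iff mult_1)
  qed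
  then have "finite {k. j * k \<le> e}" using finite_subset by blast
  then have "finite (SIGMA k:{k. j * k \<le> e}. configs S (e - j * k))"
    using insert by (intro finite_SigmaI) auto
  moreover have "bij_betw (\<lambda>(k, m). m(j := k)) (SIGMA k:{k. j * k \<le> e}. configs S (e - j * k)) (configs (insert j S) e)"
    using insert by (intro configs_insert) auto
  ultimately show ?case using bij_betw_finite by blast
qed

lemma prod_level_fps_nth:
  assumes "finite S" "\<And>j. j \<in> S \<Longrightarrow> j \<ge> 1"
  shows "fps_nth (\<Prod>j\<in>S. level_fps j (y j) (q j)) e
    = (\<Sum>m\<in>configs S e. \<Prod>j\<in>S. nb (q j) (m j) * y j ^ m j)"
  using assms
proof (induction S arbitrary: e rule: finite_induct)
  case empty
  have "configs {} e = (if e = 0 then {\<lambda>_. 0} else {})" by (auto simp: configs_def)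
  then show ?case by simp
next
  case (insert j S)
  let ?t = "\<lambda>j n. nb (q j) n * y j ^ n"
  let ?P = "\<Prod>j\<in>S. level_fps j (y j) (q j)"
  have j: "j \<ge> 1" and fin: "finite (configs S i)" for i using insert finite_configs[of S] by auto
  have K: "{i\<in>{..e}. j dvd i} = (\<lambda>k. j * k) ` {k. j * k \<le> e}" by auto
  have fK: "finite {k. j * k \<le> e}"
  proof -
    have "inj_on (\<lambda>k. j * k) {k. j * k \<le> e}" using j by (auto simp: inj_on_def)
    moreover have "finite ((\<lambda>k. j * k) ` {k. j * k \<le> e})" unfolding K[symmetric] by simp
    ultimately show ?thesis using finite_imageD by blast
  qed
  have "fps_nth (level_fps j (y j) (q j) * ?P) e
      = (\<Sum>i\<in>{..e}. if j dvd i then ?t j (i div j) * fps_nth ?P (e - i) else 0)"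
    unfolding fps_mult_nth atLeast0AtMost by (intro sum.cong) (auto simp: level_fps_def)
  also have "\<dots> = (\<Sum>i\<in>{i\<in>{..e}. j dvd i}. ?t j (i div j) * fps_nth ?P (e - i))"
    by (subst sum.inter_filter) auto
  also have "\<dots> = (\<Sum>k\<in>{k. j * k \<le> e}. ?t j k * fps_nth ?P (e - j * k))"
    unfolding K using j by (subst sum.reindex) (auto simp: inj_on_def)
  also have "\<dots> = (\<Sum>k\<in>{k. j * k \<le> e}. \<Sum>m\<in>configs S (e - j * k). ?t j k * (\<Prod>i\<in>S. ?t i (m i)))"
    using insert by (intro sum.cong) (auto simp: sum_distrib_left)
  also have "\<dots> = (\<Sum>(k, m)\<in>(SIGMA k:{k. j * k \<le> e}. configs S (e - j * k)). ?t j k * (\<Prod>i\<in>S. ?t i (m i)))"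
    using fin fK by (intro sum.Sigma) auto
  also have "\<dots> = (\<Sum>x\<in>(SIGMA k:{k. j * k \<le> e}. configs S (e - j * k)).
      \<Prod>i\<in>insert j S. ?t i ((case x of (k, m) \<Rightarrow> m(j := k)) i))"
  proof (intro sum.cong refl)
    fix x assume "x \<in> (SIGMA k:{k. j * k \<le> e}. configs S (e - j * k))"
    obtain k m where x: "x = (k, m)" by (cases x)
    have "(\<Prod>i\<in>S. ?t i ((m(j := k)) i)) = (\<Prod>i\<in>S. ?t i (m i))"
      using insert by (intro prod.cong) auto
    then show "(case x of (k, m) \<Rightarrow> ?t j k * (\<Prod>i\<in>S. ?t i (m i)))
        = (\<Prod>i\<in>insert j S. ?t i ((case x of (k, m) \<Rightarrow> m(j := k)) i))"
      using insert x by (simp del: fun_upd_apply) simp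
  qed
  also have "\<dots> = (\<Sum>m\<in>configs (insert j S) e. \<Prod>i\<in>insert j S. ?t i (m i))"
    by (rule sum.reindex_bij_betw[OF configs_insert]) (use insert j in auto)
  finally show ?case using insert by simp
qed

text \<open>Enlarging the sum to a box of all values up to \<open>K\<close> makes it factor into
  partial sums of binomial series. Only injectivity of the restriction is asked of \<open>X\<close>,
  so that the lemma covers \<open>configs\<close> as well as \<open>Omega\<close>, where level 0 is
  determined by the other levels.\<close>

lemma sum_weight_le:
  assumes X: "finite X" "inj_on (\<lambda>m. restrict m S) X" and S: "finite S"
    and y: "\<And>j. j \<in> S \<Longrightarrow> 0 \<le> y j \<and> y j < 1 \<and> q j > 0"
  shows "(\<Sum>m\<in>X. \<Prod>j\<in>S. nb (q j) (m j) * y j ^ m j) \<le> (\<Prod>j\<in>S. (1 - y j) powr (- q j))"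
proof -
  let ?t = "\<lambda>j n. nb (q j) n * y j ^ n"
  have t: "?t j n \<ge> 0" if "j \<in> S" for j n using y[OF that] nb_pos[of "q j" n] by simp
  define K where "K = Max (insert 0 ((\<lambda>(m, j). m j) ` (X \<times> S)))"
  have K: "m j \<le> K" if "m \<in> X" "j \<in> S" for m j
    unfolding K_def using that X S by (intro Max_ge) auto
  have "(\<Sum>m\<in>X. \<Prod>j\<in>S. ?t j (m j)) = (\<Sum>m\<in>X. \<Prod>j\<in>S. ?t j (restrict m S j))"
    by (intro sum.cong prod.cong) auto
  also have "\<dots> = (\<Sum>m\<in>(\<lambda>m. restrict m S) ` X. \<Prod>j\<in>S. ?t j (m j))"
    using X by (subst sum.reindex) auto
  also have "\<dots> \<le> (\<Sum>m\<in>PiE S (\<lambda>_. {..K}). \<Prod>j\<in>S. ?t j (m j))"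
    using S K t by (intro sum_mono2 finite_PiE) (auto intro!: prod_nonneg)
  also have "\<dots> = (\<Prod>j\<in>S. \<Sum>n\<le>K. ?t j n)"
    using S by (intro prod_sum_PiE[symmetric]) auto
  also have "\<dots> \<le> (\<Prod>j\<in>S. (1 - y j) powr (- q j))"
    using y t by (intro prod_mono conjI sum_nonneg sum_nb_le) auto
  finally show ?thesis .
qed

lemma logderiv_fps_sums:
  assumes "j \<ge> 1" "0 \<le> y" "y < 1"
  shows "fps_nth (logderiv_fps j y a) sums (real j * a * (y / (1 - y)))"
proof -
  have "(\<lambda>n. y ^ n) sums (1 / (1 - y))" using assms by (intro geometric_sums) auto
  then have "(\<lambda>n. y ^ Suc n) sums (1 / (1 - y) - y ^ 0)"
    by (subst sums_Suc_iff) auto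
  moreover have "1 / (1 - y) - y ^ 0 = y / (1 - y)" using assms by (simp add: field_simps)
  ultimately have "(\<lambda>n. real j * a * y ^ Suc n) sums (real j * a * (y / (1 - y)))"
    by (metis sums_mult)
  then have "(\<lambda>n. (if Suc n > 0 then real j * a * y ^ Suc n else 0)) sums (real j * a * (y / (1 - y)))"
    by simp
  then have "(\<lambda>n. if n > 0 then real j * a * y ^ n else 0) sums (real j * a * (y / (1 - y)))"
    using sums_Suc_iff[of "\<lambda>n. if n > 0 then real j * a * y ^ n else 0" "real j * a * (y / (1 - y))"] by simp
  then have "(\<lambda>n. if j dvd n then if n div j > 0 then real j * a * y ^ (n div j) else 0 else 0)
      sums (real j * a * (y / (1 - y)))"
    using assms(1) by (intro sums_dvd_reindex)
  moreover have "fps_nth (logderiv_fps j y a) = (\<lambda>n. if j dvd n then if n div j > 0 then real j * a * y ^ (n div j) else 0 else 0)"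
    using assms(1) by (auto simp: logderiv_fps_def fun_eq_iff div_greater_zero_iff dest: dvd_imp_le)
  ultimately show ?thesis by simp
qed

section \<open>The energy distribution at its mean\<close>

context level_weights
begin

text \<open>The coefficient is the sum of \<open>j * q j * y j ^ (k div j)\<close> over divisors
  \<open>j\<close> of \<open>k\<close>, and each such power of \<open>y j\<close> is at most
  \<open>exp (- \<theta> * k)\<close>. Counting at most \<open>k\<close> divisors costs one more
  power of \<open>k\<close>.\<close>

lemma logderiv_coeff_le:
  assumes y: "\<And>j. j \<in> {1..J} \<Longrightarrow> 0 \<le> y j \<and> y j \<le> exp (- (\<theta> * real j))" and k: "k \<ge> 1"
  shows "fps_nth (\<Sum>j=1..J. logderiv_fps j (y j) (q j)) k \<le> C0 * (real k powr (d + 1) * exp (- (\<theta> * real k)))"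
proof -
  have t: "fps_nth (logderiv_fps j (y j) (q j)) k
      \<le> (if j \<in> {1..k} then C0 * real k powr d * exp (- (\<theta> * real k)) else 0)" if j: "j \<in> {1..J}" for j
  proof (cases "j dvd k")
    case True
    then obtain r where r: "k = j * r" by blast
    have jk: "j \<le> k" using True k by (auto dest: dvd_imp_le)
    have "y j ^ r \<le> exp (- (\<theta> * real j)) ^ r" using y[OF j] by (intro power_mono) auto
    also have "\<dots> = exp (- (\<theta> * real k))" by (simp add: r mult_ac flip: exp_of_nat_mult)
    finally have yr: "y j ^ r \<le> exp (- (\<theta> * real k))" .
    have "real j * q j \<le> real k * (C0 * real k powr (d - 1))"
    proof (intro mult_mono)
      have "real j powr (d - 1) \<le> real k powr (d - 1)" using jk d_gt by (intro powr_mono2) auto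
      then have "C0 * real j powr (d - 1) \<le> C0 * real k powr (d - 1)" using C0_pos by (intro mult_left_mono) auto
      with q_le[of j] j show "q j \<le> C0 * real k powr (d - 1)" by auto
    qed (use jk q_pos[of j] j in auto)
    also have "\<dots> = C0 * real k powr d" using k powr_add[of "real k" "d - 1" 1] by simp
    finally have "real j * q j * y j ^ r \<le> C0 * real k powr d * exp (- (\<theta> * real k))"
      by (rule mult_mono) (use yr y[OF j] C0_pos in auto)
    then show ?thesis using True j jk k r by (simp add: logderiv_fps_def)
  next
    case False
    then show ?thesis using C0_pos by (simp add: logderiv_fps_def)
  qed
  have "fps_nth (\<Sum>j=1..J. logderiv_fps j (y j) (q j)) k
      \<le> (\<Sum>j=1..J. if j \<in> {1..k} then C0 * real k powr d * exp (- (\<theta> * real k)) else 0)"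
    unfolding fps_sum_nth by (intro sum_mono t)
  also have "\<dots> = (\<Sum>j\<in>{1..J} \<inter> {1..k}. C0 * real k powr d * exp (- (\<theta> * real k)))"
    by (rule sum.inter_restrict[symmetric]) simp
  also have "\<dots> \<le> (\<Sum>j\<in>{1..k}. C0 * real k powr d * exp (- (\<theta> * real k)))"
    using C0_pos by (intro sum_mono2) auto
  also have "\<dots> = C0 * (real k powr (d + 1) * exp (- (\<theta> * real k)))"
    using k by (simp add: powr_add)
  finally show ?thesis .
qed

text \<open>All coefficients together add up to the mean energy, so the left side is the sum over
  \<open>k > L\<close>. Half of the exponential decay yields the factor in \<open>L\<close>, the
  other half makes the sum converge.\<close>

lemma logderiv_tail:
  "\<exists>C>0. \<forall>\<theta>>0. \<forall>J L (y :: nat \<Rightarrow> real). (\<forall>j\<in>{1..J}. 0 \<le> y j \<and> y j \<le> exp (- (\<theta> * real j))) \<longrightarrow>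
    (\<Sum>j=1..J. real j * q j * (y j / (1 - y j))) - (\<Sum>k=1..L. fps_nth (\<Sum>j=1..J. logderiv_fps j (y j) (q j)) k)
      \<le> C * \<theta> powr (- d - 2) * exp (- (\<theta> / 2 * real L))"
proof -
  obtain C where C: "C > 0" "\<And>b J. b > 0 \<Longrightarrow>
      (\<Sum>j=1..J. real j powr (d + 1) * exp (- (b * real j))) \<le> C * b powr (- (d + 1) - 1)"
    using sum_powr_exp_bound[of "d + 1"] d_gt by auto
  show ?thesis
  proof (intro exI[of _ "C0 * C * 2 powr (d + 2)"] conjI allI impI)
    show "C0 * C * 2 powr (d + 2) > 0" using C C0_pos by simp
    fix \<theta> :: real and J L and y :: "nat \<Rightarrow> real"
    assume \<theta>: "\<theta> > 0" and y: "\<forall>j\<in>{1..J}. 0 \<le> y j \<and> y j \<le> exp (- (\<theta> * real j))"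
    let ?\<alpha> = "fps_nth (\<Sum>j=1..J. logderiv_fps j (y j) (q j))"
    let ?A = "\<Sum>j=1..J. real j * q j * (y j / (1 - y j))"
    let ?R = "C0 * C * 2 powr (d + 2) * \<theta> powr (- d - 2) * exp (- (\<theta> / 2 * real L))"
    have y1: "y j < 1" if "j \<in> {1..J}" for j
    proof -
      have "exp (- (\<theta> * real j)) < 1" using that \<theta> by auto
      then show ?thesis using y that le_less_trans by blast
    qed
    have "(\<lambda>k. \<Sum>j=1..J. fps_nth (logderiv_fps j (y j) (q j)) k) sums ?A"
      using y y1 by (intro sums_sum logderiv_fps_sums) auto
    then have sums: "?\<alpha> sums ?A" by (simp add: fps_sum_nth[abs_def])
    have "(\<Sum>k<n. ?\<alpha> k) \<le> (\<Sum>k=1..L. ?\<alpha> k) + ?R" for n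
    proof -
      have nonneg: "?\<alpha> k \<ge> 0" for k
        using y q_pos unfolding fps_sum_nth by (intro sum_nonneg) (auto simp: logderiv_fps_def less_imp_le)
      have z: "?\<alpha> 0 = 0" by (simp add: fps_sum_nth logderiv_fps_def)
      have "(\<Sum>k<n. ?\<alpha> k) \<le> (\<Sum>k\<in>insert 0 ({1..L} \<union> {L<..n}). ?\<alpha> k)"
        using nonneg by (intro sum_mono2) auto
      also have "\<dots> = (\<Sum>k\<in>{1..L} \<union> {L<..n}. ?\<alpha> k)" using z by (subst sum.insert) auto
      also have "\<dots> = (\<Sum>k=1..L. ?\<alpha> k) + (\<Sum>k\<in>{L<..n}. ?\<alpha> k)" by (intro sum.union_disjoint) auto
      also have "(\<Sum>k\<in>{L<..n}. ?\<alpha> k)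
          \<le> (\<Sum>k\<in>{L<..n}. C0 * exp (- (\<theta> / 2 * real L)) * (real k powr (d + 1) * exp (- (\<theta> / 2 * real k))))"
      proof (intro sum_mono)
        fix k assume k: "k \<in> {L<..n}"
        have "?\<alpha> k \<le> C0 * (real k powr (d + 1) * exp (- (\<theta> * real k)))"
          using y k by (intro logderiv_coeff_le) auto
        also have "\<dots> \<le> C0 * (real k powr (d + 1) * (exp (- (\<theta> / 2 * real L)) * exp (- (\<theta> / 2 * real k))))"
        proof (intro mult_left_mono)
          have "\<theta> / 2 * real L \<le> \<theta> / 2 * real k" using k \<theta> by (intro mult_left_mono) auto
          then show "exp (- (\<theta> * real k)) \<le> exp (- (\<theta> / 2 * real L)) * exp (- (\<theta> / 2 * real k))"
            by (simp flip: exp_add)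
        qed (use C0_pos in auto)
        finally show "?\<alpha> k \<le> C0 * exp (- (\<theta> / 2 * real L)) * (real k powr (d + 1) * exp (- (\<theta> / 2 * real k)))"
          by (simp add: mult_ac)
      qed
      also have "\<dots> = C0 * exp (- (\<theta> / 2 * real L)) * (\<Sum>k\<in>{L<..n}. real k powr (d + 1) * exp (- (\<theta> / 2 * real k)))"
        by (rule sum_distrib_left[symmetric])
      also have "(\<Sum>k\<in>{L<..n}. real k powr (d + 1) * exp (- (\<theta> / 2 * real k)))
          \<le> (\<Sum>k=1..n. real k powr (d + 1) * exp (- (\<theta> / 2 * real k)))"
        by (intro sum_mono2) auto
      also have "\<dots> \<le> C * (\<theta> / 2) powr (- (d + 1) - 1)" using \<theta> by (intro C) auto
      also have "(\<theta> / 2) powr (- (d + 1) - 1) = 2 powr (d + 2) * \<theta> powr (- d - 2)"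
      proof -
        have e: "- (d + 1) - 1 = - (d + 2)" "- d - 2 = - (d + 2)" by auto
        have "(\<theta> / 2) powr (d + 2) = \<theta> powr (d + 2) / 2 powr (d + 2)"
          using \<theta> by (simp add: powr_divide)
        then show ?thesis unfolding e powr_minus by (simp only: inverse_divide) (simp only: divide_inverse)
      qed
      also have "C0 * exp (- (\<theta> / 2 * real L)) * (C * (2 powr (d + 2) * \<theta> powr (- d - 2))) = ?R"
        by (simp only: mult_ac)
      finally show ?thesis using C0_pos by (simp add: mult_left_mono)
    qed
    then have "?A \<le> (\<Sum>k=1..L. ?\<alpha> k) + ?R"
      using sums unfolding sums_def by (intro LIMSEQ_le_const2) auto
    then show "?A - (\<Sum>k=1..L. ?\<alpha> k) \<le> ?R" by simp
  qed
qed

text \<open>The local lower bound applied to the normalised energy distribution. It is stated for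
  general \<open>y j\<close> between two exponentials so that it applies to the tilted parameters;
  \<open>b powr (- 2) \<le> J\<close> ensures that level \<open>k\<close> itself is present for
  every \<open>k \<le> L\<close>.\<close>

lemma coeff_ge:
  "\<exists>K>0. \<forall>\<^sub>F b in at_right 0. \<forall>J (y :: nat \<Rightarrow> real) A. b powr (- 2) \<le> real J \<longrightarrow>
    (\<forall>j\<in>{1..J}. exp (- (b * real j) - 1) \<le> y j \<and> y j \<le> exp (- (b / 2 * real j))) \<longrightarrow>
    A = (\<Sum>j=1..J. real j * q j * (y j / (1 - y j))) \<longrightarrow> 2 \<le> A \<longrightarrow> A \<le> b powr (- d - 2) \<longrightarrow>
    fps_nth (\<Prod>j=1..J. level_fps j (y j) (q j)) (nat \<lfloor>A\<rfloor>) \<ge> b powr K * (\<Prod>j=1..J. (1 - y j) powr (- q j))"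
proof -
  obtain C where C: "C > 0" "\<And>\<theta> J L (y :: nat \<Rightarrow> real). \<theta> > 0 \<Longrightarrow>
    (\<And>j. j\<in>{1..J} \<Longrightarrow> 0 \<le> y j \<and> y j \<le> exp (- (\<theta> * real j))) \<Longrightarrow>
    (\<Sum>j=1..J. real j * q j * (y j / (1 - y j))) - (\<Sum>k=1..L. fps_nth (\<Sum>j=1..J. logderiv_fps j (y j) (q j)) k)
      \<le> C * \<theta> powr (- d - 2) * exp (- (\<theta> / 2 * real L))"
    using logderiv_tail by blast
  define c1 where "c1 = min 1 c0"
  have c1: "0 < c1" "c1 \<le> 1" "c1 \<le> c0" using c0_pos by (auto simp: c1_def)
  have ev1: "\<forall>\<^sub>F b in at_right 0. 4 * (d + 3) * ln (1 / b) / b + 1 \<le> b powr (- 2 :: real)"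
    using d_gt by real_asymp
  have ev2: "\<forall>\<^sub>F b in at_right 0. C * (b / 2) powr (- d - 2) * b powr (d + 3) \<le> (1 :: real)"
    using d_gt C(1) by real_asymp
  \<comment> \<open>The exponent: \<open>4 * (d + 3)\<close> from \<delta>,
    \<open>2 * (d + 2)\<close> from the two factors of order \<open>A\<close> in the denominator,
    and 1 to absorb constants.\<close>
  have ev3: "\<forall>\<^sub>F b in at_right 0. b powr (6 * d + 17 :: real)
      \<le> exp (- 2) * (c1 * exp (- 2) * b powr (4 * (d + 3))) / (b powr (- d - 2) * (4 * b powr (- d - 2) + 2))"
    using d_gt c1 by real_asymp
  have ev4: "\<forall>\<^sub>F b in at_right 0. 0 < b \<and> b < (1 :: real)"
    using eventually_at_right_real[of 0 "1 :: real"] by simp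
  have "\<forall>\<^sub>F b in at_right 0. \<forall>J (y :: nat \<Rightarrow> real) A. b powr (- 2) \<le> real J \<longrightarrow>
    (\<forall>j\<in>{1..J}. exp (- (b * real j) - 1) \<le> y j \<and> y j \<le> exp (- (b / 2 * real j))) \<longrightarrow>
    A = (\<Sum>j=1..J. real j * q j * (y j / (1 - y j))) \<longrightarrow> 2 \<le> A \<longrightarrow> A \<le> b powr (- d - 2) \<longrightarrow>
    fps_nth (\<Prod>j=1..J. level_fps j (y j) (q j)) (nat \<lfloor>A\<rfloor>)
      \<ge> b powr (6 * d + 17) * (\<Prod>j=1..J. (1 - y j) powr (- q j))"
    using ev1 ev2 ev3 ev4
  proof eventually_elim
    case (elim b)
    then have b: "0 < b" "b < 1" by auto
    show ?case
    proof (intro allI impI)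
      fix J and y :: "nat \<Rightarrow> real" and A
      assume J: "b powr (- 2) \<le> real J"
        and y: "\<forall>j\<in>{1..J}. exp (- (b * real j) - 1) \<le> y j \<and> y j \<le> exp (- (b / 2 * real j))"
        and A: "A = (\<Sum>j=1..J. real j * q j * (y j / (1 - y j)))" "2 \<le> A" "A \<le> b powr (- d - 2)"
      \<comment> \<open>With decay rate \<open>b / 2\<close> the tail beyond \<open>L\<close>
        carries the factor \<open>exp (- b * L / 4)\<close>, which is at most
        \<open>b powr (d + 3)\<close>. This beats the prefactor of order
        \<open>b powr (- d - 2)\<close> and brings the tail below 1.\<close>
      define L where "L = nat \<lceil>4 * (d + 3) * ln (1 / b) / b\<rceil>"
      define \<alpha> where "\<alpha> = fps_nth (\<Sum>j=1..J. logderiv_fps j (y j) (q j))"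
      define F where "F = (\<Prod>j=1..J. level_fps j (y j) (q j))"
      define Z where "Z = (\<Prod>j=1..J. (1 - y j) powr (- q j))"
      have l: "ln (1 / b) \<ge> 0" using b by simp
      have L: "4 * (d + 3) * ln (1 / b) / b \<le> real L" "real L \<le> 4 * (d + 3) * ln (1 / b) / b + 1"
        using l d_gt b unfolding L_def by (auto intro!: of_nat_ceiling)
      have LJ: "L \<le> J" using L(2) elim(1) J by linarith
      have y01: "0 < y j \<and> y j < 1" if "j \<in> {1..J}" for j
      proof -
        have "0 < exp (- (b * real j) - 1)" by simp
        moreover have "exp (- (b / 2 * real j)) < 1" using that b by auto
        ultimately show ?thesis using y that by (meson less_le_trans le_less_trans)
      qed
      have F: "\<And>n. fps_nth F n \<ge> 0" "fps_nth F sums Z"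
        unfolding F_def Z_def using prod_level_fps[of "{1..J}" y q] y01 q_pos by (auto simp: less_imp_le)
      have Zpos: "Z > 0" unfolding Z_def
      proof (intro prod_pos ballI)
        fix j assume "j \<in> {1..J}"
        from y01[OF this] show "0 < (1 - y j) powr (- q j)" by simp
      qed
      have \<alpha>0: "\<alpha> k \<ge> 0" for k
        unfolding \<alpha>_def fps_sum_nth using y01 q_pos
        by (intro sum_nonneg) (auto simp: logderiv_fps_def less_imp_le)
      define \<delta> where "\<delta> = c1 * exp (- 2) * b powr (4 * (d + 3))"
      have "exp (- 2) * \<delta> / (A * (4 * A + 2)) \<le> fps_nth F (nat \<lfloor>A\<rfloor>) / Z"
      proof (rule local_lower_bound[where \<alpha> = \<alpha> and L = L])
        show "0 \<le> fps_nth F e / Z" for e using F Zpos by simp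
        show "\<alpha> 0 = 0" by (simp add: \<alpha>_def fps_sum_nth logderiv_fps_def)
        show "real e * (fps_nth F e / Z) = (\<Sum>k\<le>e. \<alpha> k * (fps_nth F (e - k) / Z))" for e
        proof -
          have "fps_X * fps_deriv F = (\<Sum>j=1..J. logderiv_fps j (y j) (q j)) * F"
            unfolding F_def by (subst prod_level_fps_logderiv) (auto simp: mult.commute)
          then have "fps_nth (fps_X * fps_deriv F) e = (\<Sum>k\<le>e. \<alpha> k * fps_nth F (e - k))"
            by (simp add: \<alpha>_def fps_mult_nth atLeast0AtMost)
          moreover have "fps_nth (fps_X * fps_deriv F) e = real e * fps_nth F e"
            by (cases e) auto
          ultimately have "real e * fps_nth F e = (\<Sum>k\<le>e. \<alpha> k * fps_nth F (e - k))" by metis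
          then show ?thesis by (simp only: times_divide_eq_right sum_divide_distrib[symmetric])
        qed
        have "(\<lambda>k. \<Sum>j=1..J. fps_nth (logderiv_fps j (y j) (q j)) k) sums A"
          unfolding A(1) using y01 by (intro sums_sum logderiv_fps_sums) (auto simp: less_imp_le)
        then show "\<alpha> sums A" by (simp add: \<alpha>_def fps_sum_nth[abs_def])
        show "(\<lambda>e. fps_nth F e / Z) sums 1" using sums_divide[OF F(2), of Z] Zpos by simp
        show "0 < \<delta>" using c1 b by (simp add: \<delta>_def)
        have "b powr (4 * (d + 3)) \<le> 1" using b d_gt by (intro powr_le1) auto
        then show "\<delta> \<le> 1" unfolding \<delta>_def using c1 b by (intro mult_le_one) auto
        \<comment> \<open>The divisor \<open>j = k\<close> alone contributes
          \<open>k * q k * y k\<close>, and \<open>y k\<close> is a power of \<open>b\<close> since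
          \<open>b * k\<close> is of order \<open>ln (1 / b)\<close> at most.\<close>
        show "\<delta> \<le> \<alpha> k" if "1 \<le> k" "k \<le> L" for k
        proof -
          have kJ: "k \<in> {1..J}" using that LJ by auto
          have "b * real k \<le> b * (4 * (d + 3) * ln (1 / b) / b + 1)"
            using that L(2) b by (intro mult_left_mono) auto
          also have "\<dots> = 4 * (d + 3) * ln (1 / b) + b" using b by (simp add: field_simps)
          finally have "b * real k + 1 \<le> 4 * (d + 3) * ln (1 / b) + 2" using b by linarith
          then have "exp (- (4 * (d + 3) * ln (1 / b)) - 2) \<le> exp (- (b * real k) - 1)" by simp
          moreover have "exp (- (4 * (d + 3) * ln (1 / b)) - 2) = exp (- 2) * b powr (4 * (d + 3))"
            using b by (simp add: powr_def ln_div exp_diff exp_minus field_simps)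
          moreover have "exp (- (b * real k) - 1) \<le> y k" using y kJ by blast
          ultimately have yk: "exp (- 2) * b powr (4 * (d + 3)) \<le> y k" by linarith
          have "\<delta> = c1 * (exp (- 2) * b powr (4 * (d + 3)))" by (simp add: \<delta>_def)
          also have "\<dots> \<le> q k * y k" using yk c1 q_ge_c0[of k] that by (intro mult_mono) auto
          also have "\<dots> \<le> real k * q k * y k"
            using that q_pos[of k] y01[OF kJ] by simp
          also have "\<dots> = fps_nth (logderiv_fps k (y k) (q k)) k" using that by (simp add: logderiv_fps_def)
          also have "\<dots> \<le> \<alpha> k" unfolding \<alpha>_def fps_sum_nth
            using kJ y01 q_pos by (intro member_le_sum) (auto simp: logderiv_fps_def less_imp_le)
          finally show ?thesis .
        qed
        have "A - (\<Sum>k=1..L. \<alpha> k) \<le> C * (b / 2) powr (- d - 2) * exp (- (b / 2 / 2 * real L))"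
          unfolding A(1) \<alpha>_def using b y y01 by (intro C) (auto simp: less_imp_le)
        also have "exp (- (b / 2 / 2 * real L)) \<le> b powr (d + 3)"
        proof -
          have "b / 4 * (4 * (d + 3) * ln (1 / b) / b) \<le> b / 4 * real L"
            using L(1) b by (intro mult_left_mono) auto
          moreover have "b / 4 * (4 * (d + 3) * ln (1 / b) / b) = (d + 3) * ln (1 / b)" using b by simp
          ultimately have "(d + 3) * ln (1 / b) \<le> b / 4 * real L" by linarith
          then have "exp (- (b / 4 * real L)) \<le> exp (- ((d + 3) * ln (1 / b)))" by simp
          also have "\<dots> = b powr (d + 3)" using b by (simp add: powr_def ln_div)
          finally show ?thesis by simp
        qed
        then have "C * (b / 2) powr (- d - 2) * exp (- (b / 2 / 2 * real L))
            \<le> C * (b / 2) powr (- d - 2) * b powr (d + 3)"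
          using C(1) by (intro mult_left_mono) auto
        also note elim(2)
        finally show "A - 1 \<le> sum \<alpha> {1..L}" by linarith
      qed (use A \<alpha>0 in auto)
      moreover have "b powr (6 * d + 17) \<le> exp (- 2) * \<delta> / (A * (4 * A + 2))"
      proof -
        have "exp (- 2) * \<delta> / (b powr (- d - 2) * (4 * b powr (- d - 2) + 2)) \<le> exp (- 2) * \<delta> / (A * (4 * A + 2))"
          using A c1 b by (intro divide_left_mono mult_mono) (auto simp: \<delta>_def intro!: mult_pos_pos add_pos_pos)
        with elim(3) show ?thesis unfolding \<delta>_def by linarith
      qed
      ultimately have "b powr (6 * d + 17) \<le> fps_nth F (nat \<lfloor>A\<rfloor>) / Z" by linarith
      then show "b powr (6 * d + 17) * (\<Prod>j=1..J. (1 - y j) powr (- q j))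
          \<le> fps_nth (\<Prod>j=1..J. level_fps j (y j) (q j)) (nat \<lfloor>A\<rfloor>)"
        using Zpos by (simp add: F_def Z_def field_simps)
    qed
  qed
  then show ?thesis using d_gt by (intro exI[of _ "6 * d + 17"]) auto
qed

end

section \<open>Tilting\<close>

lemma powr_eq_exp_phi: "x > 0 \<Longrightarrow> (1 - exp (- x)) powr (- a) = exp (a * phi x)"
  by (simp add: powr_def phi_def)

lemma continuous_on_bose [continuous_intros]:
  assumes "continuous_on A g" "\<And>x. x \<in> A \<Longrightarrow> g x > 0"
  shows "continuous_on A (\<lambda>x. bose (g x))"
proof -
  have "exp (g x) - 1 \<noteq> 0" if "x \<in> A" for x using assms(2)[OF that] by simp
  then show ?thesis unfolding bose_def by (intro continuous_intros assms) auto
qed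

lemma continuous_on_phi [continuous_intros]:
  assumes "continuous_on A g" "\<And>x. x \<in> A \<Longrightarrow> g x > 0"
  shows "continuous_on A (\<lambda>x. phi (g x))"
proof -
  have "1 - exp (- g x) \<noteq> 0" if "x \<in> A" for x using assms(2)[OF that] by simp
  then show ?thesis unfolding phi_def by (intro continuous_intros assms) auto
qed

lemma prod_tilt:
  fixes m :: "nat \<Rightarrow> nat"
  shows "(\<Prod>j=1..J. nb (q j) (m j) * exp (- (a * real j + \<mu>)) ^ m j)
    = (\<Prod>j=1..J. nb (q j) (m j)) * exp (- (a * real (\<Sum>j=1..J. j * m j)) - \<mu> * real (\<Sum>j=1..J. m j))"
proof -
  have "(\<Prod>j=1..J. exp (- (a * real j + \<mu>)) ^ m j) = exp (\<Sum>j=1..J. real (m j) * (- (a * real j + \<mu>)))"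
    by (subst exp_sum) (simp_all flip: exp_of_nat_mult)
  also have "(\<Sum>j=1..J. real (m j) * (- (a * real j + \<mu>)))
      = - (a * real (\<Sum>j=1..J. j * m j)) - \<mu> * real (\<Sum>j=1..J. m j)"
    by (simp add: sum_distrib_left algebra_simps sum.distrib sum_negf sum_subtractf)
  finally show ?thesis by (simp only: prod.distrib)
qed

section \<open>Tilts in number and energy and their cumulants\<close>

context level_weights
begin

definition number :: "real \<Rightarrow> nat \<Rightarrow> real" where
  "number b J = (\<Sum>j=1..J. q j * bose (b * real j))"

definition energy :: "real \<Rightarrow> nat \<Rightarrow> real" where
  "energy b J = (\<Sum>j=1..J. real j * q j * bose (b * real j))"

definition partition_fn :: "real \<Rightarrow> nat \<Rightarrow> real" where
  "partition_fn b J = exp (\<Sum>j=1..J. q j * phi (b * real j))"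

text \<open>The logarithm of the expectation of
  \<open>exp (- \<mu> * (S - E S) + \<beta> * (H - E H))\<close>, where \<open>S\<close> and
  \<open>H\<close> are the number and the energy of independent negative binomial occupation numbers
  at \<open>b\<close>.\<close>

definition Gam :: "real \<Rightarrow> nat \<Rightarrow> real \<Rightarrow> real \<Rightarrow> real" where
  "Gam b J \<mu> \<beta> = (\<Sum>j=1..J. q j * psi (b * real j) (\<mu> - \<beta> * real j))"

lemma exp_sum_phi_tilt:
  "exp (\<Sum>j=1..J. q j * phi ((b - \<beta>) * real j + \<mu>))
    = partition_fn b J * exp (Gam b J \<mu> \<beta> - \<mu> * number b J + \<beta> * energy b J)"
proof -
  have "q j * phi ((b - \<beta>) * real j + \<mu>) = q j * phi (b * real j)
      + (q j * psi (b * real j) (\<mu> - \<beta> * real j) - \<mu> * (q j * bose (b * real j)) + \<beta> * (real j * q j * bose (b * real j)))" for j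
    by (simp add: psi_def algebra_simps)
  then show ?thesis
    unfolding partition_fn_def Gam_def number_def energy_def exp_add[symmetric]
    by (simp add: sum.distrib sum_subtractf sum_distrib_left)
qed

lemma prod_powr_eq_exp:
  assumes "\<And>j. j \<in> {1..J} \<Longrightarrow> x j > 0"
  shows "(\<Prod>j=1..J. (1 - exp (- x j)) powr (- q j)) = exp (\<Sum>j=1..J. q j * phi (x j))"
  unfolding exp_sum[OF finite_atLeastAtMost] using assms by (intro prod.cong refl powr_eq_exp_phi) auto

lemma tilted_exponent_ge:
  assumes \<beta>: "\<beta> \<le> b / 2" "b > 0" "\<mu> \<ge> 0" "j \<ge> 1"
  shows "0 < (b - \<beta>) * real j + \<mu>" "b / 2 * real j \<le> (b - \<beta>) * real j + \<mu>"
proof -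
  have "b / 2 * real j \<le> (b - \<beta>) * real j" using \<beta> by (intro mult_right_mono) auto
  moreover have "0 < b / 2 * real j" using assms by simp
  ultimately show "0 < (b - \<beta>) * real j + \<mu>" "b / 2 * real j \<le> (b - \<beta>) * real j + \<mu>" using assms by linarith+
qed

text \<open>Intermediate value theorem in \<beta>. At \<open>\<beta> = 0\<close> the tilt by \<mu>
  has lowered the mean energy. By the tangent inequality it is restored once the gain, \<beta> times
  a sum of order \<open>b powr (- d - 2)\<close>, outweighs the loss, \<mu> times a sum of order
  \<open>b powr (- d - 1)\<close>; hence \<beta> of order \<open>\<mu> * b\<close>. The bound on
  \<open>\<mu> * C2\<close> keeps \<beta> below \<open>b / 2\<close>.\<close>

lemma exists_beta:
  "\<exists>C2>0. \<forall>b J \<mu>. 0 < b \<longrightarrow> b \<le> 1 / 4 \<longrightarrow> 1 / b \<le> real J \<longrightarrow> 0 \<le> \<mu> \<longrightarrow> \<mu> * C2 \<le> 1 / 2 \<longrightarrow>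
    (\<exists>\<beta>. 0 \<le> \<beta> \<and> \<beta> \<le> C2 * \<mu> * b \<and>
      (\<Sum>j=1..J. real j * q j * bose ((b - \<beta>) * real j + \<mu>)) = energy b J)"
proof -
  obtain C1 where C1: "C1 > 0" "\<And>b J. b > 0 \<Longrightarrow> (\<Sum>j=1..J. real j * q j * bvar (b * real j)) \<le> C1 * b powr (- d - 1)"
    using sum_energy_bvar_le by blast
  define c where "c = window_const 1 * (bvar 1 / 4)"
  have c: "c > 0" unfolding c_def using window_const_pos[of 1] bvar_pos[of 1] by simp
  show ?thesis
  proof (rule exI[of _ "C1 / c"], intro conjI allI impI)
    show "C1 / c > 0" using C1 c by simp
    fix b :: real and J and \<mu> :: real
    assume b: "0 < b" "b \<le> 1 / 4" and J: "1 / b \<le> real J" and \<mu>: "0 \<le> \<mu>" "\<mu> * (C1 / c) \<le> 1 / 2"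
    define \<beta>1 where "\<beta>1 = C1 / c * \<mu> * b"
    have \<beta>1: "0 \<le> \<beta>1" "\<beta>1 \<le> b / 2"
      using b \<mu> C1 c mult_right_mono[OF \<mu>(2), of b] by (auto simp: \<beta>1_def mult_ac)
    have "(\<Sum>j=1..J. q j * ((real j)\<^sup>2 * bvar (b * real j))) \<ge> window_const 1 * ((1 / (2 * b))\<^sup>2 * bvar 1) * b powr (- d)"
    proof (rule sum_window_ge_all)
      fix j :: nat assume j: "j \<ge> 1" "1 / 2 \<le> b * real j" "b * real j \<le> 1"
      have "1 / (2 * b) \<le> real j" using j b by (simp add: field_simps)
      then have "(1 / (2 * b))\<^sup>2 \<le> (real j)\<^sup>2" using b by (intro power_mono) auto
      then show "(1 / (2 * b))\<^sup>2 * bvar 1 \<le> (real j)\<^sup>2 * bvar (b * real j)"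
        using j b bvar_antimono[of "b * real j" 1] bvar_pos[of 1] by (intro mult_mono) auto
    next
      fix j :: nat assume "j \<ge> 1"
      then show "0 \<le> (real j)\<^sup>2 * bvar (b * real j)" using b bvar_pos[of "b * real j"] by simp
    qed (use b J bvar_pos[of 1] in auto)
    also have "window_const 1 * ((1 / (2 * b))\<^sup>2 * bvar 1) * b powr (- d) = c * b powr (- d - 2)"
      using b by (simp add: c_def powr_diff power2_eq_square)
    finally have low: "c * b powr (- d - 2) \<le> (\<Sum>j=1..J. q j * ((real j)\<^sup>2 * bvar (b * real j)))" .
    let ?A = "\<lambda>\<beta>. \<Sum>j=1..J. real j * q j * bose ((b - \<beta>) * real j + \<mu>)"
    have "?A 0 \<le> energy b J"
      unfolding energy_def using b \<mu> q_pos
      by (intro sum_mono mult_left_mono bose_antimono) (auto intro!: mult_nonneg_nonneg simp: less_imp_le)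
    moreover have "energy b J \<le> ?A \<beta>1"
    proof -
      have "\<mu> * (\<Sum>j=1..J. real j * q j * bvar (b * real j)) \<le> \<mu> * (C1 * b powr (- d - 1))"
        using \<mu> b by (intro mult_left_mono C1) auto
      also have "\<dots> = \<beta>1 * (c * b powr (- d - 2))"
      proof -
        have "b powr (- d - 1) = b powr (- d - 2) * b"
        proof -
          have "- d - 1 = (- d - 2) + 1" by simp
          then show ?thesis using b powr_add[of b "- d - 2" 1] by (metis less_imp_le powr_one)
        qed
        then show ?thesis using c by (simp add: \<beta>1_def)
      qed
      also have "\<dots> \<le> \<beta>1 * (\<Sum>j=1..J. q j * ((real j)\<^sup>2 * bvar (b * real j)))"
        using low \<beta>1 by (intro mult_left_mono)
      finally have "energy b J \<le> energy b J - \<mu> * (\<Sum>j=1..J. real j * q j * bvar (b * real j))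
          + \<beta>1 * (\<Sum>j=1..J. q j * ((real j)\<^sup>2 * bvar (b * real j)))" by linarith
      also have "\<dots> = (\<Sum>j=1..J. real j * q j * (bose (b * real j) - (\<mu> - \<beta>1 * real j) * bvar (b * real j)))"
        unfolding energy_def by (simp add: sum_distrib_left algebra_simps power2_eq_square sum.distrib sum_subtractf)
      also have "\<dots> \<le> ?A \<beta>1"
      proof (intro sum_mono mult_left_mono)
        fix j assume "j \<in> {1..J}"
        then have j: "j \<ge> 1" by simp
        have e: "b * real j + (\<mu> - \<beta>1 * real j) = (b - \<beta>1) * real j + \<mu>" by (simp add: algebra_simps)
        show "bose (b * real j) - (\<mu> - \<beta>1 * real j) * bvar (b * real j) \<le> bose ((b - \<beta>1) * real j + \<mu>)"
          using bose_tangent[of "b * real j" "\<mu> - \<beta>1 * real j"] tilted_exponent_ge[OF \<beta>1(2) b(1) \<mu>(1) j] b j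
          unfolding e by simp
        show "0 \<le> real j * q j" using q_pos[OF j] by simp
      qed
      finally show ?thesis .
    qed
    moreover have "continuous_on {0..\<beta>1} ?A"
      by (intro continuous_intros)
        (auto intro!: tilted_exponent_ge(1)[OF order_trans[OF _ \<beta>1(2)] b(1) \<mu>(1)])
    ultimately obtain \<beta> where "0 \<le> \<beta>" "\<beta> \<le> \<beta>1" "?A \<beta> = energy b J"
      using IVT'[of ?A 0 "energy b J" \<beta>1] \<beta>1 by auto
    then show "\<exists>\<beta>. 0 \<le> \<beta> \<and> \<beta> \<le> C1 / c * \<mu> * b \<and> ?A \<beta> = energy b J"
      by (auto simp: \<beta>1_def)
  qed
qed

lemma psi_window_ge:
  assumes b: "b > 0" "4 * b \<le> \<kappa>" "\<kappa> / b \<le> real J" and \<mu>: "0 \<le> \<mu>" "\<mu> \<le> 1"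
  shows "(\<Sum>j | j \<in> {1..J} \<and> real j \<le> \<kappa> / b. q j * psi (b * real j) \<mu>)
    \<ge> window_const \<kappa> * (\<mu>\<^sup>2 / 2 * bvar (\<kappa> + 1)) * b powr (- d)"
proof (rule sum_window_ge)
  have \<kappa>: "\<kappa> > 0" using b by linarith
  then show "0 \<le> \<mu>\<^sup>2 / 2 * bvar (\<kappa> + 1)" using bvar_pos[of "\<kappa> + 1"] by simp
  fix j :: nat assume j: "j \<ge> 1"
  then have bj: "b * real j > 0" using b by simp
  then show "0 \<le> psi (b * real j) \<mu>" using \<mu> by (intro psi_nonneg) auto
  assume "\<kappa> / 2 \<le> b * real j" "b * real j \<le> \<kappa>"
  then show "\<mu>\<^sup>2 / 2 * bvar (\<kappa> + 1) \<le> psi (b * real j) \<mu>"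
    using bj \<mu> by (intro psi_ge) auto
qed (use b in auto)

text \<open>The energy correction does not destroy the cumulant. On levels up to
  \<open>\<kappa> / b\<close> with \<open>\<kappa> = 1 / (2 * C2)\<close> one has
  \<open>\<beta> * j \<le> \<mu> / 2\<close>, so at least a quarter of each term survives by
  \<open>psi_double\<close>. The higher levels contribute nonnegatively, and in
  \<open>Gam b J \<mu> 0\<close> they are at most a constant multiple of the lower ones.\<close>

lemma Gam_ge:
  assumes "C2 > 0"
  shows "\<exists>c3>0. \<forall>b J \<mu> \<beta>. 0 < b \<longrightarrow> 4 * b \<le> 1 / (2 * C2) \<longrightarrow> 1 / (2 * C2) / b \<le> real J \<longrightarrow>
    0 \<le> \<mu> \<longrightarrow> \<mu> \<le> 1 \<longrightarrow> 0 \<le> \<beta> \<longrightarrow> \<beta> \<le> C2 * \<mu> * b \<longrightarrow> \<beta> \<le> b / 2 \<longrightarrow> Gam b J \<mu> \<beta> \<ge> c3 * Gam b J \<mu> 0"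
proof -
  define \<kappa> where "\<kappa> = 1 / (2 * C2)"
  have \<kappa>: "\<kappa> > 0" using assms by (simp add: \<kappa>_def)
  obtain C where C: "C > 0" "\<And>b J. b > 0 \<Longrightarrow>
      (\<Sum>j | j \<in> {1..J} \<and> \<not> real j \<le> \<kappa> / b. q j * bvar (b * real j)) \<le> C * b powr (- d)"
    using sum_bvar_tail_le[OF \<kappa>] by blast
  define c where "c = window_const \<kappa> * bvar (\<kappa> + 1)"
  have c: "c > 0" unfolding c_def using window_const_pos[OF \<kappa>] bvar_pos[of "\<kappa> + 1"] \<kappa> by simp
  show ?thesis
  proof (intro exI[of _ "1 / (4 * (1 + C / c))"] conjI allI impI)
    show "1 / (4 * (1 + C / c)) > 0" using C c by (simp add: add_pos_pos)
    fix b :: real and J and \<mu> \<beta> :: real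
    assume b: "0 < b" "4 * b \<le> 1 / (2 * C2)" "1 / (2 * C2) / b \<le> real J"
      and \<mu>: "0 \<le> \<mu>" "\<mu> \<le> 1" and \<beta>: "0 \<le> \<beta>" "\<beta> \<le> C2 * \<mu> * b" "\<beta> \<le> b / 2"
    let ?I = "{j. j \<in> {1..J} \<and> real j \<le> \<kappa> / b}" and ?O = "{j. j \<in> {1..J} \<and> \<not> real j \<le> \<kappa> / b}"
    define In where "In = (\<Sum>j\<in>?I. q j * psi (b * real j) \<mu>)"
    have split: "Gam b J \<mu> 0 = In + (\<Sum>j\<in>?O. q j * psi (b * real j) \<mu>)"
    proof -
      have e: "?I \<union> ?O = {1..J}" by auto
      have "Gam b J \<mu> 0 = (\<Sum>j\<in>?I \<union> ?O. q j * psi (b * real j) \<mu>)"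
        unfolding e Gam_def by simp
      also have "\<dots> = In + (\<Sum>j\<in>?O. q j * psi (b * real j) \<mu>)"
        unfolding In_def by (intro sum.union_disjoint) auto
      finally show ?thesis .
    qed
    have "(\<Sum>j\<in>?O. q j * psi (b * real j) \<mu>) \<le> (\<Sum>j\<in>?O. \<mu>\<^sup>2 / 2 * (q j * bvar (b * real j)))"
    proof (intro sum_mono)
      fix j assume "j \<in> ?O"
      then have j: "j \<ge> 1" by simp
      have "psi (b * real j) \<mu> \<le> \<mu>\<^sup>2 / 2 * bvar (b * real j)" using b j \<mu> by (intro psi_le) auto
      then have "q j * psi (b * real j) \<mu> \<le> q j * (\<mu>\<^sup>2 / 2 * bvar (b * real j))"
        using q_pos[OF j] by (intro mult_left_mono) auto
      then show "q j * psi (b * real j) \<mu> \<le> \<mu>\<^sup>2 / 2 * (q j * bvar (b * real j))" by (simp add: mult_ac)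
    qed
    also have "\<dots> = \<mu>\<^sup>2 / 2 * (\<Sum>j\<in>?O. q j * bvar (b * real j))" by (rule sum_distrib_left[symmetric])
    also have "\<dots> \<le> \<mu>\<^sup>2 / 2 * (C * b powr (- d))" using b by (intro mult_left_mono C) auto
    also have "\<dots> = C / c * (window_const \<kappa> * (\<mu>\<^sup>2 / 2 * bvar (\<kappa> + 1)) * b powr (- d))"
    proof -
      have "window_const \<kappa> * (\<mu>\<^sup>2 / 2 * bvar (\<kappa> + 1)) = c * (\<mu>\<^sup>2 / 2)" by (simp add: c_def)
      then show ?thesis using c by (simp only:) (simp add: field_simps)
    qed
    also have "\<dots> \<le> C / c * In"
      unfolding In_def using b \<mu> C c by (intro mult_left_mono psi_window_ge) (auto simp: \<kappa>_def)
    finally have "Gam b J \<mu> 0 \<le> (1 + C / c) * In" unfolding split by (simp add: algebra_simps)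
    then have "1 / (4 * (1 + C / c)) * Gam b J \<mu> 0 \<le> 1 / (4 * (1 + C / c)) * ((1 + C / c) * In)"
      using C c by (intro mult_left_mono) (auto intro!: add_nonneg_nonneg)
    also have "\<dots> = In / 4"
    proof -
      have "1 + C / c > 0" using C c by (simp add: add_pos_pos)
      moreover have "1 / (4 * r) * (r * x) = x / 4" if "r > 0" for r x :: real using that by simp
      ultimately show ?thesis by blast
    qed
    also have "In / 4 \<le> (\<Sum>j\<in>?I. q j * psi (b * real j) (\<mu> - \<beta> * real j))"
      unfolding In_def sum_divide_distrib
    proof (intro sum_mono)
      fix j assume j: "j \<in> ?I"
      then have j1: "j \<ge> 1" by simp
      have "\<beta> * real j \<le> C2 * \<mu> * b * (\<kappa> / b)" using j \<beta> b \<mu> assms by (intro mult_mono) auto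
      also have "\<dots> = \<mu> / 2" using b assms by (simp add: \<kappa>_def)
      finally have *: "\<mu> / 2 \<le> \<mu> - \<beta> * real j" by linarith
      have "psi (b * real j) \<mu> / 4 \<le> psi (b * real j) (\<mu> / 2)"
        using psi_double[of "b * real j" "\<mu> / 2"] b j1 \<mu> by simp
      also have "\<dots> \<le> psi (b * real j) (\<mu> - \<beta> * real j)" using * b j1 \<mu> by (intro psi_mono) auto
      finally show "q j * psi (b * real j) \<mu> / 4 \<le> q j * psi (b * real j) (\<mu> - \<beta> * real j)"
        using q_pos[OF j1] by simp
    qed
    also have "\<dots> \<le> Gam b J \<mu> \<beta>" unfolding Gam_def
    proof (rule sum_mono2)
      fix j assume "j \<in> {1..J} - ?I"
      then have j: "j \<ge> 1" by simp
      have "b * real j + (\<mu> - \<beta> * real j) = (b - \<beta>) * real j + \<mu>" by (simp add: algebra_simps)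
      then have "0 \<le> psi (b * real j) (\<mu> - \<beta> * real j)"
        using tilted_exponent_ge[OF \<beta>(3) b(1) \<mu>(1) j] b j by (intro psi_nonneg) auto
      then show "0 \<le> q j * psi (b * real j) (\<mu> - \<beta> * real j)" using q_pos[OF j] by simp
    qed auto
    finally show "1 / (4 * (1 + C / c)) * Gam b J \<mu> 0 \<le> Gam b J \<mu> \<beta>" .
  qed
qed

text \<open>Already a fixed \<mu> produces a cumulant of order at least \<open>b powr (- d)\<close>,
  far above a logarithm. Prescribing the value of the cumulant instead of \<mu> treats
  \<open>d > 2\<close> and \<open>d \<le> 2\<close> alike.\<close>

lemma exists_mu:
  assumes "\<mu>1 > 0" "\<mu>1 \<le> 1" "K \<ge> 0"
  shows "\<forall>\<^sub>F b in at_right 0. \<forall>J. 1 / b \<le> real J \<longrightarrow> (\<exists>\<mu>. 0 \<le> \<mu> \<and> \<mu> \<le> \<mu>1 \<and> Gam b J \<mu> 0 = K * ln (1 / b))"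
proof -
  define c where "c = window_const 1 * (\<mu>1\<^sup>2 / 2 * bvar (1 + 1))"
  have c: "c > 0" unfolding c_def using window_const_pos[of 1] bvar_pos[of "1 + 1"] assms by simp
  have "\<forall>\<^sub>F b in at_right 0. K * ln (1 / b) \<le> c * b powr (- d)" using c d_gt assms by real_asymp
  moreover have "\<forall>\<^sub>F b in at_right 0. 0 < b \<and> b < (1 / 4 :: real)"
    using eventually_at_right_real[of 0 "1 / 4 :: real"] by simp
  ultimately show ?thesis
  proof eventually_elim
    case (elim b)
    show ?case
    proof (intro allI impI)
      fix J assume J: "1 / b \<le> real J"
      have "c * b powr (- d) \<le> (\<Sum>j | j \<in> {1..J} \<and> real j \<le> 1 / b. q j * psi (b * real j) \<mu>1)"
        unfolding c_def using elim J assms by (intro psi_window_ge) auto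
      also have "\<dots> \<le> Gam b J \<mu>1 0" unfolding Gam_def
      proof (simp, rule sum_mono2)
        fix j assume "j \<in> {Suc 0..J} - {j. Suc 0 \<le> j \<and> j \<le> J \<and> real j \<le> 1 / b}"
        then have j: "j \<ge> 1" by simp
        show "0 \<le> q j * psi (b * real j) \<mu>1"
          using q_pos[OF j] psi_nonneg[of "b * real j" \<mu>1] j elim assms by (simp add: add_pos_pos)
      qed auto
      finally have up: "K * ln (1 / b) \<le> Gam b J \<mu>1 0" using elim by linarith
      have lo: "Gam b J 0 0 \<le> K * ln (1 / b)" using elim assms by (simp add: Gam_def psi_def)
      have "continuous_on {0..\<mu>1} (\<lambda>\<mu>. Gam b J \<mu> 0)"
        unfolding Gam_def psi_def using elim by (intro continuous_intros) (auto intro: add_pos_nonneg)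
      then show "\<exists>\<mu>. 0 \<le> \<mu> \<and> \<mu> \<le> \<mu>1 \<and> Gam b J \<mu> 0 = K * ln (1 / b)"
        using IVT'[of "\<lambda>\<mu>. Gam b J \<mu> 0", OF lo up] assms by auto
    qed
  qed
qed

text \<open>One energy shell contributes at most the full product, and on the shell the energy
  factor is the constant \<open>exp (- a * e)\<close>.\<close>

lemma sum_configs_tilt_le:
  assumes "a > 0" "\<mu> \<ge> 0"
  shows "(\<Sum>m\<in>configs {1..J} e. (\<Prod>j=1..J. nb (q j) (m j)) * exp (- \<mu> * real (\<Sum>j=1..J. m j)))
    \<le> exp (a * real e) * exp (\<Sum>j=1..J. q j * phi (a * real j + \<mu>))"
proof -
  let ?y = "\<lambda>j. exp (- (a * real j + \<mu>))"
  have pos: "a * real j + \<mu> > 0" if "j \<in> {1..J}" for j using that assms by (simp add: add_pos_nonneg)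
  have "(\<Sum>m\<in>configs {1..J} e. \<Prod>j=1..J. nb (q j) (m j) * ?y j ^ m j) \<le> (\<Prod>j=1..J. (1 - ?y j) powr (- q j))"
  proof (rule sum_weight_le)
    show "inj_on (\<lambda>m. restrict m {1..J}) (configs {1..J} e)"
    proof (rule inj_onI)
      fix m m' :: "nat \<Rightarrow> nat"
      assume m: "m \<in> configs {1..J} e" "m' \<in> configs {1..J} e" "restrict m {1..J} = restrict m' {1..J}"
      show "m = m'"
      proof
        fix j show "m j = m' j"
          using m(1,2) fun_cong[OF m(3), of j] by (cases "j \<in> {1..J}") (auto simp: configs_def)
      qed
    qed
    show "0 \<le> ?y j \<and> ?y j < 1 \<and> 0 < q j" if "j \<in> {1..J}" for j
      using pos[OF that] q_pos[of j] that by simp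
  qed (auto intro: finite_configs)
  also have "\<dots> = exp (\<Sum>j=1..J. q j * phi (a * real j + \<mu>))"
    by (rule prod_powr_eq_exp) (rule pos)
  also have "(\<Sum>m\<in>configs {1..J} e. \<Prod>j=1..J. nb (q j) (m j) * ?y j ^ m j)
      = exp (- (a * real e)) * (\<Sum>m\<in>configs {1..J} e. (\<Prod>j=1..J. nb (q j) (m j)) * exp (- \<mu> * real (\<Sum>j=1..J. m j)))"
    unfolding prod_tilt sum_distrib_left
  proof (intro sum.cong refl)
    fix m assume "m \<in> configs {1..J} e"
    then have "(\<Sum>j=1..J. j * m j) = e" by (simp add: configs_def)
    then show "(\<Prod>j=1..J. nb (q j) (m j)) * exp (- (a * real (\<Sum>j=1..J. j * m j)) - \<mu> * real (\<Sum>j=1..J. m j))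
        = exp (- (a * real e)) * ((\<Prod>j=1..J. nb (q j) (m j)) * exp (- \<mu> * real (\<Sum>j=1..J. m j)))"
      by (simp only: diff_conv_add_uminus exp_add minus_mult_left mult_ac)
  qed
  finally have "exp (a * real e) * (exp (- (a * real e)) * (\<Sum>m\<in>configs {1..J} e. (\<Prod>j=1..J. nb (q j) (m j)) * exp (- \<mu> * real (\<Sum>j=1..J. m j))))
      \<le> exp (a * real e) * exp (\<Sum>j=1..J. q j * phi (a * real j + \<mu>))"
    by (intro mult_left_mono) auto
  then show ?thesis by (simp only: mult.assoc[symmetric] exp_add[symmetric]) simp
qed

text \<open>The event \<open>S \<le> number b J\<close> is reached by tilting with \<open>exp (- \<mu> S)\<close>, where \<open>\<mu>\<close> is so large that the
  tilted sum over all configurations outweighs its part with \<open>S > number b J\<close>; the Cauchy--Schwarz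
  inequality then removes the tilt.\<close>

lemma good_weight_ge:
  "\<exists>K>0. \<forall>\<^sub>F b in at_right 0. \<forall>J. b powr (- 2) \<le> real J \<longrightarrow> 2 \<le> energy b J \<longrightarrow> energy b J \<le> b powr (- d - 2) \<longrightarrow>
    (\<Sum>m | m \<in> configs {1..J} (nat \<lfloor>energy b J\<rfloor>) \<and> real (\<Sum>j=1..J. m j) \<le> number b J. \<Prod>j=1..J. nb (q j) (m j))
      \<ge> b powr K * exp (b * real (nat \<lfloor>energy b J\<rfloor>)) * partition_fn b J"
proof -
  obtain K0 where K0: "K0 > 0" "\<forall>\<^sub>F b in at_right 0. \<forall>J (y :: nat \<Rightarrow> real) A. b powr (- 2) \<le> real J \<longrightarrow>
    (\<forall>j\<in>{1..J}. exp (- (b * real j) - 1) \<le> y j \<and> y j \<le> exp (- (b / 2 * real j))) \<longrightarrow>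
    A = (\<Sum>j=1..J. real j * q j * (y j / (1 - y j))) \<longrightarrow> 2 \<le> A \<longrightarrow> A \<le> b powr (- d - 2) \<longrightarrow>
    fps_nth (\<Prod>j=1..J. level_fps j (y j) (q j)) (nat \<lfloor>A\<rfloor>) \<ge> b powr K0 * (\<Prod>j=1..J. (1 - y j) powr (- q j))"
    using coeff_ge by (elim exE conjE)
  obtain C2 where C2: "C2 > 0" "\<forall>b J \<mu>. 0 < b \<longrightarrow> b \<le> 1 / 4 \<longrightarrow> 1 / b \<le> real J \<longrightarrow> 0 \<le> \<mu> \<longrightarrow> \<mu> * C2 \<le> 1 / 2 \<longrightarrow>
    (\<exists>\<beta>. 0 \<le> \<beta> \<and> \<beta> \<le> C2 * \<mu> * b \<and>
      (\<Sum>j=1..J. real j * q j * bose ((b - \<beta>) * real j + \<mu>)) = energy b J)"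
    using exists_beta by (elim exE conjE)
  obtain c3 where c3: "c3 > 0" "\<forall>b J \<mu> \<beta>. 0 < b \<longrightarrow> 4 * b \<le> 1 / (2 * C2) \<longrightarrow> 1 / (2 * C2) / b \<le> real J \<longrightarrow>
    0 \<le> \<mu> \<longrightarrow> \<mu> \<le> 1 \<longrightarrow> 0 \<le> \<beta> \<longrightarrow> \<beta> \<le> C2 * \<mu> * b \<longrightarrow> \<beta> \<le> b / 2 \<longrightarrow> Gam b J \<mu> \<beta> \<ge> c3 * Gam b J \<mu> 0"
    using Gam_ge[OF C2(1)] by (elim exE conjE)
  \<comment> \<open>Then \<open>Gam b J \<mu> \<beta>\<close> is at least
    \<open>(K0 + 1) * ln (1 / b)\<close>: it makes up for the loss \<open>b powr K0\<close> of the
    local bound and leaves a spare factor \<open>1 / b\<close>.\<close>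
  define K where "K = (K0 + 1) / c3"
  define \<mu>1 where "\<mu>1 = min 1 (1 / (2 * C2))"
  have K: "K > 0" using K0 c3 by (simp add: K_def)
  have \<mu>1: "\<mu>1 > 0" "\<mu>1 \<le> 1" "\<mu>1 * C2 \<le> 1 / 2"
  proof -
    show "\<mu>1 > 0" "\<mu>1 \<le> 1" using C2 by (auto simp: \<mu>1_def)
    have "\<mu>1 * C2 \<le> 1 / (2 * C2) * C2" using C2 by (intro mult_right_mono) (auto simp: \<mu>1_def)
    then show "\<mu>1 * C2 \<le> 1 / 2" using C2 by simp
  qed
  have ev1: "\<forall>\<^sub>F b in at_right 0. \<forall>J. 1 / b \<le> real J \<longrightarrow> (\<exists>\<mu>. 0 \<le> \<mu> \<and> \<mu> \<le> \<mu>1 \<and> Gam b J \<mu> 0 = K * ln (1 / b))"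
    using \<mu>1 K by (intro exists_mu) auto
  have ev2: "\<forall>\<^sub>F b in at_right 0. 0 < b \<and> b < (1 / 4 :: real)"
    using eventually_at_right_real[of 0 "1 / 4 :: real"] by simp
  have ev3: "\<forall>\<^sub>F b in at_right 0. 4 * b \<le> 1 / (2 * C2) \<and> 1 / (2 * C2) / b \<le> b powr (- 2 :: real) \<and> 1 / b \<le> b powr (- 2 :: real)"
    using C2(1) by (intro eventually_conj; real_asymp)
  have "\<forall>\<^sub>F b in at_right 0. \<forall>J. b powr (- 2) \<le> real J \<longrightarrow> 2 \<le> energy b J \<longrightarrow> energy b J \<le> b powr (- d - 2) \<longrightarrow>
    (\<Sum>m | m \<in> configs {1..J} (nat \<lfloor>energy b J\<rfloor>) \<and> real (\<Sum>j=1..J. m j) \<le> number b J. \<Prod>j=1..J. nb (q j) (m j))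
      \<ge> b powr (4 * K) * exp (b * real (nat \<lfloor>energy b J\<rfloor>)) * partition_fn b J"
    using K0(2) ev1 ev2 ev3
  proof eventually_elim
    case (elim b)
    then have b: "0 < b" "b < 1 / 4" by auto
    show ?case
    proof (intro allI impI)
      fix J assume J: "b powr (- 2) \<le> real J" and E: "2 \<le> energy b J" "energy b J \<le> b powr (- d - 2)"
      have J1: "1 / b \<le> real J" "1 / (2 * C2) / b \<le> real J" using J elim(4) by auto
      obtain \<mu> where \<mu>: "0 \<le> \<mu>" "\<mu> \<le> \<mu>1" "Gam b J \<mu> 0 = K * ln (1 / b)"
        using elim(2) J1 by blast
      have \<mu>C2: "\<mu> * C2 \<le> 1 / 2" using mult_right_mono[OF \<mu>(2), of C2] C2(1) \<mu>1(3) by linarith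
      have \<mu>le1: "\<mu> \<le> 1" using \<mu> \<mu>1 by linarith
      have "\<exists>\<beta>. 0 \<le> \<beta> \<and> \<beta> \<le> C2 * \<mu> * b \<and>
          (\<Sum>j=1..J. real j * q j * bose ((b - \<beta>) * real j + \<mu>)) = energy b J"
        by (rule C2(2)[rule_format]) (use b J1 \<mu> \<mu>C2 in auto)
      then obtain \<beta> where \<beta>: "0 \<le> \<beta>" "\<beta> \<le> C2 * \<mu> * b"
        "(\<Sum>j=1..J. real j * q j * bose ((b - \<beta>) * real j + \<mu>)) = energy b J"
        by (elim exE conjE)
      have \<beta>b: "\<beta> \<le> b / 2"
      proof -
        have "C2 * \<mu> * b \<le> 1 / 2 * b"
          using mult_right_mono[OF \<mu>C2, of b] b by (simp only: mult.commute)
        with \<beta>(2) show ?thesis by linarith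
      qed
      define e where "e = nat \<lfloor>energy b J\<rfloor>"
      define N where "N = number b J"
      define Z where "Z = exp (b * real e) * partition_fn b J"
      define Cf where "Cf = configs {1..J} e"
      define w where "w m = (\<Prod>j=1..J. nb (q j) (m j))" for m
      define S where "S m = real (\<Sum>j=1..J. m j)" for m :: "nat \<Rightarrow> nat"
      define G where "G = {m \<in> Cf. S m \<le> N}"
      have e: "real e \<le> energy b J" unfolding e_def using E by simp
      have fin: "finite Cf" unfolding Cf_def by (intro finite_configs) auto
      have w: "w m \<ge> 0" for m
        unfolding w_def using q_pos nb_pos by (intro prod_nonneg) (auto simp: less_imp_le)
      have Zpos: "Z > 0" by (simp add: Z_def partition_fn_def)
      \<comment> \<open>Upper bound for any tilt in the number alone, used with parameters 0 and
        \<open>2 * \<mu>\<close>.\<close>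
      have T: "(\<Sum>m\<in>Cf. w m * exp (- \<mu>' * S m)) \<le> Z * exp (Gam b J \<mu>' 0 - \<mu>' * N)" if "\<mu>' \<ge> 0" for \<mu>'
        using sum_configs_tilt_le[where a = b and \<mu> = \<mu>' and J = J and e = e]
          exp_sum_phi_tilt[where b = b and \<beta> = 0 and \<mu> = \<mu>' and J = J] b that
        by (simp add: Cf_def w_def S_def Z_def N_def)
      \<comment> \<open>The compensated tilt has mean energy \<open>energy b J\<close>, so
        \<open>coeff_ge\<close> applies on exactly the shell \<open>e\<close>. On that shell \<beta>
        contributes only a constant factor, which is divided out again.\<close>
      have Tlow: "Z * exp (- \<mu> * N) / b \<le> (\<Sum>m\<in>Cf. w m * exp (- \<mu> * S m))"
      proof -
        let ?y = "\<lambda>j. exp (- ((b - \<beta>) * real j + \<mu>))"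
        have pos: "0 < (b - \<beta>) * real j + \<mu>" "b / 2 * real j \<le> (b - \<beta>) * real j + \<mu>" if "j \<in> {1..J}" for j
          using tilted_exponent_ge[OF \<beta>b b(1) \<mu>(1), of j] that by auto
        have 1: "\<forall>j\<in>{1..J}. exp (- (b * real j) - 1) \<le> ?y j \<and> ?y j \<le> exp (- (b / 2 * real j))"
        proof
          fix j assume j: "j \<in> {1..J}"
          have "(b - \<beta>) * real j \<le> b * real j" using \<beta> by (intro mult_right_mono) auto
          then show "exp (- (b * real j) - 1) \<le> ?y j \<and> ?y j \<le> exp (- (b / 2 * real j))"
            using pos(2)[OF j] \<mu>le1 by simp
        qed
        have 2: "energy b J = (\<Sum>j=1..J. real j * q j * (?y j / (1 - ?y j)))"
          unfolding \<beta>(3)[symmetric] using pos(1) by (intro sum.cong refl) (simp add: bose_geometric)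
        have "b powr K0 * (\<Prod>j=1..J. (1 - ?y j) powr (- q j))
            \<le> fps_nth (\<Prod>j=1..J. level_fps j (?y j) (q j)) (nat \<lfloor>energy b J\<rfloor>)"
          using elim(1)[rule_format, of J ?y "energy b J"] J 1 2 E by blast
        also have "\<dots> = (\<Sum>m\<in>Cf. \<Prod>j=1..J. nb (q j) (m j) * ?y j ^ m j)"
          unfolding Cf_def e_def by (rule prod_level_fps_nth) auto
        also have "\<dots> = (\<Sum>m\<in>Cf. exp (- ((b - \<beta>) * real e)) * (w m * exp (- \<mu> * S m)))"
        proof (intro sum.cong refl)
          fix m assume "m \<in> Cf"
          then have "(\<Sum>j=1..J. j * m j) = e" by (simp add: configs_def Cf_def)
          then show "(\<Prod>j=1..J. nb (q j) (m j) * ?y j ^ m j) = exp (- ((b - \<beta>) * real e)) * (w m * exp (- \<mu> * S m))"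
            unfolding prod_tilt w_def S_def
            by (simp only: diff_conv_add_uminus exp_add minus_mult_left mult_ac)
        qed
        also have "\<dots> = exp (- ((b - \<beta>) * real e)) * (\<Sum>m\<in>Cf. w m * exp (- \<mu> * S m))"
          by (rule sum_distrib_left[symmetric])
        also have "(\<Prod>j=1..J. (1 - ?y j) powr (- q j)) = exp (\<Sum>j=1..J. q j * phi ((b - \<beta>) * real j + \<mu>))"
          by (rule prod_powr_eq_exp) (rule pos(1))
        also have "\<dots> = partition_fn b J * exp (Gam b J \<mu> \<beta> - \<mu> * N + \<beta> * energy b J)"
          unfolding N_def by (rule exp_sum_phi_tilt)
        finally have "exp ((b - \<beta>) * real e) * (b powr K0 * (partition_fn b J * exp (Gam b J \<mu> \<beta> - \<mu> * N + \<beta> * energy b J)))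
            \<le> exp ((b - \<beta>) * real e) * (exp (- ((b - \<beta>) * real e)) * (\<Sum>m\<in>Cf. w m * exp (- \<mu> * S m)))"
          by (rule mult_left_mono) auto
        also have "\<dots> = (\<Sum>m\<in>Cf. w m * exp (- \<mu> * S m))"
          by (simp only: mult.assoc[symmetric] exp_add[symmetric]) simp
        finally have T1: "exp ((b - \<beta>) * real e) * (b powr K0 * (partition_fn b J * exp (Gam b J \<mu> \<beta> - \<mu> * N + \<beta> * energy b J)))
            \<le> (\<Sum>m\<in>Cf. w m * exp (- \<mu> * S m))" .
        have "c3 * (K * ln (1 / b)) \<le> Gam b J \<mu> \<beta>"
          using c3(2)[rule_format, of b J \<mu> \<beta>] b elim(4) J1 \<mu> \<mu>le1 \<beta> \<beta>b by auto
        moreover have "c3 * (K * ln (1 / b)) = - (K0 + 1) * ln b"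
          using c3(1) b by (simp add: K_def ln_div left_diff_distrib distrib_right)
        \<comment> \<open>Rounding the energy down is harmless because it acts in the favourable
          direction for \<open>\<beta> \<ge> 0\<close>.\<close>
        moreover have "\<beta> * real e \<le> \<beta> * energy b J" using e \<beta> by (intro mult_left_mono)
        ultimately have "b * real e - (K0 + 1) * ln b - \<mu> * N
            \<le> (b - \<beta>) * real e + (Gam b J \<mu> \<beta> - \<mu> * N + \<beta> * energy b J)"
          by (simp add: algebra_simps)
        then have "b powr K0 * partition_fn b J * exp (b * real e - (K0 + 1) * ln b - \<mu> * N)
            \<le> b powr K0 * partition_fn b J * exp ((b - \<beta>) * real e + (Gam b J \<mu> \<beta> - \<mu> * N + \<beta> * energy b J))"
          by (intro mult_left_mono) (auto simp: partition_fn_def)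
        also have "\<dots> = exp ((b - \<beta>) * real e) * (b powr K0 * (partition_fn b J * exp (Gam b J \<mu> \<beta> - \<mu> * N + \<beta> * energy b J)))"
          by (simp only: exp_add mult_ac)
        also note T1
        also have "b powr K0 * partition_fn b J * exp (b * real e - (K0 + 1) * ln b - \<mu> * N) = Z * exp (- \<mu> * N) / b"
        proof -
          have x: "exp (b * real e - (K0 + 1) * ln b - \<mu> * N) = exp (b * real e) * exp (- (K0 + 1) * ln b) * exp (- \<mu> * N)"
            by (simp add: left_diff_distrib distrib_right flip: exp_add)
          have u: "b powr K0 * exp (- (K0 + 1) * ln b) = 1 / b"
            using b by (simp add: powr_def algebra_simps exp_minus inverse_eq_divide flip: exp_add)
          have "b powr K0 * partition_fn b J * (exp (b * real e) * exp (- (K0 + 1) * ln b) * exp (- \<mu> * N))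
              = (b powr K0 * exp (- (K0 + 1) * ln b)) * (exp (b * real e) * partition_fn b J * exp (- \<mu> * N))"
            by (simp only: mult_ac)
          then show ?thesis unfolding x Z_def u by simp
        qed
        finally show ?thesis .
      qed
      define H where "H = (\<Sum>m\<in>G. w m * exp (- \<mu> * S m))"
      \<comment> \<open>Configurations with \<open>S > N\<close> have tilt factor at most
        \<open>exp (- \<mu> * N)\<close> and total weight at most \<open>Z\<close>. As
        \<open>1 / b\<close> exceeds 4, the lower bound \<open>Tlow\<close> leaves more than that
        for the others.\<close>
      have H: "Z * exp (- \<mu> * N) \<le> H"
      proof -
        have "(\<Sum>m\<in>Cf. w m * exp (- \<mu> * S m)) = H + (\<Sum>m\<in>Cf - G. w m * exp (- \<mu> * S m))"
          unfolding H_def using fin by (subst add.commute, intro sum.subset_diff) (auto simp: G_def)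
        also have "(\<Sum>m\<in>Cf - G. w m * exp (- \<mu> * S m)) \<le> (\<Sum>m\<in>Cf - G. exp (- \<mu> * N) * w m)"
        proof (intro sum_mono)
          fix m assume "m \<in> Cf - G"
          then have "N \<le> S m" by (auto simp: G_def)
          then have "exp (- \<mu> * S m) \<le> exp (- \<mu> * N)" using \<mu> by (simp add: mult_left_mono)
          then show "w m * exp (- \<mu> * S m) \<le> exp (- \<mu> * N) * w m"
            using w[of m] by (simp add: mult_left_mono mult.commute)
        qed
        also have "\<dots> \<le> (\<Sum>m\<in>Cf. exp (- \<mu> * N) * w m)" using fin w by (intro sum_mono2) auto
        also have "\<dots> = exp (- \<mu> * N) * (\<Sum>m\<in>Cf. w m * exp (- 0 * S m))" by (simp add: sum_distrib_left)
        also have "\<dots> \<le> exp (- \<mu> * N) * (Z * exp (Gam b J 0 0 - 0 * N))" by (intro mult_left_mono T) auto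
        also have "\<dots> = Z * exp (- \<mu> * N)" by (simp add: Gam_def psi_def)
        finally have "Z * exp (- \<mu> * N) / b \<le> H + Z * exp (- \<mu> * N)" using Tlow by linarith
        moreover have "Z * exp (- \<mu> * N) * 4 \<le> Z * exp (- \<mu> * N) * (1 / b)"
          using Zpos b by (intro mult_left_mono) (auto simp: field_simps)
        moreover have "Z * exp (- \<mu> * N) > 0" using Zpos by simp
        ultimately show ?thesis by simp
      qed
      \<comment> \<open>Cauchy--Schwarz with the weight split evenly: the untilted mass of
        \<open>G\<close> appears against a tilt by \<open>2 * \<mu>\<close>.\<close>
      have CS: "H\<^sup>2 \<le> (\<Sum>m\<in>G. w m) * (\<Sum>m\<in>G. w m * exp (- (2 * \<mu>) * S m))"
      proof -
        have "H = (\<Sum>m\<in>G. sqrt (w m) * (sqrt (w m) * exp (- \<mu> * S m)))"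
          unfolding H_def using w by (intro sum.cong refl) (simp add: mult.assoc[symmetric])
        then have "H\<^sup>2 \<le> (\<Sum>m\<in>G. (sqrt (w m))\<^sup>2) * (\<Sum>m\<in>G. (sqrt (w m) * exp (- \<mu> * S m))\<^sup>2)"
          using Cauchy_Schwarz_ineq_sum[of "\<lambda>m. sqrt (w m)" "\<lambda>m. sqrt (w m) * exp (- \<mu> * S m)" G] by simp
        also have "(\<Sum>m\<in>G. (sqrt (w m))\<^sup>2) = (\<Sum>m\<in>G. w m)" using w by simp
        also have "(\<Sum>m\<in>G. (sqrt (w m) * exp (- \<mu> * S m))\<^sup>2) = (\<Sum>m\<in>G. w m * exp (- (2 * \<mu>) * S m))"
          using w by (intro sum.cong refl) (simp add: power_mult_distrib flip: exp_double)
        finally show ?thesis .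
      qed
      \<comment> \<open>This fixes the price of removing the tilt: a factor
        \<open>b powr (4 * K)\<close>. The factors \<open>exp (- 2 * \<mu> * N)\<close>
        cancel.\<close>
      have "Gam b J (2 * \<mu>) 0 \<le> 4 * Gam b J \<mu> 0"
        unfolding Gam_def sum_distrib_left
      proof (intro sum_mono)
        fix j assume j: "j \<in> {1..J}"
        have "q j * psi (b * real j) (2 * \<mu>) \<le> q j * (4 * psi (b * real j) \<mu>)"
          using j q_pos[of j] b \<mu> by (intro mult_left_mono psi_double) auto
        then show "q j * psi (b * real j) (2 * \<mu> - 0 * real j) \<le> 4 * (q j * psi (b * real j) (\<mu> - 0 * real j))"
          by simp
      qed
      then have G2: "Gam b J (2 * \<mu>) 0 \<le> 4 * (K * ln (1 / b))" using \<mu> by simp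
      have "(\<Sum>m\<in>G. w m * exp (- (2 * \<mu>) * S m)) \<le> (\<Sum>m\<in>Cf. w m * exp (- (2 * \<mu>) * S m))"
        using fin w by (intro sum_mono2) (auto simp: G_def)
      also have "\<dots> \<le> Z * exp (Gam b J (2 * \<mu>) 0 - 2 * \<mu> * N)" using \<mu> by (intro T) auto
      also have "\<dots> \<le> Z * exp (4 * (K * ln (1 / b)) - 2 * \<mu> * N)" using G2 Zpos by simp
      finally have T2: "(\<Sum>m\<in>G. w m * exp (- (2 * \<mu>) * S m)) \<le> Z * exp (4 * (K * ln (1 / b)) - 2 * \<mu> * N)" .
      have "(Z * exp (- \<mu> * N))\<^sup>2 \<le> H\<^sup>2" using H Zpos by (intro power_mono) auto
      also note CS
      also have "(\<Sum>m\<in>G. w m) * (\<Sum>m\<in>G. w m * exp (- (2 * \<mu>) * S m))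
          \<le> (\<Sum>m\<in>G. w m) * (Z * exp (4 * (K * ln (1 / b)) - 2 * \<mu> * N))"
        using w by (intro mult_left_mono T2 sum_nonneg)
      also have "Z * exp (4 * (K * ln (1 / b)) - 2 * \<mu> * N) = Z * exp (4 * (K * ln (1 / b))) * (exp (- \<mu> * N))\<^sup>2"
        by (simp flip: exp_double exp_add)
      finally have "Z * (Z * (exp (- \<mu> * N))\<^sup>2) \<le> (\<Sum>m\<in>G. w m) * exp (4 * (K * ln (1 / b))) * (Z * (exp (- \<mu> * N))\<^sup>2)"
        by (simp add: power2_eq_square mult_ac)
      moreover have "Z * (exp (- \<mu> * N))\<^sup>2 > 0" using Zpos by simp
      ultimately have "Z \<le> (\<Sum>m\<in>G. w m) * exp (4 * (K * ln (1 / b)))" by (rule mult_right_le_imp_le)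
      then have "Z * exp (- (4 * (K * ln (1 / b)))) \<le> (\<Sum>m\<in>G. w m)"
        by (simp add: exp_minus field_simps)
      moreover have "exp (- (4 * (K * ln (1 / b)))) = b powr (4 * K)"
        using b by (simp add: powr_def ln_div)
      ultimately have "b powr (4 * K) * exp (b * real e) * partition_fn b J \<le> (\<Sum>m\<in>G. w m)"
        by (simp add: Z_def mult_ac)
      then show "b powr (4 * K) * exp (b * real (nat \<lfloor>energy b J\<rfloor>)) * partition_fn b J
        \<le> (\<Sum>m | m \<in> configs {1..J} (nat \<lfloor>energy b J\<rfloor>) \<and> real (\<Sum>j=1..J. m j) \<le> number b J. \<Prod>j=1..J. nb (q j) (m j))"
        unfolding e_def G_def Cf_def S_def N_def w_def .
    qed
  qed
  then show ?thesis using K by (intro exI[of _ "4 * K"]) auto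
qed

end

section \<open>Occupation numbers in the ensemble\<close>

text \<open>For \<open>a \<ge> 1\<close> the ratio of consecutive coefficients,
  \<open>(n + a) / (n + 1)\<close>, does not increase with \<open>n\<close>.\<close>

lemma nb_add_le:
  assumes "a \<ge> 1"
  shows "nb a (n + m) \<le> nb a n * nb a m"
proof (induction m)
  case (Suc m)
  have "(real (n + m) + a) / real (Suc (n + m)) \<le> (real m + a) / real (Suc m)"
    using assms mult_left_mono[OF assms, of "real n"] by (simp add: field_simps)
  then have "nb a (n + m) * ((real (n + m) + a) / real (Suc (n + m)))
      \<le> (nb a n * nb a m) * ((real m + a) / real (Suc m))"
    using Suc assms nb_pos[of a] by (intro mult_mono) (auto simp: less_imp_le)
  then show ?case by (simp add: nb_Suc' mult.assoc del: of_nat_Suc of_nat_add)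
qed simp

lemma nb_mono:
  assumes "a \<ge> 1" "n \<le> m"
  shows "nb a n \<le> nb a m"
proof (rule lift_Suc_mono_le[OF _ assms(2)])
  fix n
  have "nb a n * 1 \<le> nb a n * ((real n + a) / real (Suc n))"
    using assms nb_pos[of a n] by (intro mult_left_mono) auto
  then show "nb a n \<le> nb a (Suc n)" by (simp add: nb_Suc')
qed

text \<open>By Bernoulli's inequality each ratio of consecutive coefficients is at most
  \<open>((n + 2) / (n + 1)) ^ k\<close>, and these factors telescope.\<close>

lemma nb_le_power:
  assumes "a \<ge> 1" "a \<le> real k"
  shows "nb a n \<le> (real n + 1) ^ k"
proof (induction n)
  case (Suc n)
  have "(real n + a) / real (Suc n) \<le> (real (Suc n) + real k) / real (Suc n)"
    using assms by (intro divide_right_mono) auto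
  also have "\<dots> = 1 + real k * (1 / real (Suc n))" by (simp add: add_divide_distrib del: of_nat_Suc)
  also have "\<dots> \<le> (1 + 1 / real (Suc n)) ^ k" by (rule Bernoulli_inequality) (auto intro: order_trans[of _ 0])
  also have "1 + 1 / real (Suc n) = (real (Suc n) + 1) / (real n + 1)" by (simp add: field_simps)
  finally have "(real n + a) / real (Suc n) \<le> ((real (Suc n) + 1) / (real n + 1)) ^ k" .
  then have "nb a n * ((real n + a) / real (Suc n)) \<le> (real n + 1) ^ k * ((real (Suc n) + 1) / (real n + 1)) ^ k"
    using Suc assms by (intro mult_mono) auto
  also have "\<dots> = (real (Suc n) + 1) ^ k" by (simp add: power_divide)
  finally show ?case by (simp add: nb_Suc')
qed simp

text \<open>A particle on a level above \<open>J \<ge> M\<close> would alone exceed the energy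
  \<open>M\<close>. The sums over supports thus become sums over a fixed range of levels.\<close>

lemma Omega_bounded:
  assumes n: "n \<in> Omega M N" and MJ: "M \<le> J"
  shows "\<And>j. j > J \<Longrightarrow> n j = 0"
    and "n 0 + (\<Sum>j=1..J. n j) = N" and "(\<Sum>j=1..J. j * n j) \<le> M"
proof -
  have fin: "finite {j. n j \<noteq> 0}" and s: "(\<Sum>j | n j \<noteq> 0. n j) = N" and e: "(\<Sum>j | n j \<noteq> 0. j * n j) \<le> M"
    using n by (auto simp: Omega_def)
  show z: "n j = 0" if "j > J" for j
  proof (rule ccontr)
    assume "n j \<noteq> 0"
    then have "j * n j \<le> (\<Sum>j | n j \<noteq> 0. j * n j)" using fin by (intro member_le_sum) auto
    moreover have "j \<le> j * n j" using \<open>n j \<noteq> 0\<close> by simp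
    ultimately show False using e MJ that by linarith
  qed
  have sub: "{j. n j \<noteq> 0} \<subseteq> {0..J}"
  proof
    fix j assume "j \<in> {j. n j \<noteq> 0}"
    then have "\<not> J < j" using z[of j] by auto
    then show "j \<in> {0..J}" by simp
  qed
  have "(\<Sum>j=0..J. n j) = N" using s sum.mono_neutral_left[OF _ sub, of n] by simp
  then show "n 0 + (\<Sum>j=1..J. n j) = N" by (simp add: sum.atLeast_Suc_atMost)
  have "(\<Sum>j=0..J. j * n j) \<le> M" using e sum.mono_neutral_left[OF _ sub, of "\<lambda>j. j * n j"] by simp
  then show "(\<Sum>j=1..J. j * n j) \<le> M" by (simp add: sum.atLeast_Suc_atMost)
qed

lemma OmegaI:
  assumes "\<And>j. j > J \<Longrightarrow> n j = 0" "n 0 + (\<Sum>j=1..J. n j) = N" "(\<Sum>j=1..J. j * n j) \<le> M"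
  shows "n \<in> Omega M N"
proof -
  have sub: "{j. n j \<noteq> 0} \<subseteq> {0..J}"
  proof
    fix j assume "j \<in> {j. n j \<noteq> 0}"
    then have "\<not> J < j" using assms(1)[of j] by auto
    then show "j \<in> {0..J}" by simp
  qed
  have "(\<Sum>j=0..J. n j) = N" using assms(2) by (simp add: sum.atLeast_Suc_atMost)
  moreover have "(\<Sum>j=0..J. j * n j) \<le> M" using assms(3) by (simp add: sum.atLeast_Suc_atMost)
  ultimately show ?thesis
    unfolding Omega_def using finite_subset[OF sub]
      sum.mono_neutral_left[OF _ sub, of n] sum.mono_neutral_left[OF _ sub, of "\<lambda>j. j * n j"] by simp
qed

lemma inj_on_restrict_Omega:
  assumes "M \<le> J"
  shows "inj_on (\<lambda>n. restrict n {1..J}) (Omega M N)"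
proof (rule inj_onI)
  fix n n' assume n: "n \<in> Omega M N" "n' \<in> Omega M N" and r: "restrict n {1..J} = restrict n' {1..J}"
  have eq: "n j = n' j" if "j \<in> {1..J}" for j using fun_cong[OF r, of j] that by simp
  then have "(\<Sum>j=1..J. n j) = (\<Sum>j=1..J. n' j)" by (rule sum.cong[OF refl])
  then have "n 0 = n' 0" using Omega_bounded(2)[OF n(1) assms] Omega_bounded(2)[OF n(2) assms] by linarith
  show "n = n'"
  proof
    fix j
    have "j = 0 \<or> j \<in> {1..J} \<or> j > J" by auto
    then show "n j = n' j"
      using \<open>n 0 = n' 0\<close> eq[of j] Omega_bounded(1)[OF n(1) assms, of j] Omega_bounded(1)[OF n(2) assms, of j]
      by (elim disjE) auto
  qed
qed

lemma finite_Omega: "finite (Omega M N)"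
proof -
  have "(\<lambda>n. restrict n {1..M}) ` Omega M N \<subseteq> PiE {1..M} (\<lambda>_. {..N})"
  proof
    fix r assume "r \<in> (\<lambda>n. restrict n {1..M}) ` Omega M N"
    then obtain n where n: "n \<in> Omega M N" "r = restrict n {1..M}" by auto
    have "n j \<le> N" if "j \<in> {1..M}" for j
    proof -
      have "n j \<le> (\<Sum>j=1..M. n j)" using that by (intro member_le_sum) auto
      with Omega_bounded(2)[OF n(1) order_refl] show ?thesis by linarith
    qed
    then show "r \<in> PiE {1..M} (\<lambda>_. {..N})" unfolding n(2) by auto
  qed
  then have "finite ((\<lambda>n. restrict n {1..M}) ` Omega M N)"
    by (rule finite_subset) (intro finite_PiE; simp)
  then show ?thesis by (rule finite_imageD) (rule inj_on_restrict_Omega[OF order_refl])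
qed

lemma weight_eq:
  assumes n: "n \<in> Omega M N" and MJ: "M \<le> J"
  shows "weight q n = nb (q 0) (n 0) * (\<Prod>j=1..J. nb (q j) (n j))"
proof -
  have "{j. n j \<noteq> 0} \<subseteq> {0..J}"
  proof
    fix j assume "j \<in> {j. n j \<noteq> 0}"
    then have "\<not> J < j" using Omega_bounded(1)[OF assms, of j] by auto
    then show "j \<in> {0..J}" by simp
  qed
  then have "weight q n = (\<Prod>j=0..J. nb (q j) (n j))"
    unfolding weight_def nb_def[symmetric] by (intro prod.mono_neutral_left) auto
  then show ?thesis by (simp add: prod.atLeast_Suc_atMost)
qed

section \<open>Removal of level 0 and exponential Markov bounds\<close>

context level_weights
begin

abbreviation wt :: "nat \<Rightarrow> (nat \<Rightarrow> nat) \<Rightarrow> real" where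
  "wt J n \<equiv> \<Prod>j=1..J. nb (q j) (n j)"

lemma wt_pos: "wt J n > 0"
  using q_pos nb_pos by (intro prod_pos) auto

text \<open>The occupation number of level 0 enters only through a factor that is polynomially bounded,
  since \<open>nb (q 0)\<close> is increasing and submultiplicative.\<close>

lemma Prob_le:
  assumes q0: "q 0 \<ge> 1" and MJ: "M \<le> J" and x: "0 \<le> x" "x \<le> real N" and e: "e \<le> M"
    and A: "A \<subseteq> Omega M N"
    and g: "g \<le> (\<Sum>m | m \<in> configs {1..J} e \<and> real (\<Sum>j=1..J. m j) \<le> x. wt J m)" "g > 0"
  shows "Prob q M N A \<le> nb (q 0) (nat \<lfloor>x\<rfloor>) * (\<Sum>n\<in>A. wt J n) / g"
proof -
  define N0 where "N0 = nat \<lfloor>x\<rfloor>"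
  have N0: "real N0 \<le> x" "x < real N0 + 1" using x by (auto simp: N0_def)
  then have N0N: "N0 \<le> N" using x by linarith
  \<comment> \<open>Common to numerator and denominator: the numerator uses \<open>nb\<close> at
    \<open>(N - N0) + N0\<close> and submultiplicativity, the denominator monotonicity. In the
    quotient it cancels and \<open>N\<close> disappears.\<close>
  let ?c = "nb (q 0) (N - N0)"
  have c: "?c > 0" using nb_pos q0 by simp
  have finA: "finite A" using A finite_Omega finite_subset by blast
  have num: "weight_set q A \<le> ?c * nb (q 0) N0 * (\<Sum>n\<in>A. wt J n)"
    unfolding weight_set_def sum_distrib_left
  proof (intro sum_mono)
    fix n assume "n \<in> A"
    then have n: "n \<in> Omega M N" using A by blast
    have "nb (q 0) (n 0) \<le> ?c * nb (q 0) N0"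
    proof -
      have "n 0 \<le> (N - N0) + N0" using Omega_bounded(2)[OF n MJ] by linarith
      then have "nb (q 0) (n 0) \<le> nb (q 0) ((N - N0) + N0)" by (intro nb_mono q0)
      also have "\<dots> \<le> ?c * nb (q 0) N0" by (intro nb_add_le q0)
      finally show ?thesis .
    qed
    then show "weight q n \<le> ?c * nb (q 0) N0 * wt J n"
      unfolding weight_eq[OF n MJ] using wt_pos[of n J] by (intro mult_right_mono) auto
  qed
  let ?G = "{m. m \<in> configs {1..J} e \<and> real (\<Sum>j=1..J. m j) \<le> x}"
  \<comment> \<open>All remaining particles are placed on level 0, which costs no energy;
    \<open>x \<le> N\<close> guarantees that there are enough of them.\<close>
  let ?h = "\<lambda>m. m(0 := N - (\<Sum>j=1..J. m j))"
  have sums: "(\<Sum>j=1..J. (?h m) j) = (\<Sum>j=1..J. m j)" "(\<Sum>j=1..J. j * (?h m) j) = (\<Sum>j=1..J. j * m j)"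
    "wt J (?h m) = wt J m" for m
    by (auto intro!: sum.cong prod.cong)
  have SN: "(\<Sum>j=1..J. m j) \<le> N0" if "m \<in> ?G" for m
  proof -
    have "real (\<Sum>j=1..J. m j) \<le> x" using that by simp
    then have "real (\<Sum>j=1..J. m j) < real N0 + 1" using N0 by linarith
    then show ?thesis by linarith
  qed
  have hO: "?h m \<in> Omega M N" if "m \<in> ?G" for m
  proof (rule OmegaI[where J = J])
    show "(?h m) j = 0" if "J < j" for j using that \<open>m \<in> ?G\<close> by (auto simp: configs_def)
    show "(?h m) 0 + (\<Sum>j=1..J. (?h m) j) = N" unfolding sums using SN[OF that] N0N by simp
    show "(\<Sum>j=1..J. j * (?h m) j) \<le> M" unfolding sums using that e by (simp add: configs_def)
  qed
  have inj: "inj_on ?h ?G"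
  proof (rule inj_onI)
    fix m m' assume m: "m \<in> ?G" "m' \<in> ?G" and eq: "?h m = ?h m'"
    show "m = m'"
    proof
      fix j
      show "m j = m' j"
        using m fun_cong[OF eq, of j] by (cases "j = 0") (auto simp: configs_def)
    qed
  qed
  have "?c * g \<le> ?c * (\<Sum>m\<in>?G. wt J m)" using g c by (intro mult_left_mono) auto
  also have "\<dots> = (\<Sum>m\<in>?G. ?c * wt J m)" by (rule sum_distrib_left)
  also have "\<dots> \<le> (\<Sum>m\<in>?G. weight q (?h m))"
  proof (intro sum_mono)
    fix m assume m: "m \<in> ?G"
    have "?c \<le> nb (q 0) ((?h m) 0)" using SN[OF m] by (intro nb_mono q0) auto
    then show "?c * wt J m \<le> weight q (?h m)"
      unfolding weight_eq[OF hO[OF m] MJ] sums using wt_pos[of m J] by (intro mult_right_mono) auto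
  qed
  also have "\<dots> = (\<Sum>n\<in>?h ` ?G. weight q n)" using inj by (simp add: sum.reindex)
  also have "\<dots> \<le> weight_set q (Omega M N)"
    unfolding weight_set_def
  proof (rule sum_mono2)
    show "?h ` ?G \<subseteq> Omega M N" using hO by blast
    fix n assume "n \<in> Omega M N - ?h ` ?G"
    then show "0 \<le> weight q n" using weight_eq[of n M N J q] MJ wt_pos[of n J] nb_pos[of "q 0" "n 0"] q0 by simp
  qed (rule finite_Omega)
  finally have den: "?c * g \<le> weight_set q (Omega M N)" .
  have "Prob q M N A \<le> (?c * nb (q 0) N0 * (\<Sum>n\<in>A. wt J n)) / weight_set q (Omega M N)"
    unfolding Prob_def using num den g c by (intro divide_right_mono) (auto intro: order_trans[OF _ den])
  also have "\<dots> \<le> (?c * nb (q 0) N0 * (\<Sum>n\<in>A. wt J n)) / (?c * g)"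
    using den g c q0 nb_pos[of "q 0" N0] wt_pos
    by (intro divide_left_mono mult_nonneg_nonneg sum_nonneg mult_pos_pos) (auto simp: less_imp_le intro: less_le_trans[OF _ den])
  also have "\<dots> = nb (q 0) N0 * (\<Sum>n\<in>A. wt J n) / g" using c by simp
  finally show ?thesis by (simp add: N0_def)
qed

text \<open>On \<open>Omega\<close> the energy is at most \<open>M\<close>, so the factor
  \<open>exp (b * (M - energy))\<close>, at least 1, may be inserted; after that the levels are
  independent. The bound on \<open>t\<close> keeps each shifted exponent above
  \<open>b / 2 * j\<close>, where the quadratic bound on \<open>psi\<close> applies.\<close>

lemma exponential_moment_le:
  assumes b: "b > 0" and t: "\<bar>t\<bar> \<le> b / 4" and MJ: "M \<le> J" and A: "A \<subseteq> Omega M N"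
    and h: "\<And>j. \<bar>h j\<bar> \<le> 2"
  shows "(\<Sum>n\<in>A. wt J n * exp (t * (\<Sum>j=1..J. h j * (real (n j) - q j * bose (b * real j)))))
    \<le> exp (b * real M) * partition_fn b J * exp (2 * t\<^sup>2 * (\<Sum>j=1..J. q j * bvar (b / 2 * real j)))"
proof -
  define x where "x j = b * real j + (- t * h j)" for j
  have th: "\<bar>t * h j\<bar> \<le> b / 2" for j
    using mult_mono[OF t h, of j] b by (simp add: abs_mult)
  have x: "b / 2 * real j \<le> x j" "0 < b / 2 * real j" if "j \<in> {1..J}" for j
  proof -
    have "b / 2 * 1 \<le> b / 2 * real j" using that b by (intro mult_left_mono) auto
    moreover have "b * real j = b / 2 * real j + b / 2 * real j" by simp
    moreover have "x j = b * real j - t * h j" by (simp add: x_def)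
    ultimately show "b / 2 * real j \<le> x j" "0 < b / 2 * real j"
      using th[of j] b by linarith+
  qed
  define B where "B = (\<Sum>j=1..J. h j * (q j * bose (b * real j)))"
  have "(\<Sum>n\<in>A. wt J n * exp (t * (\<Sum>j=1..J. h j * (real (n j) - q j * bose (b * real j)))))
      \<le> (\<Sum>n\<in>A. exp (b * real M) * exp (- t * B) * (\<Prod>j=1..J. nb (q j) (n j) * exp (- x j) ^ n j))"
  proof (intro sum_mono)
    fix n assume "n \<in> A"
    then have n: "n \<in> Omega M N" using A by blast
    have "real (\<Sum>j=1..J. j * n j) \<le> real M"
      using Omega_bounded(3)[OF n MJ] by (simp only: of_nat_le_iff)
    then have E: "b * real (\<Sum>j=1..J. j * n j) \<le> b * real M" using b by (intro mult_left_mono) auto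
    have "(\<Prod>j=1..J. exp (- x j) ^ n j) = exp (\<Sum>j=1..J. real (n j) * (- x j))"
      by (subst exp_sum) (simp_all flip: exp_of_nat_mult)
    also have "(\<Sum>j=1..J. real (n j) * (- x j)) = t * (\<Sum>j=1..J. h j * real (n j)) - b * real (\<Sum>j=1..J. j * n j)"
      by (simp add: x_def sum_distrib_left algebra_simps sum.distrib sum_negf sum_subtractf)
    finally have p: "(\<Prod>j=1..J. exp (- x j) ^ n j) = exp (t * (\<Sum>j=1..J. h j * real (n j)) - b * real (\<Sum>j=1..J. j * n j))" .
    have dev: "(\<Sum>j=1..J. h j * (real (n j) - q j * bose (b * real j))) = (\<Sum>j=1..J. h j * real (n j)) - B"
      by (simp add: B_def right_diff_distrib sum_subtractf)
    have "exp (t * (\<Sum>j=1..J. h j * (real (n j) - q j * bose (b * real j))))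
        \<le> exp (b * real M) * exp (- t * B) * (\<Prod>j=1..J. exp (- x j) ^ n j)"
      unfolding dev p exp_add[symmetric] exp_le_cancel_iff right_diff_distrib[of t] using E by linarith
    from mult_left_mono[OF this less_imp_le[OF wt_pos[of n J]]]
    show "wt J n * exp (t * (\<Sum>j=1..J. h j * (real (n j) - q j * bose (b * real j))))
        \<le> exp (b * real M) * exp (- t * B) * (\<Prod>j=1..J. nb (q j) (n j) * exp (- x j) ^ n j)"
      unfolding prod.distrib by (simp only: mult_ac)
  qed
  also have "\<dots> = exp (b * real M) * exp (- t * B) * (\<Sum>n\<in>A. \<Prod>j=1..J. nb (q j) (n j) * exp (- x j) ^ n j)"
    by (rule sum_distrib_left[symmetric])
  also have "(\<Sum>n\<in>A. \<Prod>j=1..J. nb (q j) (n j) * exp (- x j) ^ n j) \<le> (\<Prod>j=1..J. (1 - exp (- x j)) powr (- q j))"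
  proof (rule sum_weight_le)
    show "finite A" using A finite_Omega finite_subset by blast
    show "inj_on (\<lambda>m. restrict m {1..J}) A" using inj_on_restrict_Omega[OF MJ] A inj_on_subset by blast
    show "0 \<le> exp (- x j) \<and> exp (- x j) < 1 \<and> 0 < q j" if "j \<in> {1..J}" for j
      using x[OF that] q_pos[of j] that by auto
  qed simp
  also have "\<dots> = exp (\<Sum>j=1..J. q j * phi (x j))"
    by (rule prod_powr_eq_exp) (use x in fastforce)
  also have "(\<Sum>j=1..J. q j * phi (x j))
      \<le> (\<Sum>j=1..J. q j * phi (b * real j)) + t * B + 2 * t\<^sup>2 * (\<Sum>j=1..J. q j * bvar (b / 2 * real j))"
    unfolding B_def sum_distrib_left sum.distrib[symmetric]
  proof (intro sum_mono)
    fix j assume j: "j \<in> {1..J}"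
    have "psi (b * real j) (- t * h j) \<le> (- t * h j)\<^sup>2 / 2 * bvar (b / 2 * real j)"
      using x[OF j] b j unfolding x_def by (intro psi_le) auto
    also have "\<dots> \<le> 2 * t\<^sup>2 * bvar (b / 2 * real j)"
    proof (rule mult_right_mono)
      have "(h j)\<^sup>2 \<le> 2\<^sup>2" using h[of j] by (metis abs_le_square_iff abs_numeral)
      then have "t\<^sup>2 * (h j)\<^sup>2 \<le> t\<^sup>2 * 2\<^sup>2" by (intro mult_left_mono) auto
      then show "(- t * h j)\<^sup>2 / 2 \<le> 2 * t\<^sup>2" by (simp add: power_mult_distrib)
      show "0 \<le> bvar (b / 2 * real j)" using bvar_pos x[OF j] by (simp add: less_imp_le)
    qed
    finally have "phi (x j) \<le> phi (b * real j) + t * (h j * bose (b * real j)) + 2 * t\<^sup>2 * bvar (b / 2 * real j)"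
      by (simp add: psi_def x_def mult.assoc)
    then have "q j * phi (x j) \<le> q j * (phi (b * real j) + t * (h j * bose (b * real j)) + 2 * t\<^sup>2 * bvar (b / 2 * real j))"
      using q_pos[of j] j by (intro mult_left_mono) auto
    then show "q j * phi (x j) \<le> q j * phi (b * real j) + t * (h j * (q j * bose (b * real j)))
        + 2 * t\<^sup>2 * (q j * bvar (b / 2 * real j))"
      by (simp add: algebra_simps)
  qed
  finally have "(\<Sum>n\<in>A. wt J n * exp (t * (\<Sum>j=1..J. h j * (real (n j) - q j * bose (b * real j)))))
    \<le> exp (b * real M) * exp (- t * B) *
      exp ((\<Sum>j=1..J. q j * phi (b * real j)) + t * B + 2 * t\<^sup>2 * (\<Sum>j=1..J. q j * bvar (b / 2 * real j)))"
    by (simp add: mult_left_mono)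
  also have "\<dots> = exp (b * real M) * partition_fn b J * exp (2 * t\<^sup>2 * (\<Sum>j=1..J. q j * bvar (b / 2 * real j)))"
    unfolding partition_fn_def exp_add[symmetric] mult.assoc by simp
  finally show ?thesis .
qed

text \<open>If a complex number has modulus at least \<open>D\<close>, then one of the four signed
  real and imaginary parts is at least \<open>D / 2\<close>; hence the factor 4 and the halved
  \<open>D\<close>.\<close>

lemma deviation_weight_le:
  fixes g :: "nat \<Rightarrow> complex"
  assumes b: "b > 0" and t: "0 \<le> t" "t \<le> b / 4" and MJ: "M \<le> J" and A: "A \<subseteq> Omega M N"
    and g: "\<And>j. cmod (g j) \<le> 2"
    and dev: "\<And>n. n \<in> A \<Longrightarrow> cmod (\<Sum>j=1..J. g j * complex_of_real (real (n j) - q j * bose (b * real j))) \<ge> D"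
  shows "(\<Sum>n\<in>A. wt J n) \<le> 4 * (exp (b * real M) * partition_fn b J *
    exp (- t * D / 2 + 2 * t\<^sup>2 * (\<Sum>j=1..J. q j * bvar (b / 2 * real j))))"
proof -
  let ?R = "\<lambda>n. \<Sum>j=1..J. Re (g j) * (real (n j) - q j * bose (b * real j))"
  let ?I = "\<lambda>n. \<Sum>j=1..J. Im (g j) * (real (n j) - q j * bose (b * real j))"
  let ?B = "exp (b * real M) * partition_fn b J * exp (2 * t\<^sup>2 * (\<Sum>j=1..J. q j * bvar (b / 2 * real j)))"
  have "wt J n \<le> exp (- t * D / 2) * (wt J n * exp (t * ?R n) + wt J n * exp (- t * ?R n)
      + wt J n * exp (t * ?I n) + wt J n * exp (- t * ?I n))" if n: "n \<in> A" for n
  proof -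
    let ?z = "\<Sum>j=1..J. g j * complex_of_real (real (n j) - q j * bose (b * real j))"
    have ri: "Re ?z = ?R n" "Im ?z = ?I n" by (simp_all add: Re_sum Im_sum)
    have "D \<le> \<bar>?R n\<bar> + \<bar>?I n\<bar>" using dev[OF n] cmod_le[of ?z] unfolding ri by linarith
    then have "D / 2 \<le> ?R n \<or> D / 2 \<le> - ?R n \<or> D / 2 \<le> ?I n \<or> D / 2 \<le> - ?I n" by linarith
    then have "t * (D / 2) \<le> t * ?R n \<or> t * (D / 2) \<le> t * (- ?R n) \<or> t * (D / 2) \<le> t * ?I n \<or> t * (D / 2) \<le> t * (- ?I n)"
      using mult_left_mono[OF _ t(1)] by blast
    then have "exp (t * (D / 2)) \<le> exp (t * ?R n) \<or> exp (t * (D / 2)) \<le> exp (- t * ?R n)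
        \<or> exp (t * (D / 2)) \<le> exp (t * ?I n) \<or> exp (t * (D / 2)) \<le> exp (- t * ?I n)" by simp
    moreover have "exp (t * ?R n) > 0" "exp (- t * ?R n) > 0" "exp (t * ?I n) > 0" "exp (- t * ?I n) > 0" by simp_all
    ultimately have "exp (t * (D / 2)) \<le> exp (t * ?R n) + exp (- t * ?R n) + exp (t * ?I n) + exp (- t * ?I n)"
      by linarith
    then have "exp (- t * D / 2) * exp (t * (D / 2))
        \<le> exp (- t * D / 2) * (exp (t * ?R n) + exp (- t * ?R n) + exp (t * ?I n) + exp (- t * ?I n))"
      by (rule mult_left_mono) simp
    then have "1 \<le> exp (- t * D / 2) * (exp (t * ?R n) + exp (- t * ?R n) + exp (t * ?I n) + exp (- t * ?I n))"
      unfolding exp_add[symmetric] by simp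
    from mult_left_mono[OF this less_imp_le[OF wt_pos[of n J]]]
    show ?thesis by (simp only: mult_1_right distrib_left mult.left_commute)
  qed
  then have "(\<Sum>n\<in>A. wt J n) \<le> (\<Sum>n\<in>A. exp (- t * D / 2) * (wt J n * exp (t * ?R n) + wt J n * exp (- t * ?R n)
      + wt J n * exp (t * ?I n) + wt J n * exp (- t * ?I n)))" by (rule sum_mono)
  also have "\<dots> = exp (- t * D / 2) * ((\<Sum>n\<in>A. wt J n * exp (t * ?R n)) + (\<Sum>n\<in>A. wt J n * exp (- t * ?R n))
      + (\<Sum>n\<in>A. wt J n * exp (t * ?I n)) + (\<Sum>n\<in>A. wt J n * exp (- t * ?I n)))"
    by (simp only: sum_distrib_left[symmetric] sum.distrib)
  also have "\<dots> \<le> exp (- t * D / 2) * (?B + ?B + ?B + ?B)"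
  proof (intro mult_left_mono add_mono)
    have gr: "\<bar>Re (g j)\<bar> \<le> 2" "\<bar>Im (g j)\<bar> \<le> 2" for j
      using g[of j] abs_Re_le_cmod[of "g j"] abs_Im_le_cmod[of "g j"] by linarith+
    have tt: "\<bar>t\<bar> \<le> b / 4" "\<bar>- t\<bar> \<le> b / 4" using t by auto
    show "(\<Sum>n\<in>A. wt J n * exp (t * ?R n)) \<le> ?B" "(\<Sum>n\<in>A. wt J n * exp (t * ?I n)) \<le> ?B"
      by (rule exponential_moment_le[OF b tt(1) MJ A gr(1)], rule exponential_moment_le[OF b tt(1) MJ A gr(2)])
    show "(\<Sum>n\<in>A. wt J n * exp (- t * ?R n)) \<le> ?B" "(\<Sum>n\<in>A. wt J n * exp (- t * ?I n)) \<le> ?B"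
      using exponential_moment_le[OF b tt(2) MJ A gr(1)] exponential_moment_le[OF b tt(2) MJ A gr(2)] by simp_all
  qed simp
  also have "\<dots> = 4 * (exp (b * real M) * partition_fn b J *
      exp (- t * D / 2 + 2 * t\<^sup>2 * (\<Sum>j=1..J. q j * bvar (b / 2 * real j))))"
    by (simp only: exp_add) simp
  finally show ?thesis .
qed

end

section \<open>The parameter b\<close>

lemma bose_strict_antimono: "0 < x \<Longrightarrow> x < y \<Longrightarrow> bose y < bose x"
  by (simp add: bose_def divide_strict_left_mono)

context level_weights
begin

definition number_term :: "real \<Rightarrow> nat \<Rightarrow> real" where
  "number_term b i = q (Suc i) * bose (b * real (Suc i))"

definition energy_term :: "real \<Rightarrow> nat \<Rightarrow> real" where
  "energy_term b i = real (Suc i) * q (Suc i) * bose (b * real (Suc i))"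

lemma number_term_pos: "b > 0 \<Longrightarrow> number_term b i > 0"
  unfolding number_term_def using q_pos[of "Suc i"] bose_pos[of "b * real (Suc i)"] by simp

lemma energy_term_pos: "b > 0 \<Longrightarrow> energy_term b i > 0"
  unfolding energy_term_def using q_pos[of "Suc i"] bose_pos[of "b * real (Suc i)"] by simp

lemma number_eq_sum: "number b J = (\<Sum>i<J. number_term b i)"
  unfolding number_def number_term_def by (rule sum.reindex_bij_witness[of _ Suc "\<lambda>j. j - 1"]) auto

lemma energy_eq_sum: "energy b J = (\<Sum>i<J. energy_term b i)"
  unfolding energy_def energy_term_def by (rule sum.reindex_bij_witness[of _ Suc "\<lambda>j. j - 1"]) auto

lemma summable_number_term:
  assumes "b > 0"
  shows "summable (number_term b)"
proof -
  obtain C where "\<And>J. number b J \<le> C * b powr (- d)"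
    using sum_number_le assms unfolding number_def by blast
  then show ?thesis unfolding number_eq_sum
    using number_term_pos[OF assms] by (intro summableI_nonneg_bounded) (auto simp: less_imp_le)
qed

lemma summable_energy_term:
  assumes "b > 0"
  shows "summable (energy_term b)"
proof -
  obtain C where "\<And>J. energy b J \<le> C * b powr (- d - 1)"
    using sum_energy_le assms unfolding energy_def by blast
  then show ?thesis unfolding energy_eq_sum
    using energy_term_pos[OF assms] by (intro summableI_nonneg_bounded) (auto simp: less_imp_le)
qed

lemma energy_term_antimono: "0 < b \<Longrightarrow> b \<le> b' \<Longrightarrow> energy_term b' i \<le> energy_term b i"
  unfolding energy_term_def using q_pos[of "Suc i"]
  by (intro mult_left_mono bose_antimono) (auto simp: less_imp_le)

lemma suminf_energy_strict_antimono:
  assumes "0 < b" "b < b'"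
  shows "suminf (energy_term b') < suminf (energy_term b)"
proof -
  have s: "summable (energy_term b)" "summable (energy_term b')" using assms summable_energy_term by auto
  have "energy_term b' 0 < energy_term b 0"
    unfolding energy_term_def using assms q_pos[of 1] bose_strict_antimono[of b b'] by simp
  moreover have "energy_term b' i \<le> energy_term b i" for i using assms by (intro energy_term_antimono) auto
  ultimately have "0 < (\<Sum>i. energy_term b i - energy_term b' i)"
    using s by (intro suminf_pos2[where i = 0] summable_diff) auto
  then show ?thesis using suminf_diff[OF s] by simp
qed

text \<open>Uniform limit on \<open>{b0..}\<close>: the terms decrease in \<open>b\<close>, so those
  at \<open>b0\<close> are a summable majorant.\<close>

lemma continuous_on_suminf_energy:
  assumes "b0 > 0"
  shows "continuous_on {b0..} (\<lambda>b. suminf (energy_term b))"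
proof (rule uniform_limit_theorem)
  show "uniform_limit {b0..} (\<lambda>n b. \<Sum>i<n. energy_term b i) (\<lambda>b. suminf (energy_term b)) sequentially"
  proof (rule Weierstrass_m_test)
    show "norm (energy_term b i) \<le> energy_term b0 i" if "b \<in> {b0..}" for b i
      using that assms energy_term_antimono[of b0 b i] energy_term_pos[of b i] by simp
  qed (rule summable_energy_term[OF assms])
  show "\<forall>\<^sub>F n in sequentially. continuous_on {b0..} (\<lambda>b. \<Sum>i<n. energy_term b i)"
    unfolding energy_term_def using assms
    by (intro always_eventually allI continuous_intros) (auto intro!: mult_pos_pos)
qed simp

lemma exists_b:
  assumes "M > 0"
  shows "\<exists>b>0. energy_term b sums real M"
proof -
  obtain C where C: "C > 0" "\<And>b J. b > 0 \<Longrightarrow> energy b J \<le> C * b powr (- d - 1)"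
    using sum_energy_le unfolding energy_def by blast
  \<comment> \<open>At \<open>lo\<close> the first term of the series alone equals
    \<open>M\<close>.\<close>
  define lo where "lo = ln (1 + q 1 / real M)"
  \<comment> \<open>Being at least \<open>C\<close> and 1, \<open>hi\<close> makes the bound
    \<open>C * hi powr (- d - 1)\<close> at most 1, hence at most \<open>M\<close>; being at least
    \<open>lo\<close>, it closes the interval.\<close>
  define hi where "hi = max lo (max 1 C)"
  have q1: "q 1 / real M > 0" using q_pos[of 1] assms by simp
  then have lo: "lo > 0" by (simp add: lo_def)
  have hi: "hi \<ge> lo" "hi \<ge> 1" "hi \<ge> C" by (auto simp: hi_def)
  have "real M = energy_term lo 0"
  proof -
    have "exp lo = 1 + q 1 / real M" unfolding lo_def using q1 by (intro exp_ln) simp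
    then show ?thesis using q1 q_pos[of 1] by (simp add: energy_term_def bose_def)
  qed
  also have "\<dots> \<le> suminf (energy_term lo)"
    using sum_le_suminf[OF summable_energy_term[OF lo], of "{0}"] energy_term_pos[OF lo] by (simp add: less_imp_le)
  finally have L: "real M \<le> suminf (energy_term lo)" .
  have "suminf (energy_term hi) \<le> real M"
  proof (rule suminf_le_const[OF summable_energy_term])
    fix n
    have "(\<Sum>i<n. energy_term hi i) \<le> C * hi powr (- d - 1)"
      using C(2)[of hi n] hi unfolding energy_eq_sum by simp
    also have "\<dots> \<le> C * hi powr (- 1)" using hi C d_gt by (intro mult_left_mono powr_mono) auto
    also have "\<dots> \<le> 1" using hi C by (simp add: powr_minus_divide)
    also have "\<dots> \<le> real M" using assms by simp
    finally show "(\<Sum>i<n. energy_term hi i) \<le> real M" .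
  qed (use hi in auto)
  moreover have "continuous_on {lo..hi} (\<lambda>b. suminf (energy_term b))"
    using continuous_on_suminf_energy[OF lo] by (rule continuous_on_subset) auto
  ultimately obtain b where b: "lo \<le> b" "suminf (energy_term b) = real M"
    using IVT2'[of "\<lambda>b. suminf (energy_term b)" hi "real M" lo] L hi(1) by auto
  have "b > 0" using b(1) lo by linarith
  then show ?thesis using summable_sums[OF summable_energy_term[of b]] unfolding b(2) by blast
qed

lemma b_of:
  assumes "M > 0"
  shows "b_of q M > 0" "energy_term (b_of q M) sums real M"
proof -
  have "\<exists>!b. b > 0 \<and> energy_term b sums real M"
  proof (rule ex_ex1I)
    show "\<exists>b. b > 0 \<and> energy_term b sums real M" using exists_b[OF assms] .
    fix b b' assume "b > 0 \<and> energy_term b sums real M" "b' > 0 \<and> energy_term b' sums real M"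
    then show "b = b'"
      using suminf_energy_strict_antimono[of b b'] suminf_energy_strict_antimono[of b' b]
      by (cases b b' rule: linorder_cases) (auto simp: sums_iff)
  qed
  from theI'[OF this] have "b_of q M > 0 \<and> energy_term (b_of q M) sums real M"
    unfolding b_of_def energy_term_def bose_def by simp
  then show "b_of q M > 0" "energy_term (b_of q M) sums real M" by auto
qed

lemma Nbar_eq: "Nbar q M = suminf (number_term (b_of q M))"
  unfolding Nbar_def number_term_def bose_def by simp

lemma Nbar_pos: "M > 0 \<Longrightarrow> Nbar q M > 0"
  unfolding Nbar_eq using b_of[of M] number_term_pos summable_number_term by (intro suminf_pos) auto

lemma b_of_less:
  assumes "e > 0" "suminf (energy_term e) < real M"
  shows "b_of q M < e"
proof (rule ccontr)
  have "suminf (energy_term e) > 0"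
    using energy_term_pos[OF assms(1)] summable_energy_term[OF assms(1)] by (intro suminf_pos)
  then have M: "M > 0" using assms by simp
  assume "\<not> b_of q M < e"
  then have "suminf (energy_term (b_of q M)) \<le> suminf (energy_term e)"
    using suminf_energy_strict_antimono[OF assms(1), of "b_of q M"] by (cases "b_of q M = e") auto
  with assms(2) sums_unique[OF b_of(2)[OF M]] show False by simp
qed

text \<open>At any fixed \<open>e > 0\<close> the energy series is finite, so \<open>M\<close>
  eventually exceeds it and \<open>b_of q M\<close> falls below \<open>e\<close>. This carries
  statements about small \<open>b\<close> over to large \<open>M\<close>.\<close>

lemma filterlim_b_of: "filterlim (b_of q) (at_right 0) sequentially"
  unfolding filterlim_at
proof (intro conjI)
  show "\<forall>\<^sub>F M in sequentially. b_of q M \<in> {0<..} \<and> b_of q M \<noteq> 0"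
    using eventually_gt_at_top[of 0]
  proof eventually_elim
    case (elim M)
    from b_of(1)[OF elim] show ?case by simp
  qed
  show "b_of q \<longlonglongrightarrow> 0"
  proof (rule tendstoI)
    fix e :: real assume e: "e > 0"
    have "\<forall>\<^sub>F M in sequentially. suminf (energy_term e) < real M"
      using filterlim_real_sequentially unfolding filterlim_at_top_dense by blast
    then show "\<forall>\<^sub>F M in sequentially. dist (b_of q M) 0 < e"
      using eventually_gt_at_top[of 0]
    proof eventually_elim
      case (elim M)
      from b_of(1)[OF elim(2)] b_of_less[OF e elim(1)] show ?case by simp
    qed
  qed
qed

section \<open>Deviations\<close>

lemma number_ge:
  assumes "0 < b" "b \<le> 1 / 4" "1 / b \<le> real J"
  shows "window_const 1 * bose 1 * b powr (- d) \<le> number b J"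
  unfolding number_def
proof (rule sum_window_ge_all)
  fix j :: nat assume j: "j \<ge> 1"
  then show "0 \<le> bose (b * real j)" using bose_pos[of "b * real j"] assms by simp
  assume "1 / 2 \<le> b * real j" "b * real j \<le> 1"
  then show "bose 1 \<le> bose (b * real j)" using j assms by (intro bose_antimono) auto
qed (use assms bose_pos[of 1] in auto)

text \<open>Conservation of the particle number expresses the deviation at level 0 as minus the sum
  of the others, up to the tail \<tau> of \<open>Nbar\<close>. Substituting replaces
  \<open>f j\<close> by \<open>f j - f 0\<close>, of modulus at most 2. The levels above
  \<open>J\<close> and the remainder \<open>f 0 * \<tau>\<close> contribute at most 1 each.\<close>

lemma cmod_deviation_le:
  assumes M: "M > 0" "M \<le> J" and n: "n \<in> Omega M N" and f: "\<And>j. cmod (f j) \<le> 1"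
    and tail: "Nbar q M - number (b_of q M) J \<le> 1"
  shows "cmod (\<Sum>j. f j * complex_of_real (real (n j) - Nbar_at q M N j))
    \<le> cmod (\<Sum>j=1..J. (f j - f 0) * complex_of_real (real (n j) - q j * bose (b_of q M * real j))) + 2"
proof -
  define b where "b = b_of q M"
  have b: "b > 0" using b_of[OF M(1)] by (simp add: b_def)
  define a where "a j = f j * complex_of_real (real (n j) - Nbar_at q M N j)" for j
  define \<tau> where "\<tau> = Nbar q M - number b J"
  have at: "Nbar_at q M N j = q j * bose (b * real j)" if "j \<ge> 1" for j
    using that by (simp add: Nbar_at_def b_def bose_def)
  have sm: "summable (\<lambda>i. number_term b (i + J))"
    using summable_number_term[OF b] by (subst summable_iff_shift)
  have tau: "(\<Sum>i. number_term b (i + J)) = \<tau>"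
    using suminf_split_initial_segment[OF summable_number_term[OF b], of J]
    by (simp add: \<tau>_def Nbar_eq b_def number_eq_sum)
  have anorm: "norm (a (i + Suc J)) \<le> number_term b (i + J)" for i
  proof -
    have "n (i + Suc J) = 0" using Omega_bounded(1)[OF n M(2)] by simp
    moreover have "Nbar_at q M N (i + Suc J) = number_term b (i + J)"
      using at[of "i + Suc J"] by (simp add: number_term_def)
    ultimately have "norm (a (i + Suc J)) = cmod (f (i + Suc J)) * number_term b (i + J)"
      using number_term_pos[OF b, of "i + J"] by (simp add: a_def norm_mult)
    also have "\<dots> \<le> 1 * number_term b (i + J)"
      using f number_term_pos[OF b, of "i + J"] by (intro mult_right_mono) auto
    finally show ?thesis by simp
  qed
  have sa: "summable (\<lambda>i. norm (a (i + Suc J)))"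
    using sm anorm by (intro summable_comparison_test'[OF sm, of 0]) auto
  have "summable (\<lambda>i. a (i + Suc J))" by (rule summable_norm_cancel[OF sa])
  then have "summable a" by (subst (asm) summable_iff_shift)
  then have split: "suminf a = (\<Sum>i. a (i + Suc J)) + (\<Sum>i<Suc J. a i)"
    by (rule suminf_split_initial_segment)
  have tn: "cmod (\<Sum>i. a (i + Suc J)) \<le> \<tau>"
  proof -
    have "cmod (\<Sum>i. a (i + Suc J)) \<le> (\<Sum>i. norm (a (i + Suc J)))" by (rule summable_norm[OF sa])
    also have "\<dots> \<le> (\<Sum>i. number_term b (i + J))" by (rule suminf_le[OF anorm sa sm])
    finally show ?thesis by (simp add: tau)
  qed
  have "0 \<le> (\<Sum>i. number_term b (i + J))"
    using number_term_pos[OF b] by (intro suminf_nonneg sm) (simp add: less_imp_le)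
  then have tau01: "0 \<le> \<tau>" "\<tau> \<le> 1"
    unfolding tau using tail by (simp_all add: \<tau>_def b_def)
  have "(\<Sum>i<Suc J. a i) = a 0 + (\<Sum>j=1..J. a j)"
    by (simp only: lessThan_Suc_atMost atMost_atLeast0 sum.atLeast_Suc_atMost[OF le0] One_nat_def)
  \<comment> \<open>\<open>Nbar_at\<close> at level 0 is \<open>N - Nbar\<close>, so
    \<open>N\<close> drops out here.\<close>
  also have "a 0 = f 0 * complex_of_real \<tau>
      - (\<Sum>j=1..J. f 0 * complex_of_real (real (n j) - q j * bose (b * real j)))"
  proof -
    have "real (n 0) + (\<Sum>j=1..J. real (n j)) = real N"
      using Omega_bounded(2)[OF n M(2)] by (metis of_nat_add of_nat_sum)
    then have "real (n 0) - Nbar_at q M N 0 = \<tau> - (\<Sum>j=1..J. real (n j) - q j * bose (b * real j))"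
      by (simp add: Nbar_at_def \<tau>_def number_def sum_subtractf)
    then have "a 0 = f 0 * complex_of_real (\<tau> - (\<Sum>j=1..J. real (n j) - q j * bose (b * real j)))"
      by (simp only: a_def)
    then show ?thesis by (simp add: right_diff_distrib sum_distrib_left)
  qed
  also have "(\<Sum>j=1..J. a j) = (\<Sum>j=1..J. f j * complex_of_real (real (n j) - q j * bose (b * real j)))"
    by (intro sum.cong refl) (simp add: a_def at)
  finally have "(\<Sum>i<Suc J. a i) = f 0 * complex_of_real \<tau>
      + (\<Sum>j=1..J. (f j - f 0) * complex_of_real (real (n j) - q j * bose (b * real j)))"
    by (simp add: left_diff_distrib sum_subtractf)
  then have "suminf a = (\<Sum>i. a (i + Suc J)) + f 0 * complex_of_real \<tau>
      + (\<Sum>j=1..J. (f j - f 0) * complex_of_real (real (n j) - q j * bose (b * real j)))"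
    using split by simp
  also have "cmod \<dots> \<le> cmod (\<Sum>i. a (i + Suc J)) + cmod (f 0 * complex_of_real \<tau>)
      + cmod (\<Sum>j=1..J. (f j - f 0) * complex_of_real (real (n j) - q j * bose (b * real j)))"
    by (intro order_trans[OF norm_triangle_ineq] add_right_mono norm_triangle_ineq)
  also have "cmod (f 0 * complex_of_real \<tau>) \<le> 1 * \<tau>"
    using f tau01 unfolding norm_mult by (intro mult_mono) auto
  finally show ?thesis using tn tau01 unfolding a_def b_def by linarith
qed

text \<open>Choice of the Markov parameter \<open>t\<close>. The variance term has to stay of order
  \<open>ln (1 / b)\<close> while \<open>t * Delta\<close> is at least of order
  \<open>\<chi> x * ln (1 / b)\<close>. The \<open>- 2\<close> accounts for the error in
  \<open>cmod_deviation_le\<close>.\<close>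

lemma exponent_bound:
  assumes cN: "cN > 0"
  shows "\<exists>c>0. \<exists>C. \<forall>\<^sub>F b in at_right 0. \<exists>t. 0 \<le> t \<and> t \<le> b / 4 \<and>
    (\<forall>J x. cN * b powr (- d) \<le> x \<longrightarrow> \<chi> x \<ge> 0 \<longrightarrow>
      - t * (Delta d \<chi> x - 2) / 2 + 2 * t\<^sup>2 * (\<Sum>j=1..J. q j * bvar (b / 2 * real j)) \<le> (C - c * \<chi> x) * ln (1 / b))"
proof -
  have ev1: "\<forall>\<^sub>F b in at_right 0. 0 < b \<and> b < (1 / 4 :: real)"
    using eventually_at_right_real[of 0 "1 / 4 :: real"] by simp
  \<comment> \<open>Any exponent strictly between \<open>- d\<close> and 0 absorbs the constant
    \<open>cN\<close>; -1/2 yields \<open>ln x \<ge> ln (1 / b) / 2\<close>.\<close>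
  have ev2: "\<forall>\<^sub>F b in at_right 0. b powr (- 1 / 2) \<le> cN * b powr (- d)"
    using cN d_gt by real_asymp
  have ev3: "\<forall>\<^sub>F b in at_right 0. 1 + ln (1 / (b / 2)) \<le> 2 * ln (1 / b) \<and> 1 \<le> ln (1 / b :: real)"
    by (intro eventually_conj; real_asymp)
  have lnx: "ln x \<ge> ln (1 / b) / 2" "x \<ge> 1" if "b powr (- 1 / 2) \<le> cN * b powr (- d)" "cN * b powr (- d) \<le> x"
      "0 < b" "b < 1 / 4" for b x :: real
  proof -
    have x: "b powr (- 1 / 2) \<le> x" using that by linarith
    have "1 \<le> b powr (- 1 / 2)" using that powr_mono'[of "- 1 / 2" 0 b] by simp
    then show x1: "x \<ge> 1" using x by linarith
    have "ln (b powr (- 1 / 2)) \<le> ln x" using x x1 that by (subst ln_le_cancel_iff) auto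
    then show "ln x \<ge> ln (1 / b) / 2" using that by (simp add: ln_powr ln_div)
  qed
  show ?thesis
  proof (cases "d > 2")
    case False
    obtain Cv where Cv: "Cv > 0" "\<And>b J. 0 < b \<Longrightarrow> b \<le> 1 \<Longrightarrow>
        (\<Sum>j=1..J. q j * bvar (b * real j)) \<le> Cv / b\<^sup>2 * (1 + ln (1 / b))"
      using sum_bvar_le_le2 False by (metis linorder_not_less)
    have "\<forall>\<^sub>F b in at_right 0. \<exists>t. 0 \<le> t \<and> t \<le> b / 4 \<and>
      (\<forall>J x. cN * b powr (- d) \<le> x \<longrightarrow> \<chi> x \<ge> 0 \<longrightarrow>
        - t * (Delta d \<chi> x - 2) / 2 + 2 * t\<^sup>2 * (\<Sum>j=1..J. q j * bvar (b / 2 * real j))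
          \<le> (1 + Cv / 4 - cN powr (1 / d) / 32 * \<chi> x) * ln (1 / b))"
      using ev1 ev2 ev3
    proof eventually_elim
      case (elim b)
      define l where "l = ln (1 / b)"
      have b: "0 < b" "b < 1 / 4" using elim by auto
      show ?case
      \<comment> \<open>For \<open>d \<le> 2\<close> the parameter has the largest admissible order
        \<open>b\<close>: against it stand \<open>Delta\<close> of order
        \<open>ln (1 / b) / b\<close> times \<chi> and a variance bound of order
        \<open>ln (1 / b) / b\<^sup>2\<close>.\<close>
      proof (intro exI[of _ "b / 8"] conjI allI impI)
        fix J x assume x: "cN * b powr (- d) \<le> x" and \<chi>: "0 \<le> \<chi> x"
        note lx = lnx[OF elim(2) x b, folded l_def]
        have l1: "1 \<le> l" using elim by (simp add: l_def)
        have "(cN * b powr (- d)) powr (1 / d) \<le> x powr (1 / d)"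
          using x cN d_gt by (intro powr_mono2) auto
        moreover have "(cN * b powr (- d)) powr (1 / d) = cN powr (1 / d) / b"
          using cN b d_gt by (simp add: powr_divide powr_powr powr_minus_divide)
        ultimately have "cN powr (1 / d) / b * (l / 2) \<le> x powr (1 / d) * ln x"
          using lx l1 by (intro mult_mono) auto
        then have "cN powr (1 / d) / b * (l / 2) * \<chi> x \<le> x powr (1 / d) * ln x * \<chi> x"
          using \<chi> by (rule mult_right_mono)
        then have "cN powr (1 / d) / b * (l / 2) * \<chi> x \<le> Delta d \<chi> x"
          using False by (simp only: Delta_def if_False)
        then have "b / 16 * (cN powr (1 / d) / b * (l / 2) * \<chi> x) \<le> b / 16 * Delta d \<chi> x"
          using b by (intro mult_left_mono) auto
        moreover have "b / 16 * (cN powr (1 / d) / b * (l / 2) * \<chi> x) = cN powr (1 / d) / 32 * \<chi> x * l"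
          using b by simp
        moreover have "(\<Sum>j=1..J. q j * bvar (b / 2 * real j)) \<le> Cv / (b / 2)\<^sup>2 * (2 * l)"
        proof -
          have "(\<Sum>j=1..J. q j * bvar (b / 2 * real j)) \<le> Cv / (b / 2)\<^sup>2 * (1 + ln (1 / (b / 2)))"
            using b by (intro Cv) auto
          also have "\<dots> \<le> Cv / (b / 2)\<^sup>2 * (2 * l)"
            using elim Cv(1) by (intro mult_left_mono) (auto simp: l_def)
          finally show ?thesis .
        qed
        then have "2 * (b / 8)\<^sup>2 * (\<Sum>j=1..J. q j * bvar (b / 2 * real j)) \<le> 2 * (b / 8)\<^sup>2 * (Cv / (b / 2)\<^sup>2 * (2 * l))"
          by (intro mult_left_mono) auto
        moreover have "2 * (b / 8)\<^sup>2 * (Cv / (b / 2)\<^sup>2 * (2 * l)) = Cv / 4 * l"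
          using b by (simp add: power2_eq_square)
        moreover have "- (b / 8) * (Delta d \<chi> x - 2) / 2 = b / 8 - b / 16 * Delta d \<chi> x"
          by (simp add: field_simps)
        moreover have "(1 + Cv / 4 - cN powr (1 / d) / 32 * \<chi> x) * l = l + Cv / 4 * l - cN powr (1 / d) / 32 * \<chi> x * l"
          by (simp only: left_diff_distrib distrib_right mult_1)
        ultimately have "- (b / 8) * (Delta d \<chi> x - 2) / 2 + 2 * (b / 8)\<^sup>2 * (\<Sum>j=1..J. q j * bvar (b / 2 * real j))
            \<le> (1 + Cv / 4 - cN powr (1 / d) / 32 * \<chi> x) * l"
          using l1 b by linarith
        then show "- (b / 8) * (Delta d \<chi> x - 2) / 2 + 2 * (b / 8)\<^sup>2 * (\<Sum>j=1..J. q j * bvar (b / 2 * real j))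
            \<le> (1 + Cv / 4 - cN powr (1 / d) / 32 * \<chi> x) * ln (1 / b)" by (simp only: l_def)
      qed (use b in auto)
    qed
    then show ?thesis using cN by (intro exI[of _ "cN powr (1 / d) / 32"] conjI exI[of _ "1 + Cv / 4"]) auto
  next
    case True
    obtain Cv where Cv: "Cv > 0" "\<And>b J. 0 < b \<Longrightarrow> (\<Sum>j=1..J. q j * bvar (b * real j)) \<le> Cv * b powr (- d)"
      using sum_bvar_le_gt2[OF True] by metis
    have ev4: "\<forall>\<^sub>F b in at_right 0. sqrt (ln (1 / b) * b powr d) \<le> b / 4"
      using True by real_asymp
    have "\<forall>\<^sub>F b in at_right 0. \<exists>t. 0 \<le> t \<and> t \<le> b / 4 \<and>
      (\<forall>J x. cN * b powr (- d) \<le> x \<longrightarrow> \<chi> x \<ge> 0 \<longrightarrow>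
        - t * (Delta d \<chi> x - 2) / 2 + 2 * t\<^sup>2 * (\<Sum>j=1..J. q j * bvar (b / 2 * real j))
          \<le> (1 + 2 * Cv * 2 powr d - sqrt (cN / 2) / 2 * \<chi> x) * ln (1 / b))"
      using ev1 ev2 ev3 ev4
    proof eventually_elim
      case (elim b)
      define l where "l = ln (1 / b)"
      \<comment> \<open>For \<open>d > 2\<close> this balances
        \<open>t\<^sup>2 * b powr (- d)\<close> with \<open>ln (1 / b)\<close>; it is admissible,
        that is below \<open>b / 4\<close>, for small \<open>b\<close> because
        \<open>d > 2\<close>.\<close>
      define t where "t = sqrt (l * b powr d)"
      have b: "0 < b" "b < 1 / 4" using elim by auto
      have l1: "1 \<le> l" using elim by (simp add: l_def)
      have t: "0 \<le> t" "t \<le> b / 4" "t\<^sup>2 = l * b powr d" using elim(4) l1 by (auto simp: t_def l_def)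
      show ?case
      proof (rule exI[of _ t], intro conjI allI impI)
        fix J x assume x: "cN * b powr (- d) \<le> x" and \<chi>: "0 \<le> \<chi> x"
        note lx = lnx[OF elim(2) x b, folded l_def]
        have "cN * b powr (- d) * (l / 2) \<le> x * ln x" using x lx l1 cN by (intro mult_mono) auto
        then have "sqrt (cN * b powr (- d) * (l / 2)) \<le> sqrt (x * ln x)" by simp
        then have "t * sqrt (cN * b powr (- d) * (l / 2)) \<le> t * sqrt (x * ln x)" using t by (intro mult_left_mono)
        moreover have "t * sqrt (cN * b powr (- d) * (l / 2)) = sqrt (cN / 2) * l"
        proof -
          have "t * sqrt (cN * b powr (- d) * (l / 2)) = sqrt (l * b powr d * (cN * b powr (- d) * (l / 2)))"
            unfolding t_def by (rule real_sqrt_mult[symmetric])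
          also have "l * b powr d * (cN * b powr (- d) * (l / 2)) = (cN / 2) * l\<^sup>2 * (b powr d * b powr (- d))"
            by (simp add: power2_eq_square)
          also have "b powr d * b powr (- d) = 1" using b by (simp flip: powr_add)
          also have "sqrt (cN / 2 * l\<^sup>2 * 1) = sqrt (cN / 2) * l"
            using l1 by (simp only: mult_1_right real_sqrt_mult) simp
          finally show ?thesis .
        qed
        ultimately have "sqrt (cN / 2) * l * \<chi> x \<le> t * sqrt (x * ln x) * \<chi> x"
          using \<chi> by (intro mult_right_mono) auto
        then have D: "sqrt (cN / 2) * l * \<chi> x \<le> t * Delta d \<chi> x"
          using True lx by (simp add: Delta_def mult.assoc)
        have "2 * t\<^sup>2 * (\<Sum>j=1..J. q j * bvar (b / 2 * real j)) \<le> 2 * t\<^sup>2 * (Cv * (b / 2) powr (- d))"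
          using b by (intro mult_left_mono Cv) auto
        also have "\<dots> = 2 * Cv * l * (b powr d * (b / 2) powr (- d))" by (simp add: t)
        also have "b powr d * (b / 2) powr (- d) = 2 powr d"
          using b by (simp add: powr_minus powr_divide field_simps)
        finally have V: "2 * t\<^sup>2 * (\<Sum>j=1..J. q j * bvar (b / 2 * real j)) \<le> 2 * Cv * 2 powr d * l" by (simp add: mult_ac)
        have "- t * (Delta d \<chi> x - 2) / 2 = t - t * Delta d \<chi> x / 2" by (simp add: field_simps)
        moreover have "(1 + 2 * Cv * 2 powr d - sqrt (cN / 2) / 2 * \<chi> x) * l
            = l + 2 * Cv * 2 powr d * l - sqrt (cN / 2) * l * \<chi> x / 2"
          by (simp only: left_diff_distrib distrib_right mult_1) simp
        ultimately have "- t * (Delta d \<chi> x - 2) / 2 + 2 * t\<^sup>2 * (\<Sum>j=1..J. q j * bvar (b / 2 * real j))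
            \<le> (1 + 2 * Cv * 2 powr d - sqrt (cN / 2) / 2 * \<chi> x) * l"
          using D V t(2) l1 b by linarith
        then show "- t * (Delta d \<chi> x - 2) / 2 + 2 * t\<^sup>2 * (\<Sum>j=1..J. q j * bvar (b / 2 * real j))
            \<le> (1 + 2 * Cv * 2 powr d - sqrt (cN / 2) / 2 * \<chi> x) * ln (1 / b)" by (simp only: l_def)
      qed (use t in auto)
    qed
    then show ?thesis using cN
      by (intro exI[of _ "sqrt (cN / 2) / 2"] conjI exI[of _ "1 + 2 * Cv * 2 powr d"]) auto
  qed
qed

end

lemma Prob_le_1:
  assumes q: "\<And>j. q j > 0" and A: "A \<subseteq> Omega M N"
  shows "Prob q M N A \<le> 1"
proof -
  have w: "weight q n \<ge> 0" for n
    unfolding weight_def nb_def[symmetric] using nb_pos[OF q] by (intro prod_nonneg) (auto simp: less_imp_le)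
  have "weight_set q A \<le> weight_set q (Omega M N)"
    unfolding weight_set_def using A finite_Omega w by (intro sum_mono2) auto
  moreover have "weight_set q (Omega M N) \<ge> 0"
    unfolding weight_set_def using w by (intro sum_nonneg)
  ultimately show ?thesis by (auto simp: Prob_def divide_le_eq_1)
qed

section \<open>Assembly of the bounds for large \<open>M\<close>, then for all
  \<open>M\<close>\<close>

context level_weights
begin

lemma Prob_deviation_eventually_le:
  fixes \<chi> :: "real \<Rightarrow> real" and s :: real
  assumes q0: "q 0 \<ge> 1" and \<chi>: "filterlim \<chi> at_top at_top" and s: "s \<ge> 0"
  shows "\<forall>\<^sub>F M in sequentially. \<forall>N f. real N > Nbar q M \<longrightarrow> (\<forall>j. cmod (f j) \<le> 1) \<longrightarrow>
    Prob q M N {n \<in> Omega M N.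
        cmod (\<Sum>j. f j * complex_of_real (real (n j) - Nbar_at q M N j)) > Delta d \<chi> (Nbar q M)}
      \<le> Nbar q M powr (- s)"
proof -
  obtain K where K: "K > 0" "\<forall>\<^sub>F b in at_right 0. \<forall>J. b powr (- 2) \<le> real J \<longrightarrow> 2 \<le> energy b J \<longrightarrow> energy b J \<le> b powr (- d - 2) \<longrightarrow>
    (\<Sum>m | m \<in> configs {1..J} (nat \<lfloor>energy b J\<rfloor>) \<and> real (\<Sum>j=1..J. m j) \<le> number b J. wt J m)
      \<ge> b powr K * exp (b * real (nat \<lfloor>energy b J\<rfloor>)) * partition_fn b J"
    using good_weight_ge by (elim exE conjE)
  obtain CN where CN: "CN > 0" "\<And>b J. b > 0 \<Longrightarrow> number b J \<le> CN * b powr (- d)"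
    using sum_number_le unfolding number_def by metis
  obtain CE where CE: "CE > 0" "\<And>b J. b > 0 \<Longrightarrow> energy b J \<le> CE * b powr (- d - 1)"
    using sum_energy_le unfolding energy_def by metis
  define cN where "cN = window_const 1 * bose 1"
  have cN: "cN > 0" unfolding cN_def using window_const_pos[of 1] bose_pos[of 1] by simp
  obtain c C where c: "c > 0" and ex: "\<forall>\<^sub>F b in at_right 0. \<exists>t. 0 \<le> t \<and> t \<le> b / 4 \<and>
    (\<forall>J x. cN * b powr (- d) \<le> x \<longrightarrow> \<chi> x \<ge> 0 \<longrightarrow>
      - t * (Delta d \<chi> x - 2) / 2 + 2 * t\<^sup>2 * (\<Sum>j=1..J. q j * bvar (b / 2 * real j)) \<le> (C - c * \<chi> x) * ln (1 / b))"
    using exponent_bound[OF cN, where \<chi> = \<chi>] by (elim exE conjE)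
  define k where "k = nat \<lceil>q 0\<rceil>"
  have k: "q 0 \<le> real k" unfolding k_def by (rule real_nat_ceiling_ge)
  \<comment> \<open>The power of \<open>b\<close> needed in the numerator: \<open>K\<close> for the
    lower bound of the denominator, \<open>d * k\<close> for the factor of level 0,
    \<open>d * s\<close> for the claimed decay, and 1 to absorb constants in
    \<open>ev3\<close>.\<close>
  define R where "R = K + d * real k + d * s + 1"
  have ev1: "\<forall>\<^sub>F b in at_right 0. 0 < b \<and> b < (1 / 4 :: real)"
    using eventually_at_right_real[of 0 "1 / 4 :: real"] by simp
  have ev2: "\<forall>\<^sub>F b in at_right 0. CE * b powr (- d - 1) \<le> b powr (- d - 2)"
    using CE(1) by real_asymp
  have ev3: "\<forall>\<^sub>F b in at_right 0. 4 * exp 2 * (CN + 1) ^ k * b \<le> CN powr (- s)"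
  proof -
    have lim: "((\<lambda>b. 4 * exp 2 * (CN + 1) ^ k * b) \<longlongrightarrow> 4 * exp 2 * (CN + 1) ^ k * 0) (at_right 0)"
      by (intro tendsto_intros)
    show ?thesis
      by (rule eventually_mono[OF order_tendstoD(2)[OF lim, of "CN powr (- s)"]]) (use CN(1) in auto)
  qed
  note evs = K(2) ex ev1 ev2 ev3
  have evM: "\<forall>\<^sub>F M in sequentially. P (b_of q M)" if "\<forall>\<^sub>F b in at_right 0. P b" for P
    using eventually_compose_filterlim[OF that filterlim_b_of] .
  have Nbar_ge: "\<forall>\<^sub>F M in sequentially. cN * b_of q M powr (- d) \<le> Nbar q M"
    using evM[OF ev1] eventually_gt_at_top[of 0]
  proof eventually_elim
    case (elim M)
    obtain J where J: "1 / b_of q M \<le> real J" using real_arch_simple by blast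
    have "cN * b_of q M powr (- d) \<le> number (b_of q M) J"
      unfolding cN_def using elim J by (intro number_ge) auto
    also have "\<dots> \<le> Nbar q M"
      unfolding number_eq_sum Nbar_eq using elim number_term_pos summable_number_term
      by (intro sum_le_suminf) (auto simp: less_imp_le)
    finally show ?case .
  qed
  have "filterlim (\<lambda>b. cN * b powr (- d)) at_top (at_right 0)" using cN d_gt by real_asymp
  then have "filterlim (\<lambda>M. cN * b_of q M powr (- d)) at_top sequentially"
    using filterlim_compose[OF _ filterlim_b_of] by blast
  then have "filterlim (Nbar q) at_top sequentially" using Nbar_ge by (rule filterlim_at_top_mono)
  then have "filterlim (\<lambda>M. \<chi> (Nbar q M)) at_top sequentially" using filterlim_compose[OF \<chi>] by blast
  \<comment> \<open>From this size of \<chi> on, \<open>C - c * \<chi>\<close> is at most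
    \<open>- R\<close>. This is where the divergence of \<chi> is used, however slow it may
    be.\<close>
  then have evchi: "\<forall>\<^sub>F M in sequentially. max 0 ((C + R) / c) \<le> \<chi> (Nbar q M)"
    unfolding filterlim_at_top by blast
  show ?thesis
    using evs[THEN evM] Nbar_ge evchi eventually_ge_at_top[of 3]
  proof eventually_elim
    case (elim M)
    define b where "b = b_of q M"
    note el = elim[folded b_def]
    have M: "M > 0" using el by simp
    have b: "0 < b" "b < 1 / 4" using el(3) by auto
    have sumsE: "energy_term b sums real M" using b_of(2)[OF M] by (simp add: b_def)
    have sumsN: "number_term b sums Nbar q M"
      using summable_sums[OF summable_number_term[OF b(1)]] by (simp add: Nbar_eq b_def)
    have Epos: "\<And>i. 0 \<le> energy_term b i" and Npos: "\<And>i. 0 \<le> number_term b i"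
      using energy_term_pos[OF b(1)] number_term_pos[OF b(1)] by (auto simp: less_imp_le)
    have "energy b \<longlonglongrightarrow> real M" "number b \<longlonglongrightarrow> Nbar q M"
      using sumsE sumsN unfolding sums_def energy_eq_sum[abs_def] number_eq_sum[abs_def] by auto
    then have "\<forall>\<^sub>F J in sequentially. real M - 1 < energy b J" "\<forall>\<^sub>F J in sequentially. Nbar q M - 1 < number b J"
      by (auto intro!: order_tendstoD(1))
    moreover have "\<forall>\<^sub>F J in sequentially. max (b powr (- 2)) (1 / b) < real J"
      using filterlim_real_sequentially unfolding filterlim_at_top_dense by blast
    \<comment> \<open>The cutoff is chosen after \<open>M\<close>: it misses less than 1 of the
      energy and of the number, and exceeds \<open>M\<close>, \<open>1 / b\<close> and
      \<open>b powr (- 2)\<close>.\<close>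
    ultimately have "\<forall>\<^sub>F J in sequentially. real M - 1 < energy b J \<and> Nbar q M - 1 < number b J
        \<and> max (b powr (- 2)) (1 / b) < real J \<and> M \<le> J"
      using eventually_ge_at_top[of M] by eventually_elim simp
    from eventually_happens'[OF sequentially_bot this]
    obtain J where "real M - 1 < energy b J \<and> Nbar q M - 1 < number b J
        \<and> max (b powr (- 2)) (1 / b) < real J \<and> M \<le> J" by (elim exE)
    then have J: "real M - 1 < energy b J" "Nbar q M - 1 < number b J" "b powr (- 2) \<le> real J"
      "1 / b \<le> real J" "M \<le> J" by auto
    have EM: "energy b J \<le> real M"
      unfolding energy_eq_sum sums_unique[OF sumsE] using Epos sumsE by (intro sum_le_suminf) (auto simp: sums_iff)
    have NN: "number b J \<le> Nbar q M"
      unfolding number_eq_sum sums_unique[OF sumsN] using Npos sumsN by (intro sum_le_suminf) (auto simp: sums_iff)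
    define e where "e = nat \<lfloor>energy b J\<rfloor>"
    \<comment> \<open>\<open>e \<le> M\<close> places the shell inside \<open>Omega\<close>; the
      lower bound limits the mismatch of the factors \<open>exp (b * M)\<close> and
      \<open>exp (b * e)\<close> to \<open>exp 2\<close>.\<close>
    have e: "e \<le> M" "real M - 2 \<le> real e" using EM J(1) el(8) unfolding e_def by linarith+
    define g where "g = b powr K * exp (b * real e) * partition_fn b J"
    have g: "g > 0" "g \<le> (\<Sum>m | m \<in> configs {1..J} e \<and> real (\<Sum>j=1..J. m j) \<le> number b J. wt J m)"
    proof -
      show "g > 0" using b by (simp add: g_def partition_fn_def)
      have "energy b J \<le> b powr (- d - 2)" using CE(2)[OF b(1), of J] el(4) by linarith
      moreover have "2 \<le> energy b J" using J(1) el(8) by linarith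
      ultimately show "g \<le> (\<Sum>m | m \<in> configs {1..J} e \<and> real (\<Sum>j=1..J. m j) \<le> number b J. wt J m)"
        using el(1)[rule_format, of J] J(3) unfolding g_def e_def by blast
    qed
    obtain t where t: "0 \<le> t" "t \<le> b / 4" and tb: "\<forall>J x. cN * b powr (- d) \<le> x \<longrightarrow> \<chi> x \<ge> 0 \<longrightarrow>
        - t * (Delta d \<chi> x - 2) / 2 + 2 * t\<^sup>2 * (\<Sum>j=1..J. q j * bvar (b / 2 * real j)) \<le> (C - c * \<chi> x) * ln (1 / b)"
      using el(2) by (elim exE conjE)
    let ?x = "Nbar q M"
    define X where "X = - t * (Delta d \<chi> ?x - 2) / 2 + 2 * t\<^sup>2 * (\<Sum>j=1..J. q j * bvar (b / 2 * real j))"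
    have X: "exp X \<le> b powr R"
    proof -
      have "(C + R) / c \<le> \<chi> ?x" "0 \<le> \<chi> ?x" using el(7) by auto
      then have "C - c * \<chi> ?x \<le> - R" using c by (simp add: field_simps)
      then have "(C - c * \<chi> ?x) * ln (1 / b) \<le> - R * ln (1 / b)" using b by (intro mult_right_mono) auto
      moreover have "X \<le> (C - c * \<chi> ?x) * ln (1 / b)"
        unfolding X_def using tb el(6) \<open>0 \<le> \<chi> ?x\<close> by blast
      moreover have "- R * ln (1 / b) = R * ln b" using b by (simp add: ln_div)
      ultimately have "X \<le> R * ln b" by linarith
      then show ?thesis using b by (simp add: powr_def)
    qed
    have N0: "0 \<le> number b J" using Npos by (simp add: number_eq_sum sum_nonneg)
    show ?case
    proof (intro allI impI)
      fix N and f :: "nat \<Rightarrow> complex"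
      assume N: "real N > Nbar q M" and f: "\<forall>j. cmod (f j) \<le> 1"
      define A where "A = {n \<in> Omega M N.
        cmod (\<Sum>j. f j * complex_of_real (real (n j) - Nbar_at q M N j)) > Delta d \<chi> ?x}"
      have A: "A \<subseteq> Omega M N" by (auto simp: A_def)
      have f1: "cmod (f j) \<le> 1" for j using f by blast
      have f2: "cmod (f j - f 0) \<le> 2" for j
      proof -
        have "cmod (f j - f 0) \<le> cmod (f j) + cmod (f 0)" by (rule norm_triangle_ineq4)
        then show ?thesis using f1[of j] f1[of 0] by linarith
      qed
      have "(\<Sum>n\<in>A. wt J n) \<le> 4 * (exp (b * real M) * partition_fn b J * exp X)"
        unfolding X_def
      proof (rule deviation_weight_le[OF b(1) t J(5) A f2])
        fix n assume "n \<in> A"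
        then have n: "n \<in> Omega M N" "Delta d \<chi> ?x < cmod (\<Sum>j. f j * complex_of_real (real (n j) - Nbar_at q M N j))"
          by (auto simp: A_def)
        have "Nbar q M - number (b_of q M) J \<le> 1" using J(2) by (simp add: b_def)
        from cmod_deviation_le[where f = f, OF M J(5) n(1) f1 this] n(2)
        show "Delta d \<chi> ?x - 2 \<le> cmod (\<Sum>j=1..J. (f j - f 0) * complex_of_real (real (n j) - q j * bose (b * real j)))"
          unfolding b_def by linarith
      qed
      then have W: "(\<Sum>n\<in>A. wt J n) \<le> 4 * (exp (b * real M) * partition_fn b J * b powr R)"
        using X by (elim order_trans) (simp add: partition_fn_def)
      have nbk: "nb (q 0) (nat \<lfloor>number b J\<rfloor>) \<le> ((CN + 1) * b powr (- d)) ^ k"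
      proof -
        have "nb (q 0) (nat \<lfloor>number b J\<rfloor>) \<le> (real (nat \<lfloor>number b J\<rfloor>) + 1) ^ k" by (rule nb_le_power[OF q0 k])
        also have "\<dots> \<le> ((CN + 1) * b powr (- d)) ^ k"
        proof (rule power_mono)
          have "1 \<le> b powr (- d)" using b d_gt powr_mono'[of "- d" 0 b] by simp
          moreover have "real (nat \<lfloor>number b J\<rfloor>) \<le> number b J" using N0 by simp
          ultimately show "real (nat \<lfloor>number b J\<rfloor>) + 1 \<le> (CN + 1) * b powr (- d)"
            using CN(2)[OF b(1), of J] by (simp add: distrib_right)
        qed simp
        finally show ?thesis .
      qed
      \<comment> \<open>Here the hypothesis on \<open>N\<close> enters:
        \<open>number b J \<le> Nbar < N\<close>.\<close>
      have "Prob q M N A \<le> nb (q 0) (nat \<lfloor>number b J\<rfloor>) * (\<Sum>n\<in>A. wt J n) / g"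
        using N NN by (intro Prob_le[OF q0 J(5) N0 _ e(1) A g(2,1)]) linarith
      also have "\<dots> \<le> ((CN + 1) * b powr (- d)) ^ k * (4 * (exp (b * real M) * partition_fn b J * b powr R)) / g"
        using nbk W wt_pos g q0 nb_pos CN(1)
        by (intro divide_right_mono mult_mono) (auto intro!: sum_nonneg simp: less_imp_le)
      also have "\<dots> = (4 * (CN + 1) ^ k) * ((b powr (- d)) ^ k * b powr R / b powr K) * exp (b * real M - b * real e)"
        by (simp add: g_def exp_diff power_mult_distrib partition_fn_def)
      also have "(b powr (- d)) ^ k * b powr R / b powr K = b powr (d * s) * b"
      proof -
        have "(b powr (- d)) ^ k = b powr (- d * real k)"
          using b by (simp add: powr_powr flip: powr_realpow)
        then have "(b powr (- d)) ^ k * b powr R / b powr K = b powr (- d * real k + R - K)"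
          by (simp only: powr_add powr_diff)
        also have "- d * real k + R - K = d * s + 1" by (simp add: R_def)
        finally show ?thesis using b by (simp add: powr_add)
      qed
      also have "(4 * (CN + 1) ^ k) * (b powr (d * s) * b) * exp (b * real M - b * real e)
          \<le> (4 * (CN + 1) ^ k) * (b powr (d * s) * b) * exp 2"
      proof (rule mult_left_mono)
        have "b * (real M - real e) \<le> 1 * 2" using b e by (intro mult_mono) auto
        then show "exp (b * real M - b * real e) \<le> exp 2" by (simp add: right_diff_distrib)
      qed (use b CN in auto)
      also have "\<dots> = (4 * exp 2 * (CN + 1) ^ k * b) * b powr (d * s)" by simp
      also have "\<dots> \<le> CN powr (- s) * b powr (d * s)" using el(5) by (intro mult_right_mono) auto
      also have "\<dots> = (CN * b powr (- d)) powr (- s)" using CN(1) by (simp add: powr_mult powr_powr)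
      also have "\<dots> \<le> ?x powr (- s)"
      proof (rule powr_mono2')
        show "?x \<le> CN * b powr (- d)"
          by (rule LIMSEQ_le_const2[OF sumsN[unfolded sums_def]]) (use CN(2)[OF b(1)] in \<open>auto simp: number_eq_sum\<close>)
      qed (use s Nbar_pos[OF M] in auto)
      finally show "Prob q M N {n \<in> Omega M N.
          cmod (\<Sum>j. f j * complex_of_real (real (n j) - Nbar_at q M N j)) > Delta d \<chi> ?x} \<le> ?x powr (- s)"
        by (simp only: A_def)
    qed
  qed
qed

text \<open>The threshold \<open>M0 s\<close> is uniform in \<open>N\<close> and \<open>f\<close>,
  so only finitely many \<open>M\<close> remain for each \<open>s\<close>; for them the trivial
  bound 1 is enough.\<close>

lemma Prob_deviation_le:
  fixes \<chi> :: "real \<Rightarrow> real"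
  assumes q0: "q 0 \<ge> 1" and \<chi>: "filterlim \<chi> at_top at_top"
  shows "\<exists>C :: nat \<Rightarrow> real. (\<forall>s\<ge>1. C s > 0) \<and>
    (\<forall>(M::nat) (N::nat) (f :: nat \<Rightarrow> complex).
       M > 0 \<longrightarrow> N > 0 \<longrightarrow> real N > Nbar q M \<longrightarrow> (\<forall>j. cmod (f j) \<le> 1) \<longrightarrow>
       (\<forall>s\<ge>1. Prob q M N {n \<in> Omega M N.
            cmod (\<Sum>j. f j * complex_of_real (real (n j) - Nbar_at q M N j))
              > Delta d \<chi> (Nbar q M)}
          \<le> C s * Nbar q M powr (- real s)))"
proof -
  let ?A = "\<lambda>M N f. {n \<in> Omega M N. cmod (\<Sum>j. f j * complex_of_real (real (n j) - Nbar_at q M N j))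
    > Delta d \<chi> (Nbar q M)}"
  have "\<forall>s :: nat. \<exists>M0. \<forall>M\<ge>M0. \<forall>N f. real N > Nbar q M \<longrightarrow> (\<forall>j. cmod (f j) \<le> 1) \<longrightarrow>
      Prob q M N (?A M N f) \<le> Nbar q M powr (- real s)"
  proof
    fix s :: nat
    show "\<exists>M0. \<forall>M\<ge>M0. \<forall>N f. real N > Nbar q M \<longrightarrow> (\<forall>j. cmod (f j) \<le> 1) \<longrightarrow>
        Prob q M N (?A M N f) \<le> Nbar q M powr (- real s)"
      using Prob_deviation_eventually_le[OF q0 \<chi> of_nat_0_le_iff, of s]
      unfolding eventually_sequentially .
  qed
  from choice[OF this] obtain M0 where M0: "\<forall>s. \<forall>M\<ge>M0 s. \<forall>N f. real N > Nbar q M \<longrightarrow>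
      (\<forall>j. cmod (f j) \<le> 1) \<longrightarrow> Prob q M N (?A M N f) \<le> Nbar q M powr (- real s)" by (elim exE)
  \<comment> \<open>The summand 1 covers large \<open>M\<close>; the sum dominates
    \<open>Nbar q M powr s\<close> for each small \<open>M\<close>, so that the right-hand side is
    at least 1 there.\<close>
  define C where "C s = 1 + (\<Sum>M\<in>{1..<M0 s}. Nbar q M powr real s)" for s
  have C1: "C s \<ge> 1" for s unfolding C_def by (simp add: sum_nonneg)
  have qp: "q j > 0" for j using q_pos[of j] q0 by (cases "j = 0") auto
  show ?thesis
  proof (intro exI[of _ C] conjI allI impI)
    show "C s > 0" for s using C1[of s] by linarith
    fix M N :: nat and f :: "nat \<Rightarrow> complex" and s :: nat
    assume M: "M > 0" and N: "real N > Nbar q M" and f: "\<forall>j. cmod (f j) \<le> 1"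
    have p: "Nbar q M powr (- real s) > 0" using Nbar_pos[OF M] by simp
    show "Prob q M N (?A M N f) \<le> C s * Nbar q M powr (- real s)"
    proof (cases "M \<ge> M0 s")
      case True
      have "1 * Nbar q M powr (- real s) \<le> C s * Nbar q M powr (- real s)"
        using C1 p by (intro mult_right_mono) auto
      with M0[rule_format, OF True N, of f] f show ?thesis by simp
    next
      case False
      have "Nbar q M powr real s \<le> (\<Sum>M\<in>{1..<M0 s}. Nbar q M powr real s)"
        using False M by (intro member_le_sum) auto
      then have "Nbar q M powr real s * Nbar q M powr (- real s) \<le> C s * Nbar q M powr (- real s)"
        using p unfolding C_def by (intro mult_right_mono) auto
      moreover have "Nbar q M powr real s * Nbar q M powr (- real s) = 1"
        using Nbar_pos[OF M] by (simp flip: powr_add)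
      moreover have "Prob q M N (?A M N f) \<le> 1" by (rule Prob_le_1[OF qp]) auto
      ultimately show ?thesis by linarith
    qed
  qed
qed

end

text \<open>The ratio of the two sides converges to 1, and so does its inverse. Convergent sequences
  are bounded, and together with positivity of \<open>q\<close> this gives constants valid for every
  \<open>j \<ge> 1\<close>, not only eventually.\<close>

lemma level_weights_of_asymp_equiv:
  fixes q :: "nat \<Rightarrow> real"
  assumes "d > 1" "Q > 0" "\<And>j. j \<ge> 1 \<Longrightarrow> q j > 0" "q \<sim>[at_top] (\<lambda>j. Q * real j powr (d - 1))"
  shows "\<exists>c0 C0. level_weights q d c0 C0"
proof -
  define r where "r j = q j / (Q * real j powr (d - 1))" for j
  have rpos: "r j > 0" if "j \<ge> 1" for j using assms(2,3) that by (simp add: r_def)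
  have "\<forall>\<^sub>F j in at_top. q j \<noteq> 0 \<or> Q * real j powr (d - 1) \<noteq> 0"
    using eventually_ge_at_top[of 1] by eventually_elim (use assms(3) in force)
  then have lim: "r \<longlonglongrightarrow> 1" unfolding r_def using asymp_equivD_strong[OF assms(4)] by simp
  then have "Bseq r" by (intro convergent_imp_Bseq convergentI)
  then obtain B where B: "B > 0" "\<And>j. norm (r j) \<le> B" unfolding Bseq_def by auto
  have "(\<lambda>j. inverse (r j)) \<longlonglongrightarrow> inverse 1" using lim by (intro tendsto_inverse) auto
  then have "Bseq (\<lambda>j. inverse (r j))" by (intro convergent_imp_Bseq convergentI)
  then obtain B' where B': "B' > 0" "\<And>j. norm (inverse (r j)) \<le> B'" unfolding Bseq_def by auto
  have "level_weights q d (Q / B') (B * Q)"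
  proof
    fix j :: nat assume j: "j \<ge> 1"
    have q: "q j = r j * (Q * real j powr (d - 1))" using j assms(2) by (simp add: r_def)
    have "inverse (r j) \<le> B'" using B'(2)[of j] rpos[OF j] by simp
    then have "1 / B' \<le> r j" using rpos[OF j] B'(1) by (simp add: field_simps)
    then have "1 / B' * (Q * real j powr (d - 1)) \<le> q j" unfolding q using assms(2) by (intro mult_right_mono) auto
    then show "Q / B' * real j powr (d - 1) \<le> q j" by simp
    have "r j \<le> B" using B(2)[of j] rpos[OF j] by simp
    then have "r j * (Q * real j powr (d - 1)) \<le> B * (Q * real j powr (d - 1))"
      using assms(2) by (intro mult_right_mono) auto
    then show "q j \<le> B * Q * real j powr (d - 1)" unfolding q by simp
  qed (use assms B B' in auto)
  then show ?thesis by blast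
qed

theorem theorem3:
  fixes d Q :: real and q :: "nat \<Rightarrow> real" and \<chi> :: "real \<Rightarrow> real"
  assumes "d > 1" and "Q > 0"
    and "\<And>j. j \<ge> 1 \<Longrightarrow> q j > 0"
    and "q \<sim>[at_top] (\<lambda>j. Q * real j powr (d - 1))"
    and "q 0 \<ge> 1"
    and "\<And>x. x \<ge> 0 \<Longrightarrow> \<chi> x > 0"
    and "filterlim \<chi> at_top at_top"
  shows "\<exists>C :: nat \<Rightarrow> real. (\<forall>s\<ge>1. C s > 0) \<and>
    (\<forall>(M::nat) (N::nat) (f :: nat \<Rightarrow> complex).
       M > 0 \<longrightarrow> N > 0 \<longrightarrow> real N > Nbar q M \<longrightarrow> (\<forall>j. cmod (f j) \<le> 1) \<longrightarrow>
       (\<forall>s\<ge>1. Prob q M N {n \<in> Omega M N.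
            cmod (\<Sum>j. f j * complex_of_real (real (n j) - Nbar_at q M N j))
              > Delta d \<chi> (Nbar q M)}
          \<le> C s * Nbar q M powr (- real s)))"
proof -
  obtain c0 C0 where "level_weights q d c0 C0"
    using level_weights_of_asymp_equiv[OF assms(1-4)] by blast
  then interpret level_weights q d c0 C0 .
  show ?thesis by (rule Prob_deviation_le[OF assms(5,7)])
qed

end
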